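(* Let $u\in L^2(\mathbb{R})\cap L^\infty(\mathbb{R})$ be real-valued. Then $L_u=\frac{1}{i}\partial_x-C_+uC_+$ is a relatively compact perturbation of $\frac{1}{i}\partial_x$ on $H^+$ (i.e. $C_+uC_+$ is relatively compact with respect to the operator $\frac1i\partial_x$ on $H^+$ with domain $H^+\cap H^1(\mathbb{R})$), and $L_u$ is self-adjoint on $H^+$ with domain $H^+\cap H^1(\mathbb{R})$.
   Context: Fourier transform convention: $\hat f(\xi)=\int_{\mathbb{R}}e^{-ix\xi}f(x)\,dx$. $H^+$ is the Hardy space of (complex-valued) functions in $L^2(\mathbb{R})$ whose Fourier transform is supported on $[0,\infty)$, a Hilbert space with the $L^2$ inner product. $C_+$ is the Cauchy projection, $\widehat{C_+\varphi}=\chi_{\mathbb{R}_+}\hat\varphi$, i.e. the orthogonal projection of $L^2(\mathbb{R})$ onto $H^+$. $H^1(\mathbb{R})$ is the $L^2$-based Sobolev space of order one. $C_+uC_+$ denotes the operator $\varphi\mapsto C_+(u\,C_+\varphi)$. *)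

theory Defs
  imports "HOL-Analysis.Analysis"
begin

text \<open>
  Elements of \<open>L\<^sup>2(\<real>)\<close> are represented by Borel measurable functions; functions that agree
  almost everywhere stand for the same element, and equality of elements is \<open>eq_ae\<close>.
\<close>

definition eq_ae :: "(real \<Rightarrow> 'a) \<Rightarrow> (real \<Rightarrow> 'a) \<Rightarrow> bool" where
  "eq_ae f g \<longleftrightarrow> (AE x in lborel. f x = g x)"

definition L2 :: "(real \<Rightarrow> 'a::real_normed_vector) set" where
  "L2 = {f. f \<in> borel_measurable lborel \<and> integrable lborel (\<lambda>x. (norm (f x))\<^sup>2)}"

definition Linf :: "(real \<Rightarrow> 'a::real_normed_vector) set" where
  "Linf = {f. f \<in> borel_measurable lborel \<and> (\<exists>C. AE x in lborel. norm (f x) \<le> C)}"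

definition l2_inner :: "(real \<Rightarrow> complex) \<Rightarrow> (real \<Rightarrow> complex) \<Rightarrow> complex" where
  "l2_inner f g = (LINT x|lborel. f x * cnj (g x))"

definition l2_norm :: "(real \<Rightarrow> 'a::real_normed_vector) \<Rightarrow> real" where
  "l2_norm f = sqrt (LINT x|lborel. (norm (f x))\<^sup>2)"

text \<open>
  Membership in \<open>L2\<close> is part of convergence because the Bochner integral of a non-integrable
  function is 0, so that \<open>l2_norm\<close> is only meaningful on \<open>L2\<close>.
\<close>

definition l2_tendsto ::
    "(nat \<Rightarrow> real \<Rightarrow> 'a::real_normed_vector) \<Rightarrow> (real \<Rightarrow> 'a) \<Rightarrow> bool" where
  "l2_tendsto F f \<longleftrightarrow> (\<forall>n. F n \<in> L2) \<and> f \<in> L2 \<and>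
     (\<lambda>n. l2_norm (\<lambda>x. F n x - f x)) \<longlonglongrightarrow> 0"

text \<open>
  The integral defining the Fourier transform need not converge for \<open>f \<in> L2\<close>. As usual, the
  transform is the limit in \<open>L2\<close> of the transforms of the truncations of \<open>f\<close> to \<open>[-n, n]\<close>
  (which are integrable); \<open>SOME\<close> picks a representative of this limit.
\<close>

definition fourier_trunc :: "(real \<Rightarrow> complex) \<Rightarrow> nat \<Rightarrow> real \<Rightarrow> complex" where
  "fourier_trunc f n \<xi> =
     (LINT x:{- real n..real n}|lborel. exp (- (\<i> * complex_of_real (x * \<xi>))) * f x)"

definition fourier :: "(real \<Rightarrow> complex) \<Rightarrow> real \<Rightarrow> complex" where
  "fourier f = (SOME g. l2_tendsto (fourier_trunc f) g)"

definition Hardy :: "(real \<Rightarrow> complex) set" where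
  "Hardy = {f \<in> L2. AE \<xi> in lborel. \<xi> < 0 \<longrightarrow> fourier f \<xi> = 0}"

definition cauchy_proj :: "(real \<Rightarrow> complex) \<Rightarrow> real \<Rightarrow> complex" where
  "cauchy_proj f = (SOME g. g \<in> L2 \<and> eq_ae (fourier g) (\<lambda>\<xi>. indicator {0..} \<xi> * fourier f \<xi>))"

text \<open>
  Weak derivatives. Real-valued test functions suffice, by linearity of the defining identity
  in the test function.
\<close>

definition test_function :: "(real \<Rightarrow> real) \<Rightarrow> bool" where
  "test_function \<phi> \<longleftrightarrow> (\<forall>k. (deriv ^^ k) \<phi> differentiable_on UNIV) \<and>
     (\<exists>R. \<forall>x. \<bar>x\<bar> > R \<longrightarrow> \<phi> x = 0)"

definition has_weak_deriv :: "(real \<Rightarrow> complex) \<Rightarrow> (real \<Rightarrow> complex) \<Rightarrow> bool" where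
  "has_weak_deriv f g \<longleftrightarrow> (\<forall>\<phi>. test_function \<phi> \<longrightarrow>
     (LINT x|lborel. f x * complex_of_real (deriv \<phi> x)) =
     - (LINT x|lborel. g x * complex_of_real (\<phi> x)))"

definition Sobolev1 :: "(real \<Rightarrow> complex) set" where
  "Sobolev1 = {f \<in> L2. \<exists>g \<in> L2. has_weak_deriv f g}"

definition weak_deriv :: "(real \<Rightarrow> complex) \<Rightarrow> real \<Rightarrow> complex" where
  "weak_deriv f = (SOME g. g \<in> L2 \<and> has_weak_deriv f g)"

definition momentum :: "(real \<Rightarrow> complex) \<Rightarrow> real \<Rightarrow> complex" where
  "momentum f = (\<lambda>x. (1 / \<i>) * weak_deriv f x)"

definition cauchy_mult :: "(real \<Rightarrow> real) \<Rightarrow> (real \<Rightarrow> complex) \<Rightarrow> real \<Rightarrow> complex" where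
  "cauchy_mult u f = cauchy_proj (\<lambda>x. complex_of_real (u x) * cauchy_proj f x)"

definition Lax :: "(real \<Rightarrow> real) \<Rightarrow> (real \<Rightarrow> complex) \<Rightarrow> real \<Rightarrow> complex" where
  "Lax u f = (\<lambda>x. momentum f x - cauchy_mult u f x)"

text \<open>
  Unbounded operators in a subspace \<open>H\<close> of \<open>L2\<close>, given by a domain \<open>D\<close> and a map \<open>A\<close> whose
  values outside \<open>D\<close> are irrelevant. The last condition says that \<open>D\<close> and \<open>A\<close> are well defined
  on classes modulo almost everywhere equality.
\<close>

definition linear_operator_in ::
    "(real \<Rightarrow> complex) set \<Rightarrow> (real \<Rightarrow> complex) set \<Rightarrow>
     ((real \<Rightarrow> complex) \<Rightarrow> real \<Rightarrow> complex) \<Rightarrow> bool" where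
  "linear_operator_in H D A \<longleftrightarrow>
     D \<subseteq> H \<and> (\<forall>f\<in>D. A f \<in> H) \<and> (\<lambda>x. 0) \<in> D \<and>
     (\<forall>f\<in>D. \<forall>g\<in>D. (\<lambda>x. f x + g x) \<in> D \<and>
        eq_ae (A (\<lambda>x. f x + g x)) (\<lambda>x. A f x + A g x)) \<and>
     (\<forall>c. \<forall>f\<in>D. (\<lambda>x. c * f x) \<in> D \<and> eq_ae (A (\<lambda>x. c * f x)) (\<lambda>x. c * A f x)) \<and>
     (\<forall>f\<in>D. \<forall>g\<in>L2. eq_ae f g \<longrightarrow> g \<in> D \<and> eq_ae (A f) (A g))"

definition densely_defined_in :: "(real \<Rightarrow> complex) set \<Rightarrow> (real \<Rightarrow> complex) set \<Rightarrow> bool" where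
  "densely_defined_in H D \<longleftrightarrow> (\<forall>f\<in>H. \<exists>F. (\<forall>n. F n \<in> D) \<and> l2_tendsto F f)"

definition operator_graph ::
    "(real \<Rightarrow> complex) set \<Rightarrow> (real \<Rightarrow> complex) set \<Rightarrow>
     ((real \<Rightarrow> complex) \<Rightarrow> real \<Rightarrow> complex) \<Rightarrow> ((real \<Rightarrow> complex) \<times> (real \<Rightarrow> complex)) set" where
  "operator_graph H D A = {(g, h). g \<in> D \<and> h \<in> H \<and> eq_ae h (A g)}"

definition adjoint_graph ::
    "(real \<Rightarrow> complex) set \<Rightarrow> (real \<Rightarrow> complex) set \<Rightarrow>
     ((real \<Rightarrow> complex) \<Rightarrow> real \<Rightarrow> complex) \<Rightarrow> ((real \<Rightarrow> complex) \<times> (real \<Rightarrow> complex)) set" where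
  "adjoint_graph H D A =
     {(g, h). g \<in> H \<and> h \<in> H \<and> (\<forall>f\<in>D. l2_inner (A f) g = l2_inner f h)}"

text \<open>Equality of the graphs expresses \<open>A\<^sup>* = A\<close>, including equality of the domains.\<close>

definition self_adjoint_in ::
    "(real \<Rightarrow> complex) set \<Rightarrow> (real \<Rightarrow> complex) set \<Rightarrow>
     ((real \<Rightarrow> complex) \<Rightarrow> real \<Rightarrow> complex) \<Rightarrow> bool" where
  "self_adjoint_in H D A \<longleftrightarrow>
     linear_operator_in H D A \<and> densely_defined_in H D \<and>
     adjoint_graph H D A = operator_graph H D A"

text \<open>
  Kato's definition: \<open>K\<close> (with domain \<open>E\<close>) is relatively compact with respect to \<open>A\<close>
  (with domain \<open>D\<close>) if \<open>D \<subseteq> E\<close> and, for every sequence \<open>F n\<close> in \<open>D\<close> such that both \<open>F n\<close> and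
  \<open>A (F n)\<close> are bounded, \<open>K (F n)\<close> has a convergent subsequence.
\<close>

definition relatively_compact_in ::
    "(real \<Rightarrow> complex) set \<Rightarrow>
     (real \<Rightarrow> complex) set \<Rightarrow> ((real \<Rightarrow> complex) \<Rightarrow> real \<Rightarrow> complex) \<Rightarrow>
     (real \<Rightarrow> complex) set \<Rightarrow> ((real \<Rightarrow> complex) \<Rightarrow> real \<Rightarrow> complex) \<Rightarrow> bool" where
  "relatively_compact_in H D A E K \<longleftrightarrow>
     linear_operator_in H D A \<and> linear_operator_in H E K \<and> D \<subseteq> E \<and>
     (\<forall>F :: nat \<Rightarrow> real \<Rightarrow> complex. (\<forall>n. F n \<in> D) \<longrightarrow>
        bounded (range (\<lambda>n. l2_norm (F n))) \<longrightarrow> bounded (range (\<lambda>n. l2_norm (A (F n)))) \<longrightarrow>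
        (\<exists>(r :: nat \<Rightarrow> nat) g. strict_mono r \<and> g \<in> H \<and> l2_tendsto (\<lambda>n. K (F (r n))) g))"

end

theory Submission
  imports Defs "HOL-Probability.Characteristic_Functions" "HOL-Probability.Sinc_Integral" "HOL-Complex_Analysis.Great_Picard"
begin

text \<open>
  On the Fourier side the Hardy space is the space of square-integrable functions on \<open>[0, \<infinity>)\<close>, the
  momentum operator is multiplication by \<open>\<xi>\<close>, and the domain \<open>H\<^sup>+ \<inter> H\<^sup>1\<close> consists of the
  functions whose transform stays square-integrable after this multiplication. Multiplication by a
  real function on its maximal domain is self-adjoint, and \<open>C\<^sub>+ u C\<^sub>+\<close> is bounded (since \<open>u\<close> is) and
  symmetric (since \<open>u\<close> is real and \<open>C\<^sub>+\<close> is an orthogonal projection), so that it perturbs neither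
  the domain nor the self-adjointness. Concretely, if \<open>(g, h)\<close> is in the graph of the adjoint of
  \<open>L\<^sub>u\<close>, then \<open>(g, h + C\<^sub>+ u C\<^sub>+ g)\<close> is in the graph of the adjoint of the momentum operator, and
  testing with functions whose transform is supported in \<open>[0, n]\<close> puts \<open>g\<close> in the domain
  (\<open>momentum_adjoint\<close>, \<open>self_adjoint_Lax\<close>).

  Relative compactness uses that \<open>u\<close> is square-integrable. Functions bounded in graph norm are bounded
  in \<open>H\<^sup>1\<close>, hence uniformly bounded and equicontinuous, and a subsequence converges at every point
  (\<open>Sobolev1_pointwise_convergent_subsequence\<close>). After multiplication by \<open>u\<close> the convergence is
  dominated by a multiple of \<open>\<bar>u\<bar>\<close>, so it takes place in \<open>L\<^sup>2\<close>, and the projection \<open>C\<^sub>+\<close> preserves it.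

  All of this rests on the Fourier transform being a multiple of a unitary map of \<open>L\<^sup>2\<close>. Plancherel's
  identity is proved for bounded continuous integrable functions by inserting a wide Gaussian weight
  (\<open>gauss_weighted_FT\<close>), and extended to \<open>L\<^sup>1 \<inter> L\<^sup>2\<close> by dominated approximation; completeness of
  \<open>L\<^sup>2\<close> then gives the transform on \<open>L\<^sup>2\<close>, and the duality \<open>\<integral> (F f) g = \<integral> f (F g)\<close> its
  surjectivity (\<open>fourier_inv_fourier\<close>). That the weak derivative becomes multiplication by \<open>\<i> \<xi>\<close>
  is shown by testing with translates and dilates of a single bump function
  (\<open>fourier_has_weak_deriv\<close>).
\<close>

section \<open>The space of square-integrable functions\<close>

lemma L2_iff:
  "f \<in> L2 \<longleftrightarrow> f \<in> borel_measurable borel \<and> integrable lborel (\<lambda>x. (norm (f x))\<^sup>2)"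
  by (simp add: L2_def)

lemma L2_measurable [measurable_dest]: "f \<in> L2 \<Longrightarrow> f \<in> borel_measurable borel"
  by (simp add: L2_iff)

lemma L2_integrable_square: "f \<in> L2 \<Longrightarrow> integrable lborel (\<lambda>x. (norm (f x))\<^sup>2)"
  by (simp add: L2_iff)

lemma measurable_cnj [measurable]: "cnj \<in> borel_measurable borel"
  by (intro borel_measurable_continuous_onI continuous_intros)

lemma L2_dominated:
  fixes f :: "real \<Rightarrow> 'a::real_normed_vector" and g :: "real \<Rightarrow> 'b::real_normed_vector"
  assumes "f \<in> borel_measurable borel" "g \<in> L2" "AE x in lborel. norm (f x) \<le> norm (g x)"
  shows "f \<in> L2"
proof -
  have "integrable lborel (\<lambda>x. (norm (f x))\<^sup>2)"
  proof (rule Bochner_Integration.integrable_bound[OF L2_integrable_square[OF assms(2)]])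
    show "(\<lambda>x. (norm (f x))\<^sup>2) \<in> borel_measurable lborel"
      using assms(1) by measurable
    show "AE x in lborel. norm ((norm (f x))\<^sup>2) \<le> norm ((norm (g x))\<^sup>2)"
      using assms(3) by eventually_elim (simp add: power_mono)
  qed
  with assms(1) show ?thesis by (simp add: L2_iff)
qed

lemma L2_zero [simp]: "(\<lambda>x. 0) \<in> L2"
  by (simp add: L2_iff)

lemma L2_cmult: "f \<in> L2 \<Longrightarrow> (\<lambda>x. c * f x) \<in> L2" for f :: "real \<Rightarrow> complex"
  by (auto simp: L2_iff norm_mult power_mult_distrib)

lemma L2_add:
  fixes f g :: "real \<Rightarrow> complex"
  assumes "f \<in> L2" "g \<in> L2"
  shows "(\<lambda>x. f x + g x) \<in> L2"
proof -
  have "integrable lborel (\<lambda>x. 2 * (norm (f x))\<^sup>2 + 2 * (norm (g x))\<^sup>2)"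
    using assms by (auto simp: L2_iff)
  then have "integrable lborel (\<lambda>x. (norm (f x + g x))\<^sup>2)"
  proof (rule Bochner_Integration.integrable_bound)
    show "(\<lambda>x. (norm (f x + g x))\<^sup>2) \<in> borel_measurable lborel"
      using assms by measurable
    have "(norm (f x + g x))\<^sup>2 \<le> 2 * (norm (f x))\<^sup>2 + 2 * (norm (g x))\<^sup>2" for x
    proof -
      have "(norm (f x + g x))\<^sup>2 \<le> (norm (f x) + norm (g x))\<^sup>2"
        by (intro power_mono norm_triangle_ineq) auto
      also have "\<dots> \<le> 2 * (norm (f x))\<^sup>2 + 2 * (norm (g x))\<^sup>2"
        using sum_squares_bound[of "norm (f x)" "norm (g x)"] by (simp add: power2_sum)
      finally show ?thesis .
    qed
    then show "AE x in lborel. norm ((norm (f x + g x))\<^sup>2)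
        \<le> norm (2 * (norm (f x))\<^sup>2 + 2 * (norm (g x))\<^sup>2)"
      by simp
  qed
  with assms show ?thesis by (auto simp: L2_iff)
qed

lemma L2_uminus: "f \<in> L2 \<Longrightarrow> (\<lambda>x. - f x) \<in> L2" for f :: "real \<Rightarrow> complex"
  using L2_cmult[of f "-1"] by simp

lemma L2_diff: "f \<in> L2 \<Longrightarrow> g \<in> L2 \<Longrightarrow> (\<lambda>x. f x - g x) \<in> L2" for f g :: "real \<Rightarrow> complex"
  using L2_add[of f "\<lambda>x. - g x"] L2_uminus[of g] by simp

lemma L2_cnj: "f \<in> L2 \<Longrightarrow> (\<lambda>x. cnj (f x)) \<in> L2"
  unfolding L2_iff by (auto intro: measurable_compose[OF _ measurable_cnj])

lemma L2_bounded_mult: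
  fixes f m :: "real \<Rightarrow> complex"
  assumes "f \<in> L2" "m \<in> borel_measurable borel" "AE x in lborel. norm (m x) \<le> C"
  shows "(\<lambda>x. m x * f x) \<in> L2"
proof (rule L2_dominated[OF _ L2_cmult[OF assms(1), of "of_real C"]])
  show "(\<lambda>x. m x * f x) \<in> borel_measurable borel"
    using assms by measurable
  show "AE x in lborel. norm (m x * f x) \<le> norm (complex_of_real C * f x)"
    using assms(3) by eventually_elim (auto simp: norm_mult intro!: mult_right_mono)
qed

lemma L2_indicator_mult:
  "f \<in> L2 \<Longrightarrow> A \<in> sets borel \<Longrightarrow> (\<lambda>x. indicator A x * f x) \<in> L2" for f :: "real \<Rightarrow> complex"
  by (rule L2_bounded_mult[where C=1]) (auto simp: indicator_def)

lemma L2_cong_AE: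
  "f \<in> L2 \<Longrightarrow> g \<in> borel_measurable borel \<Longrightarrow> AE x in lborel. f x = g x \<Longrightarrow> g \<in> L2"
  by (rule L2_dominated[where g=f]) auto

lemma L2_integrable_mult:
  fixes f g :: "real \<Rightarrow> complex"
  assumes "f \<in> L2" "g \<in> L2"
  shows "integrable lborel (\<lambda>x. f x * g x)"
proof (rule Bochner_Integration.integrable_bound)
  show "integrable lborel (\<lambda>x. (norm (f x))\<^sup>2 + (norm (g x))\<^sup>2)"
    using assms by (auto simp: L2_iff)
  show "(\<lambda>x. f x * g x) \<in> borel_measurable lborel"
    using assms by measurable
  have "norm (f x * g x) \<le> (norm (f x))\<^sup>2 + (norm (g x))\<^sup>2" for x
  proof -
    have "0 \<le> norm (f x) * norm (g x)" by simp
    with sum_squares_bound[of "norm (f x)" "norm (g x)"] show ?thesis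
      unfolding norm_mult by linarith
  qed
  then show "AE x in lborel. norm (f x * g x) \<le> norm ((norm (f x))\<^sup>2 + (norm (g x))\<^sup>2)"
    by simp
qed

lemma L2_integrable_inner: "f \<in> L2 \<Longrightarrow> g \<in> L2 \<Longrightarrow> integrable lborel (\<lambda>x. f x * cnj (g x))"
  by (intro L2_integrable_mult L2_cnj)

lemma l2_inner_cong_AE:
  assumes "f \<in> L2" "g \<in> L2" "f' \<in> L2" "g' \<in> L2" "eq_ae f f'" "eq_ae g g'"
  shows "l2_inner f g = l2_inner f' g'"
  unfolding l2_inner_def
proof (rule integral_cong_AE)
  show "AE x in lborel. f x * cnj (g x) = f' x * cnj (g' x)"
    using assms(5,6) unfolding eq_ae_def by eventually_elim simp
qed (use assms in measurable)

lemma l2_inner_add_left: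
  "f \<in> L2 \<Longrightarrow> g \<in> L2 \<Longrightarrow> h \<in> L2 \<Longrightarrow> l2_inner (\<lambda>x. f x + g x) h = l2_inner f h + l2_inner g h"
  by (simp add: l2_inner_def distrib_right L2_integrable_inner Bochner_Integration.integral_add)

lemma l2_inner_diff_left:
  "f \<in> L2 \<Longrightarrow> g \<in> L2 \<Longrightarrow> h \<in> L2 \<Longrightarrow> l2_inner (\<lambda>x. f x - g x) h = l2_inner f h - l2_inner g h"
  by (simp add: l2_inner_def left_diff_distrib L2_integrable_inner Bochner_Integration.integral_diff)

lemma l2_inner_commute: "l2_inner g f = cnj (l2_inner f g)"
  unfolding l2_inner_def Bochner_Integration.integral_cnj[symmetric] by (simp add: mult.commute)

lemma l2_inner_add_right:
  "f \<in> L2 \<Longrightarrow> g \<in> L2 \<Longrightarrow> h \<in> L2 \<Longrightarrow> l2_inner h (\<lambda>x. f x + g x) = l2_inner h f + l2_inner h g"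
  by (simp add: l2_inner_def distrib_left L2_integrable_inner Bochner_Integration.integral_add)

lemma l2_inner_diff_right:
  "f \<in> L2 \<Longrightarrow> g \<in> L2 \<Longrightarrow> h \<in> L2 \<Longrightarrow> l2_inner h (\<lambda>x. f x - g x) = l2_inner h f - l2_inner h g"
  by (simp add: l2_inner_def right_diff_distrib L2_integrable_inner Bochner_Integration.integral_diff)

lemma l2_inner_cmult_right: "l2_inner f (\<lambda>x. c * g x) = cnj c * l2_inner f g"
  by (simp add: l2_inner_def mult.left_commute)

lemma l2_norm_nonneg [simp]: "0 \<le> l2_norm f"
  by (simp add: l2_norm_def)

lemma l2_norm_square: "(l2_norm f)\<^sup>2 = (LINT x|lborel. (norm (f x))\<^sup>2)"
  by (simp add: l2_norm_def)

lemma l2_inner_self: "l2_inner f f = complex_of_real ((l2_norm f)\<^sup>2)"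
  unfolding l2_inner_def l2_norm_square
  by (simp add: complex_norm_square[symmetric] flip: integral_complex_of_real)

lemma l2_norm_cong_AE:
  fixes f g :: "real \<Rightarrow> complex"
  assumes "f \<in> borel_measurable borel" "g \<in> borel_measurable borel"
    and "AE x in lborel. norm (f x) = norm (g x)"
  shows "l2_norm f = l2_norm g"
proof -
  have "(LINT x|lborel. (norm (f x))\<^sup>2) = (LINT x|lborel. (norm (g x))\<^sup>2)"
  proof (rule integral_cong_AE)
    show "AE x in lborel. (norm (f x))\<^sup>2 = (norm (g x))\<^sup>2"
      using assms(3) by eventually_elim simp
  qed (use assms in measurable)
  then show ?thesis by (simp add: l2_norm_def)
qed

lemma l2_norm_cmult: "l2_norm (\<lambda>x. c * f x) = norm c * l2_norm f" for f :: "real \<Rightarrow> complex"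
  by (simp add: l2_norm_def norm_mult power_mult_distrib real_sqrt_mult)

lemma l2_norm_minus_commute: "l2_norm (\<lambda>x. f x - g x) = l2_norm (\<lambda>x. g x - f x)"
  by (simp add: l2_norm_def norm_minus_commute)

lemma l2_norm_mono:
  fixes f :: "real \<Rightarrow> 'a::real_normed_vector" and g :: "real \<Rightarrow> 'b::real_normed_vector"
  assumes "f \<in> borel_measurable borel" "g \<in> L2" "AE x in lborel. norm (f x) \<le> norm (g x)"
  shows "l2_norm f \<le> l2_norm g"
  unfolding l2_norm_def
proof (intro real_sqrt_le_mono integral_mono_AE)
  show "AE x in lborel. (norm (f x))\<^sup>2 \<le> (norm (g x))\<^sup>2"
    using assms(3) by eventually_elim (simp add: power_mono)
qed (use L2_dominated[OF assms] assms(2) in \<open>auto simp: L2_iff\<close>)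

lemma l2_norm_eq_0_iff: "f \<in> L2 \<Longrightarrow> l2_norm f = 0 \<longleftrightarrow> (AE x in lborel. f x = 0)"
  unfolding l2_norm_def real_sqrt_eq_0_iff
  by (subst integral_nonneg_eq_0_iff_AE) (auto simp: L2_iff)

lemma nn_integral_square:
  "f \<in> L2 \<Longrightarrow> (\<integral>\<^sup>+x. ennreal ((norm (f x))\<^sup>2) \<partial>lborel) = ennreal ((l2_norm f)\<^sup>2)"
  unfolding l2_norm_square by (rule nn_integral_eq_integral) (auto simp: L2_iff)

lemma norm_l2_inner_le:
  assumes "f \<in> L2" "g \<in> L2"
  shows "norm (l2_inner f g) \<le> l2_norm f * l2_norm g"
proof -
  have [measurable]: "f \<in> borel_measurable borel" "g \<in> borel_measurable borel"
    using assms by (auto simp: L2_iff)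
  have "norm (l2_inner f g) \<le> (LINT x|lborel. norm (f x) * norm (g x))"
    unfolding l2_inner_def using integral_norm_bound[of lborel "\<lambda>x. f x * cnj (g x)"]
    by (simp add: norm_mult)
  also have "\<dots> \<le> l2_norm f * l2_norm g"
  proof (rule power2_le_imp_le)
    have i: "integrable lborel (\<lambda>x. norm (f x) * norm (g x))"
      using integrable_norm[OF L2_integrable_mult[OF assms]] by (simp add: norm_mult)
    have "(\<integral>\<^sup>+x. ennreal (norm (f x)) * ennreal (norm (g x)) \<partial>lborel)\<^sup>2
       \<le> (\<integral>\<^sup>+x. (ennreal (norm (f x)))\<^sup>2 \<partial>lborel) * (\<integral>\<^sup>+x. (ennreal (norm (g x)))\<^sup>2 \<partial>lborel)"
      by (rule Cauchy_Schwarz_nn_integral) measurable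
    also have "\<dots> = ennreal ((l2_norm f)\<^sup>2 * (l2_norm g)\<^sup>2)"
      using assms by (simp add: ennreal_power nn_integral_square ennreal_mult)
    also have "(\<integral>\<^sup>+x. ennreal (norm (f x)) * ennreal (norm (g x)) \<partial>lborel)
        = ennreal (LINT x|lborel. norm (f x) * norm (g x))"
      by (subst nn_integral_eq_integral[OF i, symmetric]) (auto simp: ennreal_mult)
    finally show "(LINT x|lborel. norm (f x) * norm (g x))\<^sup>2 \<le> (l2_norm f * l2_norm g)\<^sup>2"
      by (simp add: ennreal_power power_mult_distrib)
  qed simp
  finally show ?thesis .
qed

lemma l2_norm_add_square:
  assumes "f \<in> L2" "g \<in> L2"
  shows "(l2_norm (\<lambda>x. f x + g x))\<^sup>2 = (l2_norm f)\<^sup>2 + 2 * Re (l2_inner f g) + (l2_norm g)\<^sup>2"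
proof -
  have "complex_of_real ((l2_norm (\<lambda>x. f x + g x))\<^sup>2)
      = of_real ((l2_norm f)\<^sup>2) + l2_inner f g + cnj (l2_inner f g) + of_real ((l2_norm g)\<^sup>2)"
    unfolding l2_inner_self[symmetric]
    using assms by (simp add: l2_inner_add_left l2_inner_add_right L2_add l2_inner_commute[of g f])
  also have "\<dots> = of_real ((l2_norm f)\<^sup>2 + 2 * Re (l2_inner f g) + (l2_norm g)\<^sup>2)"
    by (simp add: complex_eq_iff)
  finally show ?thesis
    using of_real_eq_iff by blast
qed

lemma l2_norm_triangle:
  fixes f g :: "real \<Rightarrow> complex"
  assumes "f \<in> L2" "g \<in> L2"
  shows "l2_norm (\<lambda>x. f x + g x) \<le> l2_norm f + l2_norm g"
proof (rule power2_le_imp_le)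
  have "Re (l2_inner f g) \<le> l2_norm f * l2_norm g"
    using norm_l2_inner_le[OF assms] complex_Re_le_cmod order_trans by blast
  then show "(l2_norm (\<lambda>x. f x + g x))\<^sup>2 \<le> (l2_norm f + l2_norm g)\<^sup>2"
    by (simp add: l2_norm_add_square[OF assms] power2_sum)
qed simp

lemma l2_norm_triangle_diff:
  fixes f g h :: "real \<Rightarrow> complex"
  assumes "f \<in> L2" "g \<in> L2" "h \<in> L2"
  shows "l2_norm (\<lambda>x. f x - h x) \<le> l2_norm (\<lambda>x. f x - g x) + l2_norm (\<lambda>x. g x - h x)"
  using l2_norm_triangle[of "\<lambda>x. f x - g x" "\<lambda>x. g x - h x"] assms by (simp add: L2_diff)

lemma l2_norm_diff_le:
  fixes f g :: "real \<Rightarrow> complex"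
  assumes "f \<in> L2" "g \<in> L2"
  shows "\<bar>l2_norm f - l2_norm g\<bar> \<le> l2_norm (\<lambda>x. f x - g x)"
  using l2_norm_triangle[of "\<lambda>x. f x - g x" g] l2_norm_triangle[of "\<lambda>x. g x - f x" f] assms
    l2_norm_minus_commute[of f g]
  by (simp add: L2_diff)

text \<open>
  Fatou's lemma for norms: the main way to show that a function obtained as a pointwise limit
  is square-integrable, and to carry norm estimates over to it.
\<close>

lemma L2_fatou:
  fixes F :: "nat \<Rightarrow> real \<Rightarrow> complex"
  assumes F: "\<And>n. F n \<in> L2" and f [measurable]: "f \<in> borel_measurable borel"
    and lim: "AE x in lborel. (\<lambda>n. F n x) \<longlonglongrightarrow> f x"
    and b: "\<And>n. l2_norm (F n) \<le> b n" "b \<longlonglongrightarrow> B"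
  shows "f \<in> L2" "l2_norm f \<le> B"
proof -
  have [measurable]: "F n \<in> borel_measurable borel" for n
    using F by (auto simp: L2_iff)
  have b0: "0 \<le> b n" for n
    using b(1)[of n] l2_norm_nonneg[of "F n"] by linarith
  have B0: "0 \<le> B"
    using b(2) by (rule LIMSEQ_le_const) (use b0 in auto)
  have "(\<integral>\<^sup>+x. ennreal ((norm (f x))\<^sup>2) \<partial>lborel)
      = (\<integral>\<^sup>+x. liminf (\<lambda>n. ennreal ((norm (F n x))\<^sup>2)) \<partial>lborel)"
  proof (rule nn_integral_cong_AE)
    show "AE x in lborel. ennreal ((norm (f x))\<^sup>2) = liminf (\<lambda>n. ennreal ((norm (F n x))\<^sup>2))"
      using lim
    proof eventually_elim
      case (elim x)
      then have "(\<lambda>n. ennreal ((norm (F n x))\<^sup>2)) \<longlonglongrightarrow> ennreal ((norm (f x))\<^sup>2)"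
        by (intro tendsto_ennrealI tendsto_intros)
      then show ?case by (rule lim_imp_Liminf[symmetric, rotated]) simp
    qed
  qed
  also have "\<dots> \<le> liminf (\<lambda>n. \<integral>\<^sup>+x. ennreal ((norm (F n x))\<^sup>2) \<partial>lborel)"
    by (rule nn_integral_liminf) measurable
  also have "\<dots> = liminf (\<lambda>n. ennreal ((l2_norm (F n))\<^sup>2))"
    using F by (simp add: nn_integral_square)
  also have "\<dots> \<le> liminf (\<lambda>n. ennreal ((b n)\<^sup>2))"
    using b(1) by (intro Liminf_mono always_eventually allI ennreal_leI power_mono) auto
  also have "\<dots> = ennreal (B\<^sup>2)"
    by (intro lim_imp_Liminf tendsto_ennrealI tendsto_power b) simp
  finally have le: "(\<integral>\<^sup>+x. ennreal ((norm (f x))\<^sup>2) \<partial>lborel) \<le> ennreal (B\<^sup>2)" .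
  have "integrable lborel (\<lambda>x. (norm (f x))\<^sup>2)"
  proof (rule integrableI_bounded)
    show "(\<integral>\<^sup>+x. ennreal (norm ((norm (f x))\<^sup>2)) \<partial>lborel) < \<infinity>"
      using le by (simp add: le_less_trans)
  qed measurable
  then show fL: "f \<in> L2" by (simp add: L2_iff)
  show "l2_norm f \<le> B"
  proof (rule power2_le_imp_le)
    show "(l2_norm f)\<^sup>2 \<le> B\<^sup>2"
      using le unfolding nn_integral_square[OF fL] by simp
  qed (rule B0)
qed

section \<open>Convergence in the mean\<close>

lemma l2_tendstoD:
  assumes "l2_tendsto F f"
  shows "F n \<in> L2" "f \<in> L2" "(\<lambda>n. l2_norm (\<lambda>x. F n x - f x)) \<longlonglongrightarrow> 0"
  using assms by (auto simp: l2_tendsto_def)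

lemma l2_tendsto_dominated:
  fixes F :: "nat \<Rightarrow> real \<Rightarrow> complex" and w :: "real \<Rightarrow> real"
  assumes F [measurable]: "\<And>n. F n \<in> borel_measurable borel"
    and f [measurable]: "f \<in> borel_measurable borel"
    and w: "w \<in> L2" and le: "\<And>n. AE x in lborel. norm (F n x) \<le> w x"
    and lim: "AE x in lborel. (\<lambda>n. F n x) \<longlonglongrightarrow> f x"
  shows "l2_tendsto F f"
proof -
  have FL: "F n \<in> L2" for n
  proof (rule L2_dominated[OF F w])
    show "AE x in lborel. norm (F n x) \<le> norm (w x)"
      using le[of n] by eventually_elim auto
  qed
  have all: "AE x in lborel. \<forall>n. norm (F n x) \<le> w x"
    using le by (simp add: AE_all_countable)
  have fw: "AE x in lborel. norm (f x) \<le> norm (w x)"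
    using lim all
  proof eventually_elim
    case (elim x)
    have "norm (f x) \<le> w x"
      by (rule LIMSEQ_le_const2[OF tendsto_norm[OF elim(1)]]) (use elim(2) in auto)
    then show ?case by auto
  qed
  then have fL: "f \<in> L2"
    by (rule L2_dominated[OF f w])
  have "(\<lambda>n. LINT x|lborel. (norm (F n x - f x))\<^sup>2) \<longlonglongrightarrow> (LINT x|(lborel::real measure). 0)"
  proof (rule integral_dominated_convergence[where w="\<lambda>x. 4 * (norm (w x))\<^sup>2"])
    show "integrable lborel (\<lambda>x. 4 * (norm (w x))\<^sup>2)"
      using L2_integrable_square[OF w] by simp
    show "AE x in lborel. (\<lambda>n. (norm (F n x - f x))\<^sup>2) \<longlonglongrightarrow> 0"
      using lim
    proof eventually_elim
      case (elim x)
      then have "(\<lambda>n. (norm (F n x - f x))\<^sup>2) \<longlonglongrightarrow> (norm (f x - f x))\<^sup>2"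
        by (intro tendsto_intros)
      then show ?case by simp
    qed
    show "AE x in lborel. norm ((norm (F n x - f x))\<^sup>2) \<le> 4 * (norm (w x))\<^sup>2" for n
      using le[of n] fw
    proof eventually_elim
      case (elim x)
      have "norm (F n x - f x) \<le> 2 * norm (w x)"
        using elim norm_triangle_ineq4[of "F n x" "f x"] by auto
      then have "(norm (F n x - f x))\<^sup>2 \<le> (2 * norm (w x))\<^sup>2"
        by (intro power_mono) auto
      then show ?case by (simp add: power_mult_distrib)
    qed
  qed measurable
  then have "(\<lambda>n. sqrt (LINT x|lborel. (norm (F n x - f x))\<^sup>2)) \<longlonglongrightarrow> sqrt 0"
    by (intro tendsto_real_sqrt) simp
  with FL fL show ?thesis
    by (simp add: l2_tendsto_def l2_norm_def)
qed

lemma l2_tendsto_norm: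
  fixes F :: "nat \<Rightarrow> real \<Rightarrow> complex"
  assumes "l2_tendsto F f"
  shows "(\<lambda>n. l2_norm (F n)) \<longlonglongrightarrow> l2_norm f"
proof (subst tendsto_dist_iff, rule tendsto_sandwich[OF _ _ tendsto_const l2_tendstoD(3)[OF assms]])
  show "\<forall>\<^sub>F n in sequentially. dist (l2_norm (F n)) (l2_norm f) \<le> l2_norm (\<lambda>x. F n x - f x)"
    using l2_norm_diff_le[OF l2_tendstoD(1)[OF assms] l2_tendstoD(2)[OF assms]]
    by (simp add: dist_real_def)
qed simp

lemma l2_tendsto_inner_left:
  assumes "l2_tendsto F f" "g \<in> L2"
  shows "(\<lambda>n. l2_inner (F n) g) \<longlonglongrightarrow> l2_inner f g"
proof (subst tendsto_dist_iff, rule tendsto_sandwich[OF _ _ tendsto_const])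
  note F = l2_tendstoD[OF assms(1)]
  show "(\<lambda>n. l2_norm (\<lambda>x. F n x - f x) * l2_norm g) \<longlonglongrightarrow> 0"
    using tendsto_mult_right[OF F(3), of "l2_norm g"] by simp
  show "\<forall>\<^sub>F n in sequentially. dist (l2_inner (F n) g) (l2_inner f g)
      \<le> l2_norm (\<lambda>x. F n x - f x) * l2_norm g"
    using norm_l2_inner_le[OF L2_diff[OF F(1,2)] assms(2)]
    by (simp add: dist_norm l2_inner_diff_left F assms)
qed simp

text \<open>
  The estimate is demanded only along the sequence, so that \<open>T\<close> may be given by a choice of
  representatives and be linear only up to null sets.
\<close>

lemma l2_tendsto_bounded_linear:
  fixes F :: "nat \<Rightarrow> real \<Rightarrow> complex"
  assumes lim: "l2_tendsto F f"
    and L2: "\<And>n. T (F n) \<in> L2" "T f \<in> L2"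
    and le: "\<And>n. l2_norm (\<lambda>x. T (F n) x - T f x) \<le> C * l2_norm (\<lambda>x. F n x - f x)"
  shows "l2_tendsto (\<lambda>n. T (F n)) (T f :: real \<Rightarrow> complex)"
  unfolding l2_tendsto_def
proof (intro conjI allI L2)
  show "(\<lambda>n. l2_norm (\<lambda>x. T (F n) x - T f x)) \<longlonglongrightarrow> 0"
  proof (rule tendsto_sandwich[OF _ _ tendsto_const])
    show "(\<lambda>n. C * l2_norm (\<lambda>x. F n x - f x)) \<longlonglongrightarrow> 0"
      using tendsto_mult_left[OF l2_tendstoD(3)[OF lim], of C] by simp
  qed (use le in auto)
qed

lemma l2_tendsto_cmult: "l2_tendsto F f \<Longrightarrow> l2_tendsto (\<lambda>n x. c * F n x) (\<lambda>x. c * f x)"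
  for f :: "real \<Rightarrow> complex"
  by (rule l2_tendsto_bounded_linear[where C="norm c"])
     (auto intro: L2_cmult l2_tendstoD simp: l2_norm_cmult simp flip: right_diff_distrib)

lemma l2_tendsto_add:
  fixes f g :: "real \<Rightarrow> complex"
  assumes "l2_tendsto F f" "l2_tendsto G g"
  shows "l2_tendsto (\<lambda>n x. F n x + G n x) (\<lambda>x. f x + g x)"
  unfolding l2_tendsto_def
proof (intro conjI allI)
  note F = l2_tendstoD[OF assms(1)] and G = l2_tendstoD[OF assms(2)]
  show "(\<lambda>x. F n x + G n x) \<in> L2" for n by (intro L2_add F G)
  show "(\<lambda>x. f x + g x) \<in> L2" by (intro L2_add F G)
  show "(\<lambda>n. l2_norm (\<lambda>x. F n x + G n x - (f x + g x))) \<longlonglongrightarrow> 0"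
  proof (rule tendsto_sandwich[OF _ _ tendsto_const])
    show "(\<lambda>n. l2_norm (\<lambda>x. F n x - f x) + l2_norm (\<lambda>x. G n x - g x)) \<longlonglongrightarrow> 0"
      using tendsto_add[OF F(3) G(3)] by simp
    show "\<forall>\<^sub>F n in sequentially. l2_norm (\<lambda>x. F n x + G n x - (f x + g x))
        \<le> l2_norm (\<lambda>x. F n x - f x) + l2_norm (\<lambda>x. G n x - g x)"
      using l2_norm_triangle[OF L2_diff[OF F(1,2)] L2_diff[OF G(1,2)]]
      by (simp add: algebra_simps)
  qed simp
qed

text \<open>
  Limits in the mean and pointwise limits agree, by Fatou's lemma applied to \<open>F n - f\<close>.
\<close>

lemma l2_tendsto_unique_AE:
  fixes F :: "nat \<Rightarrow> real \<Rightarrow> complex"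
  assumes "l2_tendsto F f" and "g \<in> borel_measurable borel"
    and lim: "AE x in lborel. (\<lambda>n. F n x) \<longlonglongrightarrow> g x"
  shows "eq_ae f g"
proof -
  note F = l2_tendstoD[OF assms(1)]
  have m: "(\<lambda>x. g x - f x) \<in> borel_measurable borel"
    using F(2) assms(2) by (auto simp: L2_iff)
  have lim': "AE x in lborel. (\<lambda>n. F n x - f x) \<longlonglongrightarrow> g x - f x"
    using lim by eventually_elim (intro tendsto_intros)
  note fatou = L2_fatou[OF L2_diff[OF F(1,2)] m lim' order_refl F(3)]
  have "l2_norm (\<lambda>x. g x - f x) = 0"
    using fatou(2) l2_norm_nonneg by (rule antisym)
  with fatou(1) show ?thesis
    by (simp add: l2_norm_eq_0_iff eq_ae_def) (auto elim: eventually_mono)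
qed

lemma l2_norm_diff_eq_0_iff:
  "f \<in> L2 \<Longrightarrow> g \<in> L2 \<Longrightarrow> l2_norm (\<lambda>x. f x - g x) = 0 \<longleftrightarrow> eq_ae f g"
  for f g :: "real \<Rightarrow> complex"
  by (simp add: l2_norm_eq_0_iff L2_diff eq_ae_def)

lemma l2_tendsto_unique:
  fixes F :: "nat \<Rightarrow> real \<Rightarrow> complex"
  assumes "l2_tendsto F f" "l2_tendsto F g"
  shows "eq_ae f g"
proof -
  note F = l2_tendstoD[OF assms(1)] and G = l2_tendstoD[OF assms(2)]
  have "l2_norm (\<lambda>x. f x - g x) \<le> l2_norm (\<lambda>x. F n x - f x) + l2_norm (\<lambda>x. F n x - g x)" for n
    using l2_norm_triangle_diff[OF F(2) F(1)[of n] G(2)] by (simp add: l2_norm_minus_commute[of f])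
  then have "l2_norm (\<lambda>x. f x - g x) \<le> 0 + 0"
    by (intro LIMSEQ_le_const[OF tendsto_add[OF F(3) G(3)]]) auto
  then have "l2_norm (\<lambda>x. f x - g x) = 0"
    using l2_norm_nonneg[of "\<lambda>x. f x - g x"] by linarith
  then show ?thesis
    by (simp add: l2_norm_diff_eq_0_iff F G)
qed

lemma eq_ae_trans: "eq_ae f g \<Longrightarrow> eq_ae g h \<Longrightarrow> eq_ae f h"
  unfolding eq_ae_def by (auto elim: eventually_elim2)

lemma eq_ae_sym: "eq_ae f g \<Longrightarrow> eq_ae g f"
  unfolding eq_ae_def by (auto elim: eventually_mono)

lemma eq_ae_refl [simp]: "eq_ae f f"
  by (simp add: eq_ae_def)

text \<open>
  The Riesz--Fischer theorem. Along a subsequence whose increments \<open>d k\<close> have norm below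
  \<open>2\<^sup>-\<^sup>k\<close>, the integral of \<open>\<Sum>k. 2\<^sup>k \<bar>d k\<bar>\<^sup>2\<close> is finite, and
  \<open>\<bar>d k\<bar> \<le> 2\<^sup>-\<^sup>k + 2\<^sup>k \<bar>d k\<bar>\<^sup>2\<close> makes the subsequence converge almost everywhere; Fatou's
  lemma turns this into convergence in norm of the full sequence.
\<close>

lemma L2_complete:
  fixes F :: "nat \<Rightarrow> real \<Rightarrow> complex"
  assumes F: "\<And>n. F n \<in> L2"
    and Cauchy: "\<And>e. e > 0 \<Longrightarrow> \<exists>N. \<forall>m\<ge>N. \<forall>n\<ge>N. l2_norm (\<lambda>x. F m x - F n x) < e"
  shows "\<exists>g. l2_tendsto F g"
proof -
  have [measurable]: "F n \<in> borel_measurable borel" for n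
    using F by (auto simp: L2_iff)
  have "\<exists>N. \<forall>m\<ge>N. \<forall>n\<ge>N. l2_norm (\<lambda>x. F m x - F n x) < (1/2)^k" for k :: nat
    by (rule Cauchy) simp
  then obtain N where N: "\<And>k m n. m \<ge> N k \<Longrightarrow> n \<ge> N k \<Longrightarrow> l2_norm (\<lambda>x. F m x - F n x) < (1/2)^k"
    by metis
  \<comment> \<open>The partial sums make \<open>r\<close> monotone and at least as large as both \<open>N k\<close> and \<open>k\<close>.\<close>
  define r where "r k = (\<Sum>i\<le>k. Suc (N i))" for k
  have r_ge: "r k \<ge> N k" for k
    unfolding r_def using member_le_sum[of k "{..k}" "\<lambda>i. Suc (N i)"] by auto
  have r_Suc: "r (Suc k) \<ge> r k" for k by (simp add: r_def)
  have r_id: "r k \<ge> k" for k by (induction k) (auto simp: r_def)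
  define d where "d k x = F (r (Suc k)) x - F (r k) x" for k x
  have dL: "d k \<in> L2" for k unfolding d_def by (intro L2_diff F)
  have [measurable]: "d k \<in> borel_measurable borel" for k
    using dL by (auto simp: L2_iff)
  have d_le: "(l2_norm (d k))\<^sup>2 \<le> ((1/2)^k)\<^sup>2" for k
    unfolding d_def using N[of k "r (Suc k)" "r k"] r_ge[of k] r_Suc[of k]
    by (intro power_mono) auto
  have "(\<integral>\<^sup>+x. (\<Sum>k. ennreal (2^k * (norm (d k x))\<^sup>2)) \<partial>lborel)
      = (\<Sum>k. \<integral>\<^sup>+x. ennreal (2^k * (norm (d k x))\<^sup>2) \<partial>lborel)"
    by (rule nn_integral_suminf) measurable
  also have "\<dots> = (\<Sum>k. ennreal (2^k * (l2_norm (d k))\<^sup>2))"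
    by (simp add: ennreal_mult nn_integral_cmult nn_integral_square[OF dL])
  also have "\<dots> \<le> (\<Sum>k. ennreal ((1/2)^k))"
  proof (intro suminf_le ennreal_leI)
    show "2^k * (l2_norm (d k))\<^sup>2 \<le> (1/2)^k" for k
      using d_le[of k] by (simp add: field_simps power2_eq_square)
  qed auto
  also have "\<dots> < \<infinity>"
    using summable_geometric[of "1/2 :: real"] by (subst suminf_ennreal_eq[OF _ summable_sums]) auto
  finally have "AE x in lborel. (\<Sum>k. ennreal (2^k * (norm (d k x))\<^sup>2)) \<noteq> \<infinity>"
    by (intro nn_integral_PInf_AE) auto
  then have conv: "AE x in lborel. convergent (\<lambda>k. F (r k) x)"
  proof eventually_elim
    case (elim x)
    have "summable (\<lambda>k. 2^k * (norm (d k x))\<^sup>2)"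
      by (rule summable_suminf_not_top) (use elim in auto)
    then have s: "summable (\<lambda>k. (1/2)^k + 2^k * (norm (d k x))\<^sup>2)"
      by (intro summable_add summable_geometric) auto
    have "summable (\<lambda>k. d k x)"
    proof (rule summable_comparison_test[OF _ s], intro exI allI impI)
      fix k :: nat
      have "norm (d k x) \<le> (1/2)^k + 2^k * (norm (d k x))\<^sup>2"
      proof (cases "norm (d k x) \<le> (1/2)^k")
        case False
        then have "1 \<le> 2^k * norm (d k x)"
          by (simp add: field_simps)
        then have "1 * norm (d k x) \<le> 2^k * norm (d k x) * norm (d k x)"
          by (rule mult_right_mono) simp
        then show ?thesis by (simp add: power2_eq_square mult.assoc add_increasing)
      qed (simp add: add_increasing2)
      then show "norm (d k x) \<le> (1/2)^k + 2^k * (norm (d k x))\<^sup>2" .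
    qed
    then have "convergent (\<lambda>k. F (r 0) x + (\<Sum>i<k. d i x))"
      by (intro convergent_add convergent_const) (simp add: summable_iff_convergent)
    moreover have "F (r 0) x + (\<Sum>i<k. d i x) = F (r k) x" for k
      unfolding d_def by (subst sum_lessThan_telescope) simp
    ultimately show ?case by simp
  qed
  define g where "g x = lim (\<lambda>k. F (r k) x)" for x
  have g [measurable]: "g \<in> borel_measurable borel"
    unfolding g_def by measurable
  have lim: "AE x in lborel. (\<lambda>k. F (r k) x) \<longlonglongrightarrow> g x"
    using conv by eventually_elim (simp add: g_def convergent_LIMSEQ_iff)
  have main: "\<exists>M. \<forall>m\<ge>M. (\<lambda>x. F m x - g x) \<in> L2 \<and> l2_norm (\<lambda>x. F m x - g x) \<le> e" if "e > 0" for e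
  proof -
    from Cauchy[OF that] obtain M where
      M: "\<And>m n. m \<ge> M \<Longrightarrow> n \<ge> M \<Longrightarrow> l2_norm (\<lambda>x. F m x - F n x) < e" by blast
    have "(\<lambda>x. F m x - g x) \<in> L2 \<and> l2_norm (\<lambda>x. F m x - g x) \<le> e" if m: "m \<ge> M" for m
    proof -
      have lim': "AE x in lborel. (\<lambda>k. F m x - F (r (k + M)) x) \<longlonglongrightarrow> F m x - g x"
        using lim
      proof eventually_elim
        case (elim x)
        show ?case
          by (intro tendsto_diff tendsto_const LIMSEQ_ignore_initial_segment elim)
      qed
      have b: "l2_norm (\<lambda>x. F m x - F (r (k + M)) x) \<le> e" for k
        using M[OF m, of "r (k + M)"] r_id[of "k + M"] by auto
      have meas: "(\<lambda>x. F m x - g x) \<in> borel_measurable borel" by measurable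
      show ?thesis
        using L2_fatou[OF L2_diff[OF F F] meas lim' b tendsto_const] by blast
    qed
    then show ?thesis by blast
  qed
  from main[of 1] obtain M where "(\<lambda>x. F M x - g x) \<in> L2" by auto
  from L2_diff[OF F[of M] this] have gL: "g \<in> L2" by simp
  have "(\<lambda>n. l2_norm (\<lambda>x. F n x - g x)) \<longlonglongrightarrow> 0"
  proof (rule LIMSEQ_I)
    fix e :: real assume "e > 0"
    from main[of "e/2"] this obtain M where M: "\<And>m. m \<ge> M \<Longrightarrow> l2_norm (\<lambda>x. F m x - g x) \<le> e/2"
      by auto
    have "norm (l2_norm (\<lambda>x. F m x - g x) - 0) < e" if "m \<ge> M" for m
      unfolding real_norm_def diff_0_right abs_of_nonneg[OF l2_norm_nonneg]
      using M[OF that] \<open>e > 0\<close> by linarith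
    then show "\<exists>M. \<forall>m\<ge>M. norm (l2_norm (\<lambda>x. F m x - g x) - 0) < e" by blast
  qed
  with F gL show ?thesis by (auto simp: l2_tendsto_def)
qed

section \<open>The Fourier integral and Plancherel's identity\<close>

definition fker :: "real \<Rightarrow> real \<Rightarrow> complex" where
  "fker x \<xi> = exp (- (\<i> * complex_of_real (x * \<xi>)))"

definition FT :: "(real \<Rightarrow> complex) \<Rightarrow> real \<Rightarrow> complex" where
  "FT f \<xi> = (LINT x|lborel. fker x \<xi> * f x)"

lemma norm_fker [simp]: "norm (fker x \<xi>) = 1"
  by (simp add: fker_def)

lemma fker_0 [simp]: "fker x 0 = 1"
  by (simp add: fker_def)

lemma fker_commute: "fker x \<xi> = fker \<xi> x"
  by (simp add: fker_def mult.commute)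

lemma continuous_fker: "continuous_on S (\<lambda>x. fker x \<xi>)"
  unfolding fker_def by (intro continuous_intros)

lemma fker_measurable [measurable]:
  assumes [measurable]: "f \<in> borel_measurable M" "g \<in> borel_measurable M"
  shows "(\<lambda>p. fker (f p) (g p)) \<in> borel_measurable M"
proof -
  have "exp \<in> borel_measurable (borel :: complex measure)"
    by (intro borel_measurable_continuous_onI continuous_intros)
  then show ?thesis unfolding fker_def by measurable
qed

lemma fker_add: "fker x \<xi> * fker x \<eta> = fker x (\<xi> + \<eta>)"
  by (simp add: fker_def exp_add[symmetric] algebra_simps)

lemma cnj_fker: "cnj (fker x \<xi>) = fker x (- \<xi>)"
  by (simp add: fker_def exp_cnj)

lemma integrable_fker_mult:
  "integrable lborel f \<Longrightarrow> integrable lborel (\<lambda>x. fker x \<xi> * f x)"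
  by (rule Bochner_Integration.integrable_bound[where f=f]) (auto simp: norm_mult)

lemma FT_measurable [measurable]:
  assumes [measurable]: "f \<in> borel_measurable borel"
  shows "FT f \<in> borel_measurable borel"
  unfolding FT_def by measurable

lemma norm_FT_le: "norm (FT f \<xi>) \<le> (LINT x|lborel. norm (f x))"
  unfolding FT_def using integral_norm_bound[of lborel "\<lambda>x. fker x \<xi> * f x"] by (simp add: norm_mult)

lemma FT_diff:
  "integrable lborel f \<Longrightarrow> integrable lborel g \<Longrightarrow> FT (\<lambda>x. f x - g x) \<xi> = FT f \<xi> - FT g \<xi>"
  unfolding FT_def
  by (simp add: right_diff_distrib integrable_fker_mult Bochner_Integration.integral_diff)

lemma cnj_FT: "cnj (FT f \<xi>) = FT (\<lambda>x. cnj (f (- x))) \<xi>"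
  unfolding FT_def Bochner_Integration.integral_cnj[symmetric]
  by (subst lborel_integral_real_affine[where c="-1" and t=0]) (auto simp: fker_def exp_cnj)

text \<open>
  Fubini's theorem, as the kernel is bounded and symmetric in its two arguments.
\<close>

lemma FT_duality:
  assumes f: "integrable lborel f" and g: "integrable lborel g"
  shows "(LINT \<xi>|lborel. FT f \<xi> * g \<xi>) = (LINT x|lborel. f x * FT g x)"
proof -
  have [measurable]: "f \<in> borel_measurable borel" "g \<in> borel_measurable borel"
    using f g by (auto dest: borel_measurable_integrable)
  have int: "integrable (lborel \<Otimes>\<^sub>M lborel) (\<lambda>(x, \<xi>). fker x \<xi> * f x * g \<xi>)"
  proof (rule lborel_pair.Fubini_integrable)
    show "(\<lambda>(x, \<xi>). fker x \<xi> * f x * g \<xi>) \<in> borel_measurable (lborel \<Otimes>\<^sub>M lborel)"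
      by measurable
    have "integrable lborel (\<lambda>x. norm (f x) * (LINT \<xi>|lborel. norm (g \<xi>)))"
      using f by auto
    then show "integrable lborel (\<lambda>x. LINT \<xi>|lborel. norm (case (x, \<xi>) of (x, \<xi>) \<Rightarrow> fker x \<xi> * f x * g \<xi>))"
      by (simp add: norm_mult)
    have "integrable lborel (\<lambda>\<xi>. fker x \<xi> * f x * g \<xi>)" for x
      using integrable_mult_left[OF integrable_fker_mult[OF g, of x], of "f x"]
      by (simp add: fker_commute mult.commute mult.left_commute)
    then show "AE x in lborel. integrable lborel (\<lambda>\<xi>. case (x, \<xi>) of (x, \<xi>) \<Rightarrow> fker x \<xi> * f x * g \<xi>)"
      by simp
  qed
  have "(LINT \<xi>|lborel. FT f \<xi> * g \<xi>) = (LINT \<xi>|lborel. LINT x|lborel. fker x \<xi> * f x * g \<xi>)"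
    by (simp add: FT_def)
  also have "\<dots> = (LINT x|lborel. LINT \<xi>|lborel. fker x \<xi> * f x * g \<xi>)"
    using lborel_pair.Fubini_integral[OF int] by simp
  also have "\<dots> = (LINT x|lborel. LINT \<xi>|lborel. f x * (fker \<xi> x * g \<xi>))"
    by (simp add: fker_commute ac_simps)
  also have "\<dots> = (LINT x|lborel. f x * FT g x)"
    by (simp add: FT_def)
  finally show ?thesis .
qed

definition gauss :: "real \<Rightarrow> real \<Rightarrow> complex" where
  "gauss s \<xi> = complex_of_real (exp (- (\<xi> / s)\<^sup>2 / 2))"

lemma gauss_eq_density: "exp (- x\<^sup>2 / 2) = sqrt (2 * pi) * std_normal_density x"
  by (simp add: std_normal_density_def)

lemma integrable_gauss: "s > 0 \<Longrightarrow> integrable lborel (gauss s)"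
proof -
  assume "s > 0"
  have "integrable lborel (\<lambda>x. exp (- x\<^sup>2 / 2) :: real)"
    using integrable_std_normal_moment[of 0] unfolding gauss_eq_density by simp
  from lborel_integrable_real_affine[OF this, of "1/s" 0] \<open>s > 0\<close>
  show ?thesis unfolding gauss_def by (intro integrable_of_real) simp
qed

lemma integral_gauss: "(LINT t|lborel. exp (- t\<^sup>2 / 2)) = sqrt (2 * pi)"
  using integral_std_normal_moment_even[of 0] unfolding gauss_eq_density by simp

text \<open>
  This is the characteristic function of the standard normal distribution, rescaled by \<open>s\<close>.
\<close>

lemma FT_gauss:
  assumes s: "s > 0"
  shows "FT (gauss s) y = of_real (s * sqrt (2 * pi) * exp (- (s * y)\<^sup>2 / 2))"
proof -
  have char: "(LINT x|lborel. of_real (std_normal_density x) * exp (\<i> * of_real (t * x)))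
      = complex_of_real (exp (- t\<^sup>2 / 2))" for t
    using fun_cong[OF char_std_normal_distribution, of t]
    unfolding char_def
    by (subst (asm) integral_density) (auto simp: scaleR_conv_of_real)
  have "FT (gauss s) y = \<bar>s\<bar> *\<^sub>R (LINT x|lborel. fker (0 + s * x) y * gauss s (0 + s * x))"
    unfolding FT_def by (rule lborel_integral_real_affine) (use s in auto)
  also have "(\<lambda>x. fker (0 + s * x) y * gauss s (0 + s * x))
      = (\<lambda>x. of_real (sqrt (2 * pi)) * (of_real (std_normal_density x) * exp (\<i> * of_real (- (s * y) * x))))"
  proof
    fix x
    have "gauss s (0 + s * x) = of_real (sqrt (2 * pi)) * of_real (std_normal_density x)"
      unfolding gauss_def of_real_mult[symmetric] gauss_eq_density[symmetric] using s by simp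
    then show "fker (0 + s * x) y * gauss s (0 + s * x)
      = of_real (sqrt (2 * pi)) * (of_real (std_normal_density x) * exp (\<i> * of_real (- (s * y) * x)))"
      by (simp add: fker_def ac_simps)
  qed
  also have "(LINT x|lborel. of_real (sqrt (2 * pi)) *
        (of_real (std_normal_density x) * exp (\<i> * of_real (- (s * y) * x))))
      = of_real (sqrt (2 * pi)) * complex_of_real (exp (- (- (s * y))\<^sup>2 / 2))"
    by (subst integral_mult_right_zero) (simp only: char)
  finally show ?thesis using s by (simp add: scaleR_conv_of_real ac_simps)
qed

text \<open>
  Plancherel's identity tested against a Gaussian weight of width \<open>s\<close>: two applications of the
  duality \<open>\<integral> (FT f) g = \<integral> f (FT g)\<close> move both transforms onto the Gaussian, whose
  transform is an approximate identity.
\<close>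

lemma gauss_weighted_FT:
  assumes f: "integrable lborel f" and s: "s > 0"
  shows "(LINT \<xi>|lborel. FT f \<xi> * (cnj (FT f \<xi>) * gauss s \<xi>)) =
    (LINT x|lborel. f x * (of_real (sqrt (2 * pi)) *
       (LINT t|lborel. cnj (f (x - t / s)) * of_real (exp (- t\<^sup>2 / 2)))))"
proof -
  define h where "h x = cnj (f (- x))" for x
  have h: "integrable lborel h"
    unfolding h_def using lborel_integrable_real_affine[OF f, of "-1" 0] by simp
  have [measurable]: "f \<in> borel_measurable borel" "h \<in> borel_measurable borel"
    using f h by (auto dest: borel_measurable_integrable)
  have [measurable]: "gauss s \<in> borel_measurable borel"
    using integrable_gauss[OF s] by (auto dest: borel_measurable_integrable)
  have hg: "integrable lborel (\<lambda>\<xi>. FT h \<xi> * gauss s \<xi>)"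
  proof (rule Bochner_Integration.integrable_bound)
    show "integrable lborel (\<lambda>\<xi>. of_real (LINT x|lborel. norm (h x)) * gauss s \<xi>)"
      using integrable_gauss[OF s] by (rule integrable_mult_right)
    have "norm (FT h \<xi> * gauss s \<xi>) \<le> norm (of_real (LINT x|lborel. norm (h x)) * gauss s \<xi>)" for \<xi>
      unfolding norm_mult using norm_FT_le[of h \<xi>] by (intro mult_right_mono) auto
    then show "AE \<xi> in lborel. norm (FT h \<xi> * gauss s \<xi>)
        \<le> norm (of_real (LINT x|lborel. norm (h x)) * gauss s \<xi>)"
      by blast
  qed measurable
  have inner: "FT (\<lambda>\<xi>. FT h \<xi> * gauss s \<xi>) x = of_real (sqrt (2 * pi)) *
       (LINT t|lborel. cnj (f (x - t / s)) * of_real (exp (- t\<^sup>2 / 2)))" for x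
  proof -
    have "FT (\<lambda>\<xi>. FT h \<xi> * gauss s \<xi>) x = (LINT \<xi>|lborel. FT h \<xi> * (fker \<xi> x * gauss s \<xi>))"
      unfolding FT_def[of "\<lambda>\<xi>. FT h \<xi> * gauss s \<xi>"] by (simp add: ac_simps)
    also have "\<dots> = (LINT y|lborel. h y * FT (\<lambda>\<xi>. fker \<xi> x * gauss s \<xi>) y)"
      by (rule FT_duality[OF h integrable_fker_mult[OF integrable_gauss[OF s]]])
    also have "\<dots> = (LINT y|lborel. h y * FT (gauss s) (y + x))"
      unfolding FT_def[of "\<lambda>\<xi>. fker \<xi> x * gauss s \<xi>"] FT_def[of "gauss s"]
        mult.assoc[symmetric] fker_add ..
    also have "\<dots> = \<bar>1/s\<bar> *\<^sub>R
        (LINT t|lborel. h (- x + (1/s) * t) * FT (gauss s) (- x + (1/s) * t + x))"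
      by (rule lborel_integral_real_affine) (use s in auto)
    also have "\<dots> = \<bar>1/s\<bar> *\<^sub>R (LINT t|lborel. of_real (s * sqrt (2 * pi)) *
        (cnj (f (x - t / s)) * of_real (exp (- t\<^sup>2 / 2))))"
      using s by (simp add: FT_gauss[OF s] h_def ac_simps)
    also have "\<dots> = of_real (sqrt (2 * pi)) *
       (LINT t|lborel. cnj (f (x - t / s)) * of_real (exp (- t\<^sup>2 / 2)))"
      by (subst integral_mult_right_zero) (use s in \<open>simp add: scaleR_conv_of_real\<close>)
    finally show ?thesis .
  qed
  have "(LINT \<xi>|lborel. FT f \<xi> * (cnj (FT f \<xi>) * gauss s \<xi>))
      = (LINT x|lborel. f x * FT (\<lambda>\<xi>. FT h \<xi> * gauss s \<xi>) x)"
    unfolding cnj_FT h_def[symmetric] by (rule FT_duality[OF f hg])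
  also have "\<dots> = (LINT x|lborel. f x * (of_real (sqrt (2 * pi)) *
       (LINT t|lborel. cnj (f (x - t / s)) * of_real (exp (- t\<^sup>2 / 2)))))"
    unfolding inner ..
  finally show ?thesis .
qed

text \<open>
  Let the Gaussian widen. The inner integrals on the right of \<open>gauss_weighted_FT\<close> are averages of
  \<open>cnj f\<close> around \<open>x\<close>, which converge to \<open>cnj (f x)\<close> by continuity and are dominated because \<open>f\<close> is
  bounded; on the left the weights increase to \<open>1\<close>, so monotone convergence also yields that
  \<open>FT f\<close> is square-integrable.
\<close>

lemma FT_plancherel_continuous:
  assumes cont: "continuous_on UNIV f" and bound: "\<And>x. norm (f x) \<le> M" and f: "integrable lborel f"
  shows "FT f \<in> L2" "l2_norm (FT f) = sqrt (2 * pi) * l2_norm f"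
proof -
  have [measurable]: "f \<in> borel_measurable borel"
    using f by (auto dest: borel_measurable_integrable)
  have gauss_int: "integrable lborel (\<lambda>t. exp (- t\<^sup>2 / 2) :: real)"
    using integrable_std_normal_moment[of 0] unfolding gauss_eq_density by simp
  define s where "s n = real (Suc n)" for n
  have s: "s n > 0" for n by (simp add: s_def)
  define A where "A n x = of_real (sqrt (2 * pi)) *
       (LINT t|lborel. cnj (f (x - t / s n)) * complex_of_real (exp (- t\<^sup>2 / 2)))" for n x
  have dom: "norm (cnj (f (x - t / s n)) * complex_of_real (exp (- t\<^sup>2 / 2))) \<le> M * exp (- t\<^sup>2 / 2)"
    for n x t
    unfolding norm_mult using bound[of "x - t / s n"] by (intro mult_mono) (auto intro: order_trans[OF norm_ge_zero])
  have A_lim: "(\<lambda>n. A n x) \<longlonglongrightarrow> of_real (2 * pi) * cnj (f x)" for x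
  proof -
    have "(\<lambda>n. LINT t|lborel. cnj (f (x - t / s n)) * complex_of_real (exp (- t\<^sup>2 / 2)))
        \<longlonglongrightarrow> (LINT t|lborel. cnj (f x) * complex_of_real (exp (- t\<^sup>2 / 2)))"
    proof (rule integral_dominated_convergence[where w="\<lambda>t. M * exp (- t\<^sup>2 / 2)"])
      show "AE t in lborel. (\<lambda>n. cnj (f (x - t / s n)) * complex_of_real (exp (- t\<^sup>2 / 2)))
          \<longlonglongrightarrow> cnj (f x) * complex_of_real (exp (- t\<^sup>2 / 2))"
      proof (rule AE_I2)
        fix t
        have "(\<lambda>n. inverse (real (Suc n))) \<longlonglongrightarrow> 0"
          by (rule LIMSEQ_inverse_real_of_nat)
        then have "(\<lambda>n. x - t * inverse (real (Suc n))) \<longlonglongrightarrow> x - t * 0"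
          by (intro tendsto_intros)
        then have "(\<lambda>n. x - t / s n) \<longlonglongrightarrow> x"
          by (simp add: s_def divide_inverse)
        with cont have "(\<lambda>n. f (x - t / s n)) \<longlonglongrightarrow> f x"
          by (auto intro: continuous_on_tendsto_compose)
        then show "(\<lambda>n. cnj (f (x - t / s n)) * complex_of_real (exp (- t\<^sup>2 / 2)))
          \<longlonglongrightarrow> cnj (f x) * complex_of_real (exp (- t\<^sup>2 / 2))"
          by (intro tendsto_intros)
      qed
    qed (use gauss_int dom in auto)
    also have "(LINT t|lborel. cnj (f x) * complex_of_real (exp (- t\<^sup>2 / 2)))
        = cnj (f x) * of_real (sqrt (2 * pi))"
      by (simp only: integral_mult_right_zero integral_complex_of_real integral_gauss)
    finally have "(\<lambda>n. A n x) \<longlonglongrightarrow> of_real (sqrt (2 * pi)) * (cnj (f x) * of_real (sqrt (2 * pi)))"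
      unfolding A_def by (intro tendsto_intros)
    moreover have "complex_of_real (sqrt (2 * pi)) * of_real (sqrt (2 * pi)) = of_real (2 * pi)"
      unfolding of_real_mult[symmetric] by simp
    ultimately show ?thesis by (simp add: ac_simps)
  qed
  have A_bound: "norm (A n x) \<le> 2 * pi * M" for n x
  proof -
    have int: "integrable lborel (\<lambda>t. cnj (f (x - t / s n)) * complex_of_real (exp (- t\<^sup>2 / 2)))"
      by (rule Bochner_Integration.integrable_bound[of lborel "\<lambda>t. M * exp (- t\<^sup>2 / 2)"])
         (use gauss_int order_trans[OF dom abs_ge_self] in auto)
    have "norm (LINT t|lborel. cnj (f (x - t / s n)) * complex_of_real (exp (- t\<^sup>2 / 2)))
        \<le> (LINT t|lborel. norm (cnj (f (x - t / s n)) * complex_of_real (exp (- t\<^sup>2 / 2))))"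
      by (rule integral_norm_bound)
    also have "\<dots> \<le> (LINT t|lborel. M * exp (- t\<^sup>2 / 2))"
      using gauss_int int dom by (intro integral_mono) auto
    also have "\<dots> = M * sqrt (2 * pi)"
      by (simp only: integral_mult_right_zero integral_gauss)
    finally have "norm (A n x) \<le> sqrt (2 * pi) * (M * sqrt (2 * pi))"
      unfolding A_def norm_mult by (intro mult_mono) auto
    then show ?thesis by (simp add: algebra_simps flip: real_sqrt_mult power2_eq_square)
  qed
  have A_meas [measurable]: "A n \<in> borel_measurable borel" for n
    unfolding A_def by measurable
  have lim: "(\<lambda>n. LINT x|lborel. f x * A n x) \<longlonglongrightarrow> (LINT x|lborel. f x * (of_real (2 * pi) * cnj (f x)))"
  proof (rule integral_dominated_convergence[where w="\<lambda>x. norm (f x) * (2 * pi * M)"])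
    show "integrable lborel (\<lambda>x. norm (f x) * (2 * pi * M))"
      using f by auto
    show "AE x in lborel. (\<lambda>n. f x * A n x) \<longlonglongrightarrow> f x * (of_real (2 * pi) * cnj (f x))"
      by (intro AE_I2 tendsto_mult tendsto_const A_lim)
    show "AE x in lborel. norm (f x * A n x) \<le> norm (f x) * (2 * pi * M)" for n
      unfolding norm_mult by (intro AE_I2 mult_left_mono A_bound) auto
  qed measurable
  also have "(LINT x|lborel. f x * (of_real (2 * pi) * cnj (f x)))
      = of_real (2 * pi * (l2_norm f)\<^sup>2)"
    unfolding of_real_mult[of "2 * pi"] l2_inner_self[symmetric] l2_inner_def
    by (subst integral_mult_right_zero[symmetric]) (simp add: ac_simps)
  finally have lim_A: "(\<lambda>n. LINT x|lborel. f x * A n x) \<longlonglongrightarrow> of_real (2 * pi * (l2_norm f)\<^sup>2)" .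
  have A_eq: "(LINT x|lborel. f x * A n x)
      = of_real (LINT \<xi>|lborel. (norm (FT f \<xi>))\<^sup>2 * exp (- (\<xi> / s n)\<^sup>2 / 2))" for n
    unfolding A_def gauss_weighted_FT[OF f s, symmetric] integral_complex_of_real[symmetric]
      gauss_def of_real_mult complex_norm_square mult.assoc ..
  have lim': "(\<lambda>n. LINT \<xi>|lborel. (norm (FT f \<xi>))\<^sup>2 * exp (- (\<xi> / s n)\<^sup>2 / 2))
      \<longlonglongrightarrow> 2 * pi * (l2_norm f)\<^sup>2"
    using lim_A unfolding A_eq tendsto_of_real_iff .
  have int: "integrable lborel (\<lambda>\<xi>. (norm (FT f \<xi>))\<^sup>2 * exp (- (\<xi> / s n)\<^sup>2 / 2))" for n
  proof (rule Bochner_Integration.integrable_bound)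
    show "integrable lborel (\<lambda>\<xi>. of_real ((LINT x|lborel. norm (f x))\<^sup>2) * gauss (s n) \<xi>)"
      by (intro integrable_mult_right integrable_gauss s)
    show "AE \<xi> in lborel. norm ((norm (FT f \<xi>))\<^sup>2 * exp (- (\<xi> / s n)\<^sup>2 / 2))
        \<le> norm (of_real ((LINT x|lborel. norm (f x))\<^sup>2) * gauss (s n) \<xi>)"
      unfolding gauss_def norm_mult
      by (intro AE_I2 mult_mono) (auto simp: norm_power intro!: power_mono order_trans[OF norm_FT_le order_refl])
  qed measurable
  have mono: "mono (\<lambda>n. (norm (FT f \<xi>))\<^sup>2 * exp (- (\<xi> / s n)\<^sup>2 / 2))" for \<xi>
  proof (rule monoI)
    fix m n :: nat assume "m \<le> n"
    then have "s m \<le> s n" by (simp add: s_def)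
    then have "(s m)\<^sup>2 \<le> (s n)\<^sup>2" using s[of m] by (intro power_mono) auto
    then have "\<xi>\<^sup>2 / (s n)\<^sup>2 \<le> \<xi>\<^sup>2 / (s m)\<^sup>2"
      using s[of m] by (intro divide_left_mono) (auto intro!: mult_pos_pos zero_less_power s)
    then show "(norm (FT f \<xi>))\<^sup>2 * exp (- (\<xi> / s m)\<^sup>2 / 2) \<le> (norm (FT f \<xi>))\<^sup>2 * exp (- (\<xi> / s n)\<^sup>2 / 2)"
      by (intro mult_left_mono) (auto simp: power_divide)
  qed
  have conv: "(\<lambda>n. (norm (FT f \<xi>))\<^sup>2 * exp (- (\<xi> / s n)\<^sup>2 / 2)) \<longlonglongrightarrow> (norm (FT f \<xi>))\<^sup>2" for \<xi>
  proof -
    have "(\<lambda>n. \<xi> * inverse (real (Suc n))) \<longlonglongrightarrow> \<xi> * 0"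
      by (rule tendsto_mult[OF tendsto_const LIMSEQ_inverse_real_of_nat])
    then have "(\<lambda>n. \<xi> / s n) \<longlonglongrightarrow> 0"
      by (simp add: s_def divide_inverse)
    from tendsto_mult[OF tendsto_const tendsto_exp[OF tendsto_divide[OF tendsto_minus[OF
        tendsto_power[OF this, of 2]] tendsto_const, of 2]], of "(norm (FT f \<xi>))\<^sup>2"]
    show ?thesis by simp
  qed
  have meas: "(\<lambda>\<xi>. (norm (FT f \<xi>))\<^sup>2) \<in> borel_measurable lborel"
    by measurable
  note * = integrable_monotone_convergence[OF int AE_I2[OF mono] AE_I2[OF conv] lim' meas]
    integral_monotone_convergence[OF int AE_I2[OF mono] AE_I2[OF conv] lim' meas]
  show "FT f \<in> L2" using * by (simp add: L2_iff)
  show "l2_norm (FT f) = sqrt (2 * pi) * l2_norm f"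
    using * by (simp add: l2_norm_def[of "FT f"] real_sqrt_mult)
qed

lemma FT_tendsto_dominated:
  fixes F :: "nat \<Rightarrow> real \<Rightarrow> complex"
  assumes [measurable]: "\<And>n. F n \<in> borel_measurable borel" "f \<in> borel_measurable borel"
    and h: "integrable lborel h" "\<And>n. AE x in lborel. norm (F n x) \<le> h x"
    and lim: "AE x in lborel. (\<lambda>n. F n x) \<longlonglongrightarrow> f x"
  shows "(\<lambda>n. FT (F n) \<xi>) \<longlonglongrightarrow> FT f \<xi>"
  unfolding FT_def
proof (rule integral_dominated_convergence[OF _ _ h(1)])
  show "AE x in lborel. (\<lambda>n. fker x \<xi> * F n x) \<longlonglongrightarrow> fker x \<xi> * f x"
    using lim by eventually_elim (intro tendsto_intros)
  show "AE x in lborel. norm (fker x \<xi> * F n x) \<le> h x" for n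
    using h(2)[of n] by (simp add: norm_mult)
qed measurable

text \<open>
  Plancherel's identity passes to dominated limits. Since \<open>FT (F n)\<close> converges pointwise only,
  convergence in the mean has to come from Fatou's lemma applied to \<open>FT (F m - F n)\<close> as
  \<open>n \<longlonglongrightarrow> \<infinity>\<close>, which is why the identity is needed for the differences as well.
\<close>

lemma FT_plancherel_limit:
  fixes F :: "nat \<Rightarrow> real \<Rightarrow> complex" and h :: "real \<Rightarrow> real"
  assumes F: "\<And>n. FT (F n) \<in> L2" "\<And>n. l2_norm (FT (F n)) = sqrt (2 * pi) * l2_norm (F n)"
    and diff: "\<And>m n. l2_norm (FT (\<lambda>x. F m x - F n x)) = sqrt (2 * pi) * l2_norm (\<lambda>x. F m x - F n x)"
    and [measurable]: "\<And>n. F n \<in> borel_measurable borel" "f \<in> borel_measurable borel"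
    and h: "integrable lborel h" "h \<in> L2" "\<And>n. AE x in lborel. norm (F n x) \<le> h x"
    and lim: "AE x in lborel. (\<lambda>n. F n x) \<longlonglongrightarrow> f x"
  shows "FT f \<in> L2" "l2_norm (FT f) = sqrt (2 * pi) * l2_norm f"
proof -
  have conv: "(\<lambda>n. FT (F n) \<xi>) \<longlonglongrightarrow> FT f \<xi>" for \<xi>
    by (rule FT_tendsto_dominated[OF _ _ h(1,3) lim]) measurable
  have Ff: "l2_tendsto F f"
    by (rule l2_tendsto_dominated[OF _ _ h(2,3) lim]) measurable
  have Fint: "integrable lborel (F n)" for n
  proof (rule Bochner_Integration.integrable_bound[OF h(1)])
    show "AE x in lborel. norm (F n x) \<le> norm (h x)"
      using h(3)[of n] by eventually_elim auto
  qed measurable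
  have *: "(\<lambda>\<xi>. FT (F m) \<xi> - FT f \<xi>) \<in> L2 \<and>
      l2_norm (\<lambda>\<xi>. FT (F m) \<xi> - FT f \<xi>) \<le> sqrt (2 * pi) * l2_norm (\<lambda>x. F m x - f x)" for m
  proof -
    have "l2_tendsto (\<lambda>n x. F m x - F n x) (\<lambda>x. F m x - f x)"
      using l2_tendsto_add[OF _ l2_tendsto_cmult[OF Ff, of "-1"], of "\<lambda>_. F m" "F m"]
        l2_tendstoD(1)[OF Ff, of m] by (simp add: l2_tendsto_def l2_norm_def)
    then have nconv: "(\<lambda>n. sqrt (2 * pi) * l2_norm (\<lambda>x. F m x - F n x))
        \<longlonglongrightarrow> sqrt (2 * pi) * l2_norm (\<lambda>x. F m x - f x)"
      by (intro tendsto_intros l2_tendsto_norm)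
    have lim': "AE \<xi> in lborel. (\<lambda>n. FT (F m) \<xi> - FT (F n) \<xi>) \<longlonglongrightarrow> FT (F m) \<xi> - FT f \<xi>"
      by (intro AE_I2 tendsto_intros conv)
    have b: "l2_norm (\<lambda>\<xi>. FT (F m) \<xi> - FT (F n) \<xi>) \<le> sqrt (2 * pi) * l2_norm (\<lambda>x. F m x - F n x)" for n
      using diff[of m n] by (simp add: FT_diff[OF Fint Fint, abs_def])
    have meas: "(\<lambda>\<xi>. FT (F m) \<xi> - FT f \<xi>) \<in> borel_measurable borel"
      by measurable
    show ?thesis
      using L2_fatou[OF L2_diff[OF F(1) F(1)] meas lim' b nconv] by blast
  qed
  from L2_diff[OF F(1)[of 0] conjunct1[OF *[of 0]]] show L: "FT f \<in> L2" by simp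
  have "l2_tendsto (\<lambda>n. FT (F n)) (FT f)"
    by (rule l2_tendsto_bounded_linear[OF Ff]) (use F L * in auto)
  then have "(\<lambda>n. l2_norm (FT (F n))) \<longlonglongrightarrow> l2_norm (FT f)"
    by (rule l2_tendsto_norm)
  moreover have "(\<lambda>n. l2_norm (FT (F n))) \<longlonglongrightarrow> sqrt (2 * pi) * l2_norm f"
    unfolding F(2) by (intro tendsto_intros l2_tendsto_norm Ff)
  ultimately show "l2_norm (FT f) = sqrt (2 * pi) * l2_norm f"
    by (rule LIMSEQ_unique)
qed

lemma borel_measurable_continuous_approx:
  fixes f :: "real \<Rightarrow> complex"
  assumes "f \<in> borel_measurable borel"
  shows "\<exists>g. (\<forall>n. continuous_on UNIV (g n)) \<and> (AE x in lborel. (\<lambda>n. g n x) \<longlonglongrightarrow> f x)"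
proof -
  have "f \<in> borel_measurable lebesgue"
    using assms by (intro measurable_completion) simp
  then have "f measurable_on UNIV"
    by (rule lebesgue_measurable_imp_measurable_on) simp
  then obtain N g where N: "negligible N" and g: "\<And>n. continuous_on UNIV (g n)"
    "\<And>x. x \<notin> N \<Longrightarrow> (\<lambda>n. g n x) \<longlonglongrightarrow> f x"
    unfolding measurable_on_def by auto
  have "AE x in lebesgue. x \<notin> N"
    using N unfolding negligible_iff_null_sets by (rule AE_not_in)
  then have "AE x in lborel. x \<notin> N"
    by (simp add: AE_completion_iff)
  then have "AE x in lborel. (\<lambda>n. g n x) \<longlonglongrightarrow> f x"
    by eventually_elim (rule g)
  with g show ?thesis by blast
qed

text \<open>
  A bounded function of bounded support is an almost everywhere limit of continuous functions.
  Cutting their values back to a disc and multiplying them by a fixed continuous bump makes them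
  dominated by a multiple of one indicator function.
\<close>

lemma FT_plancherel_bounded:
  assumes [measurable]: "f \<in> borel_measurable borel"
    and bound: "\<And>x. norm (f x) \<le> M" and supp: "\<And>x. \<bar>x\<bar> > R \<Longrightarrow> f x = 0"
  shows "FT f \<in> L2" "l2_norm (FT f) = sqrt (2 * pi) * l2_norm f"
proof -
  obtain g where g: "\<And>n. continuous_on UNIV (g n)" and glim: "AE x in lborel. (\<lambda>n. g n x) \<longlonglongrightarrow> f x"
    using borel_measurable_continuous_approx[of f] by auto
  \<comment> \<open>A positive bound, so that \<open>cut\<close> does not divide by zero.\<close>
  define K where "K = max M 1"
  have K: "K > 0" "\<And>x. norm (f x) \<le> K"
    using bound by (auto simp: K_def le_max_iff_disj)
  define cut where "cut z = z * of_real (K / max K (norm z))" for z :: complex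
  have cut_le: "norm (cut z) \<le> K" for z
  proof -
    have "norm z * K \<le> max K (norm z) * K" using K by (intro mult_right_mono) auto
    then show ?thesis
      using K by (simp add: cut_def norm_mult norm_divide divide_le_eq mult.commute)
  qed
  have cut_id: "cut z = z" if "norm z \<le> K" for z
    using that K(1) by (simp add: cut_def max_absorb1)
  have cut_cont: "continuous_on UNIV cut"
    unfolding cut_def by (intro continuous_intros) (use K in auto)
  define cutoff where "cutoff x = complex_of_real (max 0 (min 1 (R + 1 - \<bar>x\<bar>)))" for x
  have cutoff_cont: "continuous_on UNIV cutoff"
    unfolding cutoff_def by (intro continuous_intros)
  have cutoff_le: "norm (cutoff x) \<le> 1" for x
    by (auto simp: cutoff_def)
  define G where "G n x = cutoff x * cut (g n x)" for n x
  have G_cont: "continuous_on UNIV (G n)" for n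
    unfolding G_def
    by (intro continuous_on_mult cutoff_cont continuous_on_compose2[OF cut_cont g]) auto
  have Gm [measurable]: "G n \<in> borel_measurable borel" for n
    by (rule borel_measurable_continuous_onI[OF G_cont])
  define h where "h x = K * indicator {- (R + 1)..R + 1} x" for x :: real
  have h_int: "integrable lborel h"
    unfolding h_def by (intro integrable_mult_right integrable_real_indicator)
      (auto simp: emeasure_lborel_Icc_eq)
  have "integrable lborel (\<lambda>x. K * h x)" using h_int by simp
  moreover have "(\<lambda>x. K * h x) = (\<lambda>x. (norm (h x))\<^sup>2)"
    by (auto simp: h_def indicator_def power2_eq_square)
  ultimately have h_L2: "h \<in> L2"
    unfolding L2_iff using h_int by (auto dest: borel_measurable_integrable)
  have G_h: "norm (G n x) \<le> h x" for n x
  proof (cases "\<bar>x\<bar> \<le> R + 1")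
    case True
    have "norm (G n x) \<le> 1 * K"
      unfolding G_def norm_mult by (intro mult_mono cutoff_le cut_le) auto
    then show ?thesis using True by (simp add: h_def indicator_def abs_le_iff)
  next
    case False
    then show ?thesis using K(1) by (simp add: G_def cutoff_def h_def)
  qed
  have h_le: "h x \<le> K" for x
    using K(1) by (simp add: h_def indicator_def)
  have G_int: "integrable lborel (G n)" for n
    by (rule Bochner_Integration.integrable_bound[OF h_int])
       (use G_h order_trans[OF G_h abs_ge_self] in auto)
  have lim: "AE x in lborel. (\<lambda>n. G n x) \<longlonglongrightarrow> f x"
    using glim
  proof eventually_elim
    case (elim x)
    have "(\<lambda>n. cut (g n x)) \<longlonglongrightarrow> cut (f x)"
      by (rule continuous_on_tendsto_compose[OF cut_cont elim]) auto
    then have "(\<lambda>n. G n x) \<longlonglongrightarrow> cutoff x * f x"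
      unfolding G_def cut_id[OF K(2)] by (intro tendsto_intros)
    moreover have "cutoff x * f x = f x"
      using supp[of x] by (cases "\<bar>x\<bar> > R") (auto simp: cutoff_def)
    ultimately show ?case by simp
  qed
  have diff_le: "norm (G m x - G n x) \<le> K + K" for m n x
    using norm_triangle_ineq4[of "G m x" "G n x"] G_h[of m x] G_h[of n x] h_le[of x] by linarith
  have plG: "FT (G n) \<in> L2" "l2_norm (FT (G n)) = sqrt (2 * pi) * l2_norm (G n)" for n
    using FT_plancherel_continuous[OF G_cont _ G_int, of n K] order_trans[OF G_h h_le] by auto
  have pld: "l2_norm (FT (\<lambda>x. G m x - G n x)) = sqrt (2 * pi) * l2_norm (\<lambda>x. G m x - G n x)" for m n
    by (rule FT_plancherel_continuous(2)[OF _ diff_le])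
       (auto intro!: continuous_on_diff G_cont Bochner_Integration.integrable_diff G_int)
  have dom: "AE x in lborel. norm (G n x) \<le> h x" for n
    by (rule AE_I2) (rule G_h)
  note * = FT_plancherel_limit[OF plG pld Gm assms(1) h_int h_L2 dom lim]
  show "FT f \<in> L2" by (rule *(1))
  show "l2_norm (FT f) = sqrt (2 * pi) * l2_norm f" by (rule *(2))
qed

theorem FT_plancherel:
  assumes f: "integrable lborel f" "f \<in> L2"
  shows "FT f \<in> L2" "l2_norm (FT f) = sqrt (2 * pi) * l2_norm f"
proof -
  have [measurable]: "f \<in> borel_measurable borel"
    using f by (auto simp: L2_iff)
  define F where "F n x = (if \<bar>x\<bar> \<le> real n \<and> norm (f x) \<le> real n then f x else 0)" for n x
  have Fm [measurable]: "F n \<in> borel_measurable borel" for n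
    unfolding F_def by measurable
  have F_le: "norm (F n x) \<le> real n" and F_f: "norm (F n x) \<le> norm (f x)" for n x
    by (auto simp: F_def)
  have F_supp: "F n x = 0" if "\<bar>x\<bar> > real n" for n x
    using that by (auto simp: F_def)
  have lim: "(\<lambda>n. F n x) \<longlonglongrightarrow> f x" for x
  proof (rule tendsto_eventually)
    obtain N :: nat where N: "max \<bar>x\<bar> (norm (f x)) \<le> real N"
      using real_arch_simple by blast
    show "\<forall>\<^sub>F n in sequentially. F n x = f x"
      using eventually_ge_at_top[of N] by eventually_elim (use N in \<open>auto simp: F_def\<close>)
  qed
  have plF: "FT (F n) \<in> L2" "l2_norm (FT (F n)) = sqrt (2 * pi) * l2_norm (F n)" for n
    using FT_plancherel_bounded[of "F n" "real n" "real n"] F_le F_supp by auto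
  have pld: "l2_norm (FT (\<lambda>x. F m x - F n x)) = sqrt (2 * pi) * l2_norm (\<lambda>x. F m x - F n x)" for m n
  proof (rule FT_plancherel_bounded(2))
    show "norm (F m x - F n x) \<le> real m + real n" for x
      using norm_triangle_ineq4[of "F m x" "F n x"] F_le[of m x] F_le[of n x] by linarith
    show "F m x - F n x = 0" if "\<bar>x\<bar> > max (real m) (real n)" for x
      using that F_supp by simp
  qed measurable
  have h: "integrable lborel (\<lambda>x. norm (f x))" "(\<lambda>x. norm (f x)) \<in> L2"
    using f by (auto simp: L2_iff)
  have dom: "AE x in lborel. norm (F n x) \<le> norm (f x)" for n
    by (rule AE_I2) (rule F_f)
  note * = FT_plancherel_limit[OF plF pld Fm L2_measurable[OF f(2)] h dom AE_I2[OF lim]]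
  show "FT f \<in> L2" by (rule *(1))
  show "l2_norm (FT f) = sqrt (2 * pi) * l2_norm f" by (rule *(2))
qed

section \<open>The Fourier transform as a unitary map up to the factor \<open>sqrt (2 * pi)\<close>\<close>

definition trunc :: "(real \<Rightarrow> complex) \<Rightarrow> nat \<Rightarrow> real \<Rightarrow> complex" where
  "trunc f n x = indicator {- real n..real n} x * f x"

lemma fourier_trunc_eq_FT: "fourier_trunc f n = FT (trunc f n)"
  unfolding fourier_trunc_def FT_def trunc_def set_lebesgue_integral_def fker_def
  by (intro ext Bochner_Integration.integral_cong) (auto simp: indicator_def)

lemma trunc_L2: "f \<in> L2 \<Longrightarrow> trunc f n \<in> L2"
  unfolding trunc_def by (rule L2_indicator_mult) auto

lemma integrable_trunc:
  assumes "f \<in> L2"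
  shows "integrable lborel (trunc f n)"
proof -
  have "indicator {- real n..real n} \<in> (L2 :: (real \<Rightarrow> complex) set)"
  proof -
    have "integrable lborel (indicator {- real n..real n} :: real \<Rightarrow> real)"
      by (intro integrable_real_indicator) (auto simp: emeasure_lborel_Icc_eq)
    moreover have "(\<lambda>x. (norm (indicator {- real n..real n} x :: complex))\<^sup>2) = indicator {- real n..real n}"
      by (auto simp: indicator_def)
    ultimately show ?thesis by (simp add: L2_iff)
  qed
  then show ?thesis
    unfolding trunc_def by (rule L2_integrable_mult[OF _ assms])
qed

lemma trunc_tendsto: "(\<lambda>n. trunc f n x) \<longlonglongrightarrow> f x"
proof (rule tendsto_eventually)
  obtain N :: nat where N: "\<bar>x\<bar> \<le> real N" using real_arch_simple by blast
  show "\<forall>\<^sub>F n in sequentially. trunc f n x = f x"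
    using eventually_ge_at_top[of N]
    by eventually_elim (use N in \<open>auto simp: trunc_def abs_le_iff\<close>)
qed

lemma l2_tendsto_trunc:
  assumes "f \<in> L2"
  shows "l2_tendsto (trunc f) f"
proof (rule l2_tendsto_dominated[where w="\<lambda>x. norm (f x)"])
  show "(\<lambda>x. norm (f x)) \<in> L2" using assms by (auto simp: L2_iff)
  show "AE x in lborel. (\<lambda>n. trunc f n x) \<longlonglongrightarrow> f x" by (intro AE_I2 trunc_tendsto)
qed (use assms trunc_L2[OF assms] in \<open>auto simp: L2_iff trunc_def indicator_def\<close>)

text \<open>
  The limit chosen in the definition of \<open>fourier\<close> exists: by Plancherel's identity the transforms of
  the truncations form a Cauchy sequence.
\<close>

lemma l2_tendsto_fourier:
  assumes f: "f \<in> L2"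
  shows "l2_tendsto (fourier_trunc f) (fourier f)"
proof -
  note tr = l2_tendsto_trunc[OF f] and T = trunc_L2[OF f] and I = integrable_trunc[OF f]
  have eq: "l2_norm (\<lambda>\<xi>. FT (trunc f m) \<xi> - FT (trunc f n) \<xi>)
      = sqrt (2 * pi) * l2_norm (\<lambda>x. trunc f m x - trunc f n x)" for m n
    using FT_plancherel(2)[OF Bochner_Integration.integrable_diff[OF I I] L2_diff[OF T T], of m n]
    by (simp add: FT_diff[OF I I, abs_def])
  have "\<exists>g. l2_tendsto (fourier_trunc f) g"
    unfolding fourier_trunc_eq_FT
  proof (rule L2_complete)
    show "FT (trunc f n) \<in> L2" for n
      by (rule FT_plancherel(1)[OF I T])
    fix e :: real assume "e > 0"
    define d where "d = e / (2 * sqrt (2 * pi))"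
    have "d > 0" using \<open>e > 0\<close> by (simp add: d_def)
    with l2_tendstoD(3)[OF tr] obtain N where "\<And>n. n \<ge> N \<Longrightarrow> \<bar>l2_norm (\<lambda>x. trunc f n x - f x)\<bar> < d"
      unfolding LIMSEQ_iff by auto
    then have N: "\<And>n. n \<ge> N \<Longrightarrow> l2_norm (\<lambda>x. trunc f n x - f x) < d"
      by (auto simp: abs_less_iff)
    have "l2_norm (\<lambda>\<xi>. FT (trunc f m) \<xi> - FT (trunc f n) \<xi>) < e" if "m \<ge> N" "n \<ge> N" for m n
    proof -
      have "l2_norm (\<lambda>x. trunc f m x - trunc f n x) < d + d"
        using l2_norm_triangle_diff[OF T f T, of m n] N[OF that(1)] N[OF that(2)]
        by (simp add: l2_norm_minus_commute[of f])
      then have "sqrt (2 * pi) * l2_norm (\<lambda>x. trunc f m x - trunc f n x) < sqrt (2 * pi) * (d + d)"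
        by (intro mult_strict_left_mono) auto
      also have "\<dots> = e" by (simp add: d_def)
      finally show ?thesis unfolding eq .
    qed
    then show "\<exists>N. \<forall>m\<ge>N. \<forall>n\<ge>N. l2_norm (\<lambda>\<xi>. FT (trunc f m) \<xi> - FT (trunc f n) \<xi>) < e"
      by blast
  qed
  then show ?thesis
    unfolding fourier_def by (rule someI_ex)
qed

lemma fourier_L2 [simp]: "f \<in> L2 \<Longrightarrow> fourier f \<in> L2"
  by (rule l2_tendstoD(2)[OF l2_tendsto_fourier])

lemma l2_norm_fourier:
  assumes "f \<in> L2"
  shows "l2_norm (fourier f) = sqrt (2 * pi) * l2_norm f"
proof (rule LIMSEQ_unique)
  show "(\<lambda>n. l2_norm (fourier_trunc f n)) \<longlonglongrightarrow> l2_norm (fourier f)"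
    by (rule l2_tendsto_norm[OF l2_tendsto_fourier[OF assms]])
  show "(\<lambda>n. l2_norm (fourier_trunc f n)) \<longlonglongrightarrow> sqrt (2 * pi) * l2_norm f"
    unfolding fourier_trunc_eq_FT FT_plancherel(2)[OF integrable_trunc[OF assms] trunc_L2[OF assms]]
    by (intro tendsto_intros l2_tendsto_norm l2_tendsto_trunc assms)
qed

lemma FT_add:
  "integrable lborel f \<Longrightarrow> integrable lborel g \<Longrightarrow> FT (\<lambda>x. f x + g x) \<xi> = FT f \<xi> + FT g \<xi>"
  unfolding FT_def
  by (simp add: distrib_left integrable_fker_mult Bochner_Integration.integral_add)

lemma FT_cmult: "FT (\<lambda>x. c * f x) \<xi> = c * FT f \<xi>"
  unfolding FT_def by (simp add: mult.left_commute)

lemma fourier_add: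
  assumes "f \<in> L2" "g \<in> L2"
  shows "eq_ae (fourier (\<lambda>x. f x + g x)) (\<lambda>\<xi>. fourier f \<xi> + fourier g \<xi>)"
proof (rule l2_tendsto_unique)
  have "trunc (\<lambda>x. f x + g x) n = (\<lambda>x. trunc f n x + trunc g n x)" for n
    by (auto simp: trunc_def distrib_left)
  then have "fourier_trunc (\<lambda>x. f x + g x) n = (\<lambda>\<xi>. fourier_trunc f n \<xi> + fourier_trunc g n \<xi>)" for n
    using assms by (intro ext) (simp add: fourier_trunc_eq_FT FT_add integrable_trunc)
  then show "l2_tendsto (\<lambda>n \<xi>. fourier_trunc f n \<xi> + fourier_trunc g n \<xi>) (fourier (\<lambda>x. f x + g x))"
    using l2_tendsto_fourier[OF L2_add[OF assms]] by presburger
qed (intro l2_tendsto_add l2_tendsto_fourier assms)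

lemma fourier_cmult:
  assumes "f \<in> L2"
  shows "eq_ae (fourier (\<lambda>x. c * f x)) (\<lambda>\<xi>. c * fourier f \<xi>)"
proof (rule l2_tendsto_unique)
  have "trunc (\<lambda>x. c * f x) n = (\<lambda>x. c * trunc f n x)" for n
    by (auto simp: trunc_def)
  then have "fourier_trunc (\<lambda>x. c * f x) n = (\<lambda>\<xi>. c * fourier_trunc f n \<xi>)" for n
    by (simp add: fourier_trunc_eq_FT FT_cmult[abs_def])
  then show "l2_tendsto (\<lambda>n \<xi>. c * fourier_trunc f n \<xi>) (fourier (\<lambda>x. c * f x))"
    using l2_tendsto_fourier[OF L2_cmult[OF assms, of c]] by presburger
qed (intro l2_tendsto_cmult l2_tendsto_fourier assms)

lemma fourier_diff:
  assumes "f \<in> L2" "g \<in> L2"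
  shows "eq_ae (fourier (\<lambda>x. f x - g x)) (\<lambda>\<xi>. fourier f \<xi> - fourier g \<xi>)"
  using fourier_add[OF assms(1) L2_uminus[OF assms(2)]] fourier_cmult[OF assms(2), of "-1"]
  unfolding eq_ae_def by (simp, eventually_elim) simp

text \<open>
  Functions that agree almost everywhere have literally the same transform, since \<open>fourier\<close> chooses
  from the same set of limits. Membership in \<open>Hardy\<close>, the projection and the \<open>H\<^sup>1\<close> condition
  therefore depend only on the class of a function.
\<close>

lemma fourier_cong:
  assumes [measurable]: "f \<in> borel_measurable borel" "g \<in> borel_measurable borel" and eq: "eq_ae f g"
  shows "fourier f = fourier g"
proof -
  have "fourier_trunc f n \<xi> = fourier_trunc g n \<xi>" for n \<xi>
    unfolding fourier_trunc_eq_FT FT_def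
  proof (rule integral_cong_AE)
    show "AE x in lborel. fker x \<xi> * trunc f n x = fker x \<xi> * trunc g n x"
      using eq unfolding eq_ae_def by eventually_elim (simp add: trunc_def)
  qed (unfold trunc_def, measurable)
  then have "fourier_trunc f = fourier_trunc g" by blast
  then show ?thesis by (simp add: fourier_def)
qed

lemma fourier_eq_FT:
  assumes f: "integrable lborel f" "f \<in> L2"
  shows "eq_ae (fourier f) (FT f)"
proof (rule l2_tendsto_unique_AE[OF l2_tendsto_fourier[OF f(2)]])
  have [measurable]: "f \<in> borel_measurable borel" using f(2) by (auto simp: L2_iff)
  show "FT f \<in> borel_measurable borel" by measurable
  have "(\<lambda>n. FT (trunc f n) \<xi>) \<longlonglongrightarrow> FT f \<xi>" for \<xi>
  proof (rule FT_tendsto_dominated[where h="\<lambda>x. norm (f x)"])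
    show "AE x in lborel. (\<lambda>n. trunc f n x) \<longlonglongrightarrow> f x" by (intro AE_I2 trunc_tendsto)
  qed (use f trunc_L2[OF f(2)] in \<open>auto simp: L2_iff trunc_def indicator_def\<close>)
  then show "AE \<xi> in lborel. (\<lambda>n. fourier_trunc f n \<xi>) \<longlonglongrightarrow> FT f \<xi>"
    by (simp add: fourier_trunc_eq_FT)
qed

text \<open>Polarization turns the norm identity into an identity of inner products.\<close>

lemma fourier_parseval:
  assumes f: "f \<in> L2" and g: "g \<in> L2"
  shows "l2_inner (fourier f) (fourier g) = 2 * pi * l2_inner f g"
proof -
  have Re: "Re (l2_inner (fourier f) (fourier g)) = 2 * pi * Re (l2_inner f g)" if g: "g \<in> L2" for g
  proof -
    have sq: "(l2_norm (fourier h))\<^sup>2 = 2 * pi * (l2_norm h)\<^sup>2" if "h \<in> L2" for h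
      by (simp add: l2_norm_fourier that power_mult_distrib)
    have "l2_norm (\<lambda>\<xi>. fourier f \<xi> + fourier g \<xi>) = l2_norm (fourier (\<lambda>x. f x + g x))"
    proof (rule l2_norm_cong_AE)
      show "AE \<xi> in lborel. cmod (fourier f \<xi> + fourier g \<xi>) = cmod (fourier (\<lambda>x. f x + g x) \<xi>)"
        using fourier_add[OF f g] unfolding eq_ae_def by eventually_elim simp
    qed (use f g L2_add[OF f g] L2_add[OF fourier_L2[OF f] fourier_L2[OF g]] in
        \<open>auto intro: L2_measurable\<close>)
    then have "(l2_norm (\<lambda>\<xi>. fourier f \<xi> + fourier g \<xi>))\<^sup>2 = 2 * pi * (l2_norm (\<lambda>x. f x + g x))\<^sup>2"
      by (simp only: sq[OF L2_add[OF f g]])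
    then show ?thesis
      using f g by (simp add: l2_norm_add_square sq algebra_simps)
  qed
  have "Im (l2_inner (fourier f) (fourier g)) = Re (l2_inner (fourier f) (\<lambda>\<xi>. \<i> * fourier g \<xi>))"
    by (simp add: l2_inner_cmult_right)
  also have "l2_inner (fourier f) (\<lambda>\<xi>. \<i> * fourier g \<xi>) = l2_inner (fourier f) (fourier (\<lambda>x. \<i> * g x))"
    by (rule l2_inner_cong_AE) (use f g in \<open>auto intro!: fourier_L2 L2_cmult eq_ae_sym[OF fourier_cmult]\<close>)
  also have "Re \<dots> = 2 * pi * Im (l2_inner f g)"
    using Re[OF L2_cmult[OF g, of \<i>]] by (simp add: l2_inner_cmult_right)
  finally show ?thesis
    using Re[OF g] by (simp add: complex_eq_iff)
qed

text \<open>
  Injectivity turns almost every identity between operators below into a pointwise one between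
  transforms.
\<close>

lemma fourier_inj:
  assumes "f \<in> L2" "g \<in> L2" "eq_ae (fourier f) (fourier g)"
  shows "eq_ae f g"
proof -
  have "l2_norm (fourier (\<lambda>x. f x - g x)) = l2_norm (\<lambda>\<xi>. 0 :: complex)"
  proof (rule l2_norm_cong_AE)
    show "AE \<xi> in lborel. cmod (fourier (\<lambda>x. f x - g x) \<xi>) = cmod 0"
      using fourier_diff[OF assms(1,2)] assms(3) unfolding eq_ae_def by eventually_elim simp
  qed (use assms in \<open>auto intro!: L2_measurable fourier_L2 L2_diff\<close>)
  also have "\<dots> = 0"
    by (simp add: l2_norm_def)
  finally have "l2_norm (\<lambda>x. f x - g x) = 0"
    using assms by (simp add: l2_norm_fourier L2_diff)
  then show ?thesis using assms by (simp add: l2_norm_diff_eq_0_iff)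
qed

lemma l2_tendsto_integral_mult:
  fixes g :: "real \<Rightarrow> complex"
  assumes "l2_tendsto F f" "g \<in> L2"
  shows "(\<lambda>n. LINT x|lborel. F n x * g x) \<longlonglongrightarrow> (LINT x|lborel. f x * g x)"
  using l2_tendsto_inner_left[OF assms(1) L2_cnj[of g, OF assms(2)]] by (simp add: l2_inner_def)

text \<open>
  Passing to the limit in \<open>FT_duality\<close> for truncations, in one argument after the other.
\<close>

lemma fourier_duality:
  assumes f: "f \<in> L2" and g: "g \<in> L2"
  shows "(LINT \<xi>|lborel. fourier f \<xi> * g \<xi>) = (LINT x|lborel. f x * fourier g x)"
proof -
  have half: "(LINT \<xi>|lborel. fourier f \<xi> * trunc g m \<xi>) = (LINT x|lborel. f x * fourier_trunc g m x)" for m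
  proof (rule LIMSEQ_unique)
    show "(\<lambda>n. LINT \<xi>|lborel. fourier_trunc f n \<xi> * trunc g m \<xi>)
        \<longlonglongrightarrow> (LINT \<xi>|lborel. fourier f \<xi> * trunc g m \<xi>)"
      by (intro l2_tendsto_integral_mult l2_tendsto_fourier trunc_L2 f g)
    have "(\<lambda>n. LINT x|lborel. trunc f n x * fourier_trunc g m x)
        \<longlonglongrightarrow> (LINT x|lborel. f x * fourier_trunc g m x)"
      by (intro l2_tendsto_integral_mult l2_tendsto_trunc f l2_tendstoD(1)[OF l2_tendsto_fourier[OF g]])
    then show "(\<lambda>n. LINT \<xi>|lborel. fourier_trunc f n \<xi> * trunc g m \<xi>)
        \<longlonglongrightarrow> (LINT x|lborel. f x * fourier_trunc g m x)"
      by (simp add: fourier_trunc_eq_FT FT_duality integrable_trunc f g)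
  qed
  show ?thesis
  proof (rule LIMSEQ_unique)
    show "(\<lambda>m. LINT \<xi>|lborel. trunc g m \<xi> * fourier f \<xi>) \<longlonglongrightarrow> (LINT \<xi>|lborel. fourier f \<xi> * g \<xi>)"
      using l2_tendsto_integral_mult[OF l2_tendsto_trunc[OF g] fourier_L2[OF f]]
      by (simp add: mult.commute)
    show "(\<lambda>m. LINT \<xi>|lborel. trunc g m \<xi> * fourier f \<xi>) \<longlonglongrightarrow> (LINT x|lborel. f x * fourier g x)"
      using l2_tendsto_integral_mult[OF l2_tendsto_fourier[OF g] f] half
      by (simp add: mult.commute)
  qed
qed

definition inv_fourier :: "(real \<Rightarrow> complex) \<Rightarrow> real \<Rightarrow> complex" where
  "inv_fourier h x = of_real (1 / (2 * pi)) * cnj (fourier (\<lambda>\<xi>. cnj (h \<xi>)) x)"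

lemma inv_fourier_L2: "h \<in> L2 \<Longrightarrow> inv_fourier h \<in> L2"
  unfolding inv_fourier_def by (intro L2_cmult L2_cnj fourier_L2)

text \<open>
  Surjectivity: \<open>k = inv_fourier h\<close> satisfies \<open>\<langle>F k, F k\<rangle> = \<langle>h, F k\<rangle>\<close> by duality and Parseval,
  and \<open>\<parallel>F k\<parallel> = \<parallel>h\<parallel>\<close> since complex conjugation is isometric. Hence \<open>\<parallel>h - F k\<parallel>\<^sup>2 = 0\<close>.
\<close>

lemma fourier_inv_fourier:
  assumes h: "h \<in> L2"
  shows "eq_ae (fourier (inv_fourier h)) h"
proof -
  define k where "k = inv_fourier h"
  have k: "k \<in> L2" using h by (simp add: k_def inv_fourier_L2)
  have Fk: "fourier k \<in> L2" using k by simp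
  have norm_k: "l2_norm k = l2_norm h / sqrt (2 * pi)"
  proof -
    have "l2_norm k = norm (complex_of_real (1 / (2 * pi))) * l2_norm (\<lambda>x. cnj (fourier (\<lambda>\<xi>. cnj (h \<xi>)) x))"
      unfolding k_def inv_fourier_def by (rule l2_norm_cmult)
    also have "l2_norm (\<lambda>x. cnj (fourier (\<lambda>\<xi>. cnj (h \<xi>)) x)) = sqrt (2 * pi) * l2_norm (\<lambda>\<xi>. cnj (h \<xi>))"
      using l2_norm_fourier[OF L2_cnj[OF h]] by (simp add: l2_norm_def)
    also have "l2_norm (\<lambda>\<xi>. cnj (h \<xi>)) = l2_norm h"
      by (simp add: l2_norm_def)
    also have "norm (complex_of_real (1 / (2 * pi))) = 1 / (sqrt (2 * pi) * sqrt (2 * pi))"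
      unfolding norm_of_real by simp
    finally have eq: "l2_norm k = 1 / (sqrt (2 * pi) * sqrt (2 * pi)) * (sqrt (2 * pi) * l2_norm h)" .
    have cancel: "1 / (S * S) * (S * t) = t / S" if "S > 0" for S t :: real
      using that by (simp add: field_simps)
    show ?thesis unfolding eq by (rule cancel) simp
  qed
  have norm_Fk: "l2_norm (fourier k) = l2_norm h"
    using k by (simp add: l2_norm_fourier norm_k)
  have "l2_inner k k = of_real (1 / (2 * pi)) * cnj (LINT x|lborel. fourier (\<lambda>\<xi>. cnj (h \<xi>)) x * k x)"
    unfolding Bochner_Integration.integral_cnj[symmetric] integral_mult_right_zero[symmetric] l2_inner_def
    by (simp add: k_def inv_fourier_def mult.assoc)
  also have "(LINT x|lborel. fourier (\<lambda>\<xi>. cnj (h \<xi>)) x * k x) = cnj (l2_inner h (fourier k))"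
    unfolding l2_inner_def Bochner_Integration.integral_cnj[symmetric]
    by (simp add: fourier_duality L2_cnj h k)
  finally have "l2_inner h (fourier k) = 2 * pi * l2_inner k k"
    by (simp add: field_simps)
  also have "\<dots> = l2_inner (fourier k) (fourier k)"
    by (rule fourier_parseval[OF k k, symmetric])
  also have "\<dots> = of_real ((l2_norm h)\<^sup>2)"
    unfolding l2_inner_self norm_Fk ..
  finally have inner: "l2_inner h (fourier k) = of_real ((l2_norm h)\<^sup>2)" .
  have "(l2_norm (\<lambda>x. h x + - 1 * fourier k x))\<^sup>2
      = (l2_norm h)\<^sup>2 + 2 * Re (l2_inner h (\<lambda>x. - 1 * fourier k x)) + (l2_norm (\<lambda>x. - 1 * fourier k x))\<^sup>2"
    by (intro l2_norm_add_square h L2_cmult Fk)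
  also have "\<dots> = 0"
    unfolding l2_inner_cmult_right l2_norm_cmult by (simp add: inner norm_Fk)
  finally have "l2_norm (\<lambda>x. h x - fourier k x) = 0" by simp
  then have "eq_ae h (fourier k)" by (simp add: l2_norm_diff_eq_0_iff h Fk)
  then show ?thesis unfolding k_def by (rule eq_ae_sym)
qed

text \<open>
  Fourier inversion.
\<close>

lemma eq_ae_inv_fourier:
  assumes f: "f \<in> L2" and h: "h \<in> L2" "eq_ae (fourier f) h"
  shows "eq_ae f (inv_fourier h)"
  by (rule fourier_inj[OF f inv_fourier_L2[OF h(1)]])
     (rule eq_ae_trans[OF h(2) eq_ae_sym[OF fourier_inv_fourier[OF h(1)]]])

section \<open>Test functions\<close>

text \<open>
  The exponential series dominates each of its terms; this is what makes the bump function vanish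
  to every order at the end points of its support.
\<close>

lemma exp_minus_inverse_le_power:
  fixes q :: real
  assumes "q > 0"
  shows "exp (- 1 / q) \<le> fact n * q ^ n"
proof -
  have "(1 / q) ^ n / fact n \<le> exp (1 / q)"
  proof -
    have s: "(\<lambda>k. (1 / q) ^ k /\<^sub>R fact k) sums exp (1 / q)"
      by (rule exp_converges)
    have "(\<Sum>k\<in>{n}. (1 / q) ^ k /\<^sub>R fact k) \<le> (\<Sum>k. (1 / q) ^ k /\<^sub>R fact k)"
      using assms by (intro sum_le_suminf sums_summable[OF s]) auto
    also have "\<dots> = exp (1 / q)" using sums_unique[OF s] ..
    finally show ?thesis by (simp add: divide_inverse mult.commute)
  qed
  then show ?thesis
    using assms by (simp add: exp_minus field_simps)
qed

text \<open>
  The standard bump function is \<open>flat 1 0\<close>. The extra factor \<open>p(x) / (1 - x\<^sup>2)\<^sup>m\<close> gives a family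
  that is closed under differentiation, so that smoothness needs a single derivative.
\<close>

definition flat :: "real poly \<Rightarrow> nat \<Rightarrow> real \<Rightarrow> real" where
  "flat p m x = (if \<bar>x\<bar> < 1 then poly p x / (1 - x\<^sup>2) ^ m * exp (- 1 / (1 - x\<^sup>2)) else 0)"

text \<open>
  The numerator of the derivative, once it is written over \<open>(1 - x\<^sup>2)\<^sup>m\<^sup>+\<^sup>2\<close>.
\<close>

definition flat_deriv :: "real poly \<Rightarrow> nat \<Rightarrow> real poly" where
  "flat_deriv p m = pderiv p * [:1, 0, -1:]\<^sup>2 + smult (2 * real m) ([:0, 1:] * p * [:1, 0, -1:])
     - smult 2 ([:0, 1:] * p)"

lemma DERIV_quadratic_bound:
  fixes f :: "real \<Rightarrow> real"
  assumes "\<And>y. \<bar>f y\<bar> \<le> C * (y - x)\<^sup>2"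
  shows "(f has_real_derivative 0) (at x)"
proof -
  have fx: "f x = 0" using assms[of x] by simp
  have "(\<lambda>y. (f y - f x) / (y - x)) \<midarrow>x\<rightarrow> 0"
  proof (rule Lim_null_comparison)
    have "norm ((f y - f x) / (y - x)) \<le> C * \<bar>y - x\<bar>" for y
    proof (cases "y = x")
      case False
      have "\<bar>f y\<bar> \<le> C * \<bar>y - x\<bar> * \<bar>y - x\<bar>"
        using assms[of y] by (simp add: power2_eq_square)
      then show ?thesis using False by (simp add: fx field_simps)
    qed simp
    then show "\<forall>\<^sub>F y in at x. norm ((f y - f x) / (y - x)) \<le> C * \<bar>y - x\<bar>"
      by simp
    have "((\<lambda>y. C * \<bar>y - x\<bar>) \<longlongrightarrow> C * \<bar>x - x\<bar>) (at x)"
      by (intro tendsto_intros)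
    then show "(\<lambda>y. C * \<bar>y - x\<bar>) \<midarrow>x\<rightarrow> 0" by simp
  qed
  then show ?thesis by (simp add: has_field_derivative_iff)
qed

text \<open>
  At \<open>x = 1\<close> and \<open>x = -1\<close> the function vanishes to second order, which is all that is needed for
  its derivative there to be \<open>0\<close>: the factor \<open>exp (- 1 / q)\<close> with \<open>q = 1 - y\<^sup>2\<close> absorbs the
  denominator \<open>q\<^sup>m\<close> and leaves \<open>q\<^sup>2\<close>.
\<close>

lemma flat_quadratic_bound:
  assumes "\<bar>x\<bar> = 1"
  shows "\<exists>C. \<forall>y. \<bar>flat p m y\<bar> \<le> C * (y - x)\<^sup>2"
proof -
  have "compact (poly p ` {-1..1})"
    by (intro compact_continuous_image continuous_intros) auto
  then have "bounded (poly p ` {-1..1})" by (rule compact_imp_bounded)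
  then obtain B where "\<forall>y\<in>{-1..1}. \<bar>poly p y\<bar> \<le> B"
    unfolding bounded_iff by auto
  then have B: "\<bar>poly p y\<bar> \<le> B" if "\<bar>y\<bar> < 1" for y
    using that by (auto simp: abs_less_iff)
  have B0: "0 \<le> B" using B[of 0] by simp
  have "\<bar>flat p m y\<bar> \<le> (B * fact (m + 2) * 4) * (y - x)\<^sup>2" for y
  proof (cases "\<bar>y\<bar> < 1")
    case True
    define q where "q = 1 - y\<^sup>2"
    have q: "q > 0" using True by (simp add: q_def abs_square_less_1)
    have "q\<^sup>2 \<le> (2 * \<bar>y - x\<bar>)\<^sup>2"
    proof (rule power_mono)
      have "q = (1 - x * y) * (1 + x * y)"
        using assms by (auto simp: q_def abs_if algebra_simps power2_eq_square split: if_splits)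
      also have "\<dots> \<le> \<bar>y - x\<bar> * 2"
        using assms True by (intro mult_mono) (auto simp: abs_if split: if_splits)
      finally show "q \<le> 2 * \<bar>y - x\<bar>" by simp
    qed (use q in simp)
    then have q2: "q\<^sup>2 \<le> 4 * (y - x)\<^sup>2" by (simp add: power_mult_distrib)
    have "\<bar>flat p m y\<bar> = \<bar>poly p y\<bar> * (exp (- 1 / q) / q ^ m)"
      using True q by (simp add: flat_def q_def[symmetric] abs_mult)
    also have "\<dots> \<le> B * (fact (m + 2) * q ^ (m + 2) / q ^ m)"
      using q by (intro mult_mono B True divide_right_mono exp_minus_inverse_le_power B0) auto
    also have "\<dots> = B * fact (m + 2) * q\<^sup>2"
      using q by (simp add: power_add power2_eq_square)
    also have "\<dots> \<le> B * fact (m + 2) * (4 * (y - x)\<^sup>2)"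
      using B0 by (intro mult_left_mono q2) auto
    finally show ?thesis by (simp add: mult.assoc)
  qed (use B0 in \<open>simp add: flat_def\<close>)
  then show ?thesis by blast
qed

lemma DERIV_flat: "(flat p m has_real_derivative flat (flat_deriv p m) (m + 2) x) (at x)"
proof -
  consider "\<bar>x\<bar> < 1" | "\<bar>x\<bar> = 1" | "\<bar>x\<bar> > 1" by linarith
  then show ?thesis
  proof cases
    case 1
    define q where "q = 1 - x\<^sup>2"
    have q: "q > 0" using 1 by (simp add: q_def abs_square_less_1)
    have "((\<lambda>x. poly p x / (1 - x\<^sup>2) ^ m * exp (- 1 / (1 - x\<^sup>2))) has_real_derivative
        ((poly (pderiv p) x * q ^ m - poly p x * (m * q ^ (m - 1) * (- 2 * x))) / (q ^ m * q ^ m)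
          * exp (- 1 / q) + exp (- 1 / q) * (- 2 * x / (q * q)) * (poly p x / q ^ m))) (at x)"
      by (rule derivative_eq_intros poly_DERIV refl | use q in \<open>simp add: q_def\<close>)+
    also have "(poly (pderiv p) x * q ^ m - poly p x * (m * q ^ (m - 1) * (- 2 * x))) / (q ^ m * q ^ m)
          * exp (- 1 / q) + exp (- 1 / q) * (- 2 * x / (q * q)) * (poly p x / q ^ m)
        = flat (flat_deriv p m) (m + 2) x"
    proof -
      have "poly (flat_deriv p m) x = poly (pderiv p) x * q\<^sup>2 + 2 * m * x * poly p x * q - 2 * x * poly p x"
        by (simp add: flat_deriv_def q_def power2_eq_square algebra_simps)
      moreover have "(P' * q ^ m - P * (m * q ^ (m - 1) * (- 2 * x))) / (q ^ m * q ^ m) * E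
            + E * (- 2 * x / (q * q)) * (P / q ^ m)
          = (P' * q\<^sup>2 + 2 * m * x * P * q - 2 * x * P) / q ^ (m + 2) * E" for P P' E :: real
        using q by (cases m) (simp_all add: field_simps power2_eq_square)
      ultimately show ?thesis
        using 1 by (simp only: flat_def if_True q_def[symmetric])
    qed
    finally have "((\<lambda>x. poly p x / (1 - x\<^sup>2) ^ m * exp (- 1 / (1 - x\<^sup>2))) has_real_derivative
        flat (flat_deriv p m) (m + 2) x) (at x)" .
    then show ?thesis
    proof (rule has_field_derivative_transform_within_open)
      show "open {-1<..<1::real}" by simp
    qed (use 1 in \<open>auto simp: flat_def\<close>)
  next
    case 2
    with flat_quadratic_bound[OF 2, of p m] have "(flat p m has_real_derivative 0) (at x)"
      by (auto intro: DERIV_quadratic_bound)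
    with 2 show ?thesis by (simp add: flat_def)
  next
    case 3
    have "((\<lambda>x. 0) has_real_derivative 0) (at x)" by simp
    then have "(flat p m has_real_derivative 0) (at x)"
    proof (rule has_field_derivative_transform_within_open)
      show "open (- {-1..1::real})" by (simp add: open_Compl)
    qed (use 3 in \<open>auto simp: flat_def abs_if split: if_splits\<close>)
    with 3 show ?thesis by (simp add: flat_def)
  qed
qed

text \<open>
  The iterated derivatives remain multiples of functions of the same form, with the same dilation
  and translation.
\<close>

lemma test_function_flat:
  assumes c: "c > 0"
  shows "test_function (\<lambda>x. flat p m (c * (x - d)))"
proof -
  have D: "((\<lambda>x. a * flat p m (c * (x - d))) has_real_derivative
      a * c * flat (flat_deriv p m) (m + 2) (c * (x - d))) (at x)" for a p m x
  proof -
    have "((\<lambda>x. flat p m (c * (x - d))) has_real_derivative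
        flat (flat_deriv p m) (m + 2) (c * (x - d)) * c) (at x)"
      by (rule DERIV_chain2[OF DERIV_flat]) (auto intro!: derivative_eq_intros)
    from DERIV_cmult[OF this, of a] show ?thesis by (simp add: mult_ac)
  qed
  have iter: "\<exists>a p' m'. (deriv ^^ k) (\<lambda>x. flat p m (c * (x - d))) = (\<lambda>x. a * flat p' m' (c * (x - d)))" for k
  proof (induction k)
    case 0
    show ?case by (rule exI[of _ 1]) auto
  next
    case (Suc k)
    then obtain a p' m' where *: "(deriv ^^ k) (\<lambda>x. flat p m (c * (x - d))) = (\<lambda>x. a * flat p' m' (c * (x - d)))"
      by blast
    have "(deriv ^^ Suc k) (\<lambda>x. flat p m (c * (x - d)))
        = (\<lambda>x. a * c * flat (flat_deriv p' m') (m' + 2) (c * (x - d)))"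
      using * D[of a p' m'] by (auto intro!: DERIV_imp_deriv)
    then show ?case by blast
  qed
  have "(deriv ^^ k) (\<lambda>x. flat p m (c * (x - d))) differentiable_on UNIV" for k
  proof -
    obtain a p' m' where *: "(deriv ^^ k) (\<lambda>x. flat p m (c * (x - d))) = (\<lambda>x. a * flat p' m' (c * (x - d)))"
      using iter by blast
    show ?thesis
      unfolding * differentiable_on_def
      using D[of a p' m'] by (auto simp: real_differentiable_def intro: differentiable_at_withinI)
  qed
  moreover have "flat p m (c * (x - d)) = 0" if "\<bar>x\<bar> > \<bar>d\<bar> + 1 / c" for x
  proof -
    have "c * \<bar>x - d\<bar> > c * (1 / c)"
      using that c by (intro mult_strict_left_mono) auto
    then have "\<not> \<bar>c * (x - d)\<bar> < 1"
      using c by (simp add: abs_mult)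
    then show ?thesis unfolding flat_def by (rule if_not_P)
  qed
  ultimately show ?thesis unfolding test_function_def by blast
qed

lemma test_functionD:
  assumes "test_function \<phi>"
  shows "(\<phi> has_real_derivative deriv \<phi> x) (at x)" "continuous_on UNIV (deriv \<phi>)"
    "\<exists>R>0. \<forall>x. \<bar>x\<bar> > R \<longrightarrow> \<phi> x = 0 \<and> deriv \<phi> x = 0"
proof -
  from assms obtain R where R: "\<And>x. \<bar>x\<bar> > R \<Longrightarrow> \<phi> x = 0"
    and diff: "\<And>k. (deriv ^^ k) \<phi> differentiable_on UNIV"
    unfolding test_function_def by auto
  have D: "(\<phi> has_real_derivative deriv \<phi> x) (at x)" for x
    using diff[of 0] by (auto simp: differentiable_on_def real_differentiable_def dest: DERIV_imp_deriv)
  have cont: "continuous_on UNIV (deriv \<phi>)"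
    using differentiable_imp_continuous_on[OF diff[of 1]] by simp
  have "deriv \<phi> x = 0" if "\<bar>x\<bar> > R" for x
  proof -
    have "((\<lambda>x. 0) has_real_derivative 0) (at x)" by simp
    then have "(\<phi> has_real_derivative 0) (at x)"
    proof (rule has_field_derivative_transform_within_open)
      show "open {x. R < \<bar>x\<bar>}" by (intro open_Collect_less continuous_intros)
    qed (use that R in auto)
    then show ?thesis by (rule DERIV_imp_deriv)
  qed
  with R show "\<exists>R>0. \<forall>x. \<bar>x\<bar> > R \<longrightarrow> \<phi> x = 0 \<and> deriv \<phi> x = 0"
    by (intro exI[of _ "max R 1"]) auto
  show "(\<phi> has_real_derivative deriv \<phi> x) (at x)" "continuous_on UNIV (deriv \<phi>)"
    by (fact D cont)+
qed

lemma continuous_compact_support_L1_L2: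
  fixes f :: "real \<Rightarrow> complex"
  assumes cont: "continuous_on UNIV f" and supp: "\<And>x. \<bar>x\<bar> > R \<Longrightarrow> f x = 0"
  shows "integrable lborel f" "f \<in> L2"
proof -
  have ind: "indicator {-R..R} x *\<^sub>R g x = g x" if "\<And>x. \<bar>x\<bar> > R \<Longrightarrow> g x = 0"
    for g :: "real \<Rightarrow> 'b::real_vector" and x
    using that[of x] by (auto simp: indicator_def abs_if)
  have "integrable lborel (\<lambda>x. indicator {-R..R} x *\<^sub>R f x)"
    by (intro borel_integrable_compact continuous_on_subset[OF cont]) auto
  then show "integrable lborel f"
    using ind[of f] supp by simp
  have "integrable lborel (\<lambda>x. indicator {-R..R} x *\<^sub>R (norm (f x))\<^sup>2)"
    by (intro borel_integrable_compact continuous_intros continuous_on_subset[OF cont]) auto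
  then have "integrable lborel (\<lambda>x. (norm (f x))\<^sup>2)"
    by (subst (asm) ind) (auto simp: supp)
  then show "f \<in> L2"
    using borel_measurable_continuous_onI[OF cont] by (simp add: L2_iff)
qed

lemma test_function_L1_L2:
  assumes "test_function \<phi>"
  shows "integrable lborel (\<lambda>x. complex_of_real (\<phi> x))" "(\<lambda>x. complex_of_real (\<phi> x)) \<in> L2"
    "integrable lborel (\<lambda>x. complex_of_real (deriv \<phi> x))" "(\<lambda>x. complex_of_real (deriv \<phi> x)) \<in> L2"
proof -
  note D = test_functionD(1,2)[OF assms]
  obtain R where R: "R > 0" "\<And>x. \<bar>x\<bar> > R \<Longrightarrow> \<phi> x = 0" "\<And>x. \<bar>x\<bar> > R \<Longrightarrow> deriv \<phi> x = 0"
    using test_functionD(3)[OF assms] by blast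
  have "continuous_on UNIV \<phi>"
    using D(1) by (auto intro!: continuous_at_imp_continuous_on DERIV_isCont)
  then have c: "continuous_on UNIV (\<lambda>x. complex_of_real (\<phi> x))"
    "continuous_on UNIV (\<lambda>x. complex_of_real (deriv \<phi> x))"
    using D(2) by (auto intro: continuous_intros)
  show "integrable lborel (\<lambda>x. complex_of_real (\<phi> x))" "(\<lambda>x. complex_of_real (\<phi> x)) \<in> L2"
    using continuous_compact_support_L1_L2[OF c(1), of R] R(2) by auto
  show "integrable lborel (\<lambda>x. complex_of_real (deriv \<phi> x))" "(\<lambda>x. complex_of_real (deriv \<phi> x)) \<in> L2"
    using continuous_compact_support_L1_L2[OF c(2), of R] R(3) by auto
qed

text \<open>
  Integration by parts, in the form that the derivative of \<open>fker x \<xi> * \<phi> x\<close> integrates to \<open>0\<close>.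
\<close>

lemma FT_deriv_test_function:
  assumes "test_function \<phi>"
  shows "FT (\<lambda>x. complex_of_real (deriv \<phi> x)) \<xi> = \<i> * of_real \<xi> * FT (\<lambda>x. complex_of_real (\<phi> x)) \<xi>"
proof -
  note D = test_functionD(1,2)[OF assms]
  obtain R where R: "R > 0" "\<And>x. \<bar>x\<bar> > R \<Longrightarrow> \<phi> x = 0" "\<And>x. \<bar>x\<bar> > R \<Longrightarrow> deriv \<phi> x = 0"
    using test_functionD(3)[OF assms] by blast
  note L = test_function_L1_L2[OF assms]
  have \<phi>_cont: "continuous_on UNIV \<phi>"
    using D(1) by (auto intro!: continuous_at_imp_continuous_on DERIV_isCont)
  define F where "F x = fker x \<xi> * complex_of_real (\<phi> x)" for x
  define f where "f x = fker x \<xi> * complex_of_real (deriv \<phi> x)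
      - \<i> * of_real \<xi> * (fker x \<xi> * complex_of_real (\<phi> x))" for x
  have der: "(F has_vector_derivative f x) (at x)" for x
  proof -
    have k: "((\<lambda>x. fker x \<xi>) has_vector_derivative - (\<i> * of_real \<xi>) * fker x \<xi>) (at x)"
    proof -
      have "((\<lambda>z. exp (- (\<i> * (z * of_real \<xi>)))) has_field_derivative - (\<i> * of_real \<xi>) * exp (- (\<i> * (of_real x * of_real \<xi>))))
          (at (complex_of_real x))"
        by (auto intro!: derivative_eq_intros)
      from has_vector_derivative_real_field[OF this]
      show ?thesis by (simp add: fker_def)
    qed
    have p: "((\<lambda>x. complex_of_real (\<phi> x)) has_vector_derivative of_real (deriv \<phi> x)) (at x)"
      using D(1)[of x] by (intro has_vector_derivative_of_real)
        (simp add: has_real_derivative_iff_has_vector_derivative)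
    show ?thesis
      unfolding F_def f_def using has_vector_derivative_mult[OF k p] by (simp add: mult.assoc)
  qed
  have cont: "continuous_on {-(R+1)..R+1} f"
  proof -
    have "continuous_on {-(R+1)..R+1} \<phi>" "continuous_on {-(R+1)..R+1} (deriv \<phi>)"
      by (auto intro: continuous_on_subset[OF \<phi>_cont] continuous_on_subset[OF D(2)])
    then show ?thesis
      unfolding f_def by (intro continuous_intros continuous_fker)
  qed
  have "(\<integral>x. indicator {-(R+1)..R+1} x *\<^sub>R f x \<partial>lborel) = F (R+1) - F (-(R+1))"
    by (rule integral_FTC_Icc[OF _ has_vector_derivative_at_within[OF der] cont]) (use R(1) in simp)
  moreover have "indicator {-(R+1)..R+1} x *\<^sub>R f x = f x" for x
    using R(2)[of x] R(3)[of x] by (cases "\<bar>x\<bar> > R") (auto simp: f_def indicator_def abs_if split: if_splits)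
  ultimately have "(\<integral>x. f x \<partial>lborel) = 0"
    using R(2)[of "R+1"] R(2)[of "-(R+1)"] R(1) by (simp add: F_def)
  then show ?thesis
    unfolding f_def FT_def
    by (subst (asm) Bochner_Integration.integral_diff)
       (use integrable_fker_mult[OF L(1), of \<xi>] integrable_fker_mult[OF L(3), of \<xi>] in auto)
qed

section \<open>The Hardy space and the Cauchy projection\<close>

lemma Hardy_L2: "f \<in> Hardy \<Longrightarrow> f \<in> L2"
  by (simp add: Hardy_def)

lemma Hardy_iff:
  assumes "f \<in> L2"
  shows "f \<in> Hardy \<longleftrightarrow> eq_ae (\<lambda>\<xi>. indicator {0..} \<xi> * fourier f \<xi>) (fourier f)"
  using assms unfolding Hardy_def eq_ae_def
  by (auto simp: indicator_def not_le elim!: eventually_mono)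

lemma fourier_cong_L2: "f \<in> L2 \<Longrightarrow> g \<in> L2 \<Longrightarrow> eq_ae f g \<Longrightarrow> fourier f = fourier g"
  by (rule fourier_cong) (auto intro: L2_measurable)

lemma Hardy_cong: "f \<in> Hardy \<Longrightarrow> g \<in> L2 \<Longrightarrow> eq_ae f g \<Longrightarrow> g \<in> Hardy"
  using fourier_cong_L2[of f g] by (simp add: Hardy_def)

lemma Hardy_zero: "(\<lambda>x. 0) \<in> Hardy"
  using fourier_cmult[of "\<lambda>x. 0" 0] by (auto simp: Hardy_def eq_ae_def elim: eventually_mono)

lemma Hardy_add:
  assumes "f \<in> Hardy" "g \<in> Hardy"
  shows "(\<lambda>x. f x + g x) \<in> Hardy"
proof -
  have L: "f \<in> L2" "g \<in> L2" and
    0: "AE \<xi> in lborel. \<xi> < 0 \<longrightarrow> fourier f \<xi> = 0" "AE \<xi> in lborel. \<xi> < 0 \<longrightarrow> fourier g \<xi> = 0"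
    using assms by (auto simp: Hardy_def)
  have "AE \<xi> in lborel. \<xi> < 0 \<longrightarrow> fourier (\<lambda>x. f x + g x) \<xi> = 0"
    using 0 fourier_add[OF L] unfolding eq_ae_def by eventually_elim simp
  then show ?thesis using L2_add[OF L] by (simp add: Hardy_def)
qed

lemma Hardy_cmult:
  assumes "f \<in> Hardy"
  shows "(\<lambda>x. c * f x) \<in> Hardy"
proof -
  have L: "f \<in> L2" and 0: "AE \<xi> in lborel. \<xi> < 0 \<longrightarrow> fourier f \<xi> = 0"
    using assms by (auto simp: Hardy_def)
  have "AE \<xi> in lborel. \<xi> < 0 \<longrightarrow> fourier (\<lambda>x. c * f x) \<xi> = 0"
    using 0 fourier_cmult[OF L, of c] unfolding eq_ae_def by eventually_elim simp
  then show ?thesis using L2_cmult[OF L] by (simp add: Hardy_def)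
qed

lemma Hardy_diff: "f \<in> Hardy \<Longrightarrow> g \<in> Hardy \<Longrightarrow> (\<lambda>x. f x - g x) \<in> Hardy"
  using Hardy_add[OF _ Hardy_cmult[of g "-1"], of f] by simp

lemma cauchy_proj_spec:
  assumes "f \<in> L2"
  shows "cauchy_proj f \<in> L2"
    and fourier_cauchy_proj: "eq_ae (fourier (cauchy_proj f)) (\<lambda>\<xi>. indicator {0..} \<xi> * fourier f \<xi>)"
proof -
  have h: "(\<lambda>\<xi>. indicator {0..} \<xi> * fourier f \<xi>) \<in> L2"
    using assms by (intro L2_indicator_mult fourier_L2) auto
  have "\<exists>g. g \<in> L2 \<and> eq_ae (fourier g) (\<lambda>\<xi>. indicator {0..} \<xi> * fourier f \<xi>)"
    using inv_fourier_L2[OF h] fourier_inv_fourier[OF h] by blast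
  from someI_ex[OF this] show "cauchy_proj f \<in> L2"
    "eq_ae (fourier (cauchy_proj f)) (\<lambda>\<xi>. indicator {0..} \<xi> * fourier f \<xi>)"
    unfolding cauchy_proj_def by auto
qed

lemma cauchy_proj_cong: "f \<in> L2 \<Longrightarrow> g \<in> L2 \<Longrightarrow> eq_ae f g \<Longrightarrow> cauchy_proj f = cauchy_proj g"
  using fourier_cong_L2[of f g] by (simp add: cauchy_proj_def)

lemma cauchy_proj_Hardy: "f \<in> L2 \<Longrightarrow> cauchy_proj f \<in> Hardy"
  using cauchy_proj_spec[of f] unfolding Hardy_def eq_ae_def
  by (auto elim!: eventually_mono)

lemma cauchy_proj_id:
  assumes "f \<in> Hardy"
  shows "eq_ae (cauchy_proj f) f"
proof (rule fourier_inj)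
  show f: "f \<in> L2" by (rule Hardy_L2[OF assms])
  show "cauchy_proj f \<in> L2" by (rule cauchy_proj_spec[OF f])
  show "eq_ae (fourier (cauchy_proj f)) (fourier f)"
    using eq_ae_trans[OF fourier_cauchy_proj[OF f]] assms Hardy_iff[OF f] by blast
qed

lemma cauchy_proj_add:
  assumes "f \<in> L2" "g \<in> L2"
  shows "eq_ae (cauchy_proj (\<lambda>x. f x + g x)) (\<lambda>x. cauchy_proj f x + cauchy_proj g x)"
proof (rule fourier_inj)
  note C = cauchy_proj_spec(1)[OF assms(1)] cauchy_proj_spec(1)[OF assms(2)]
  show "eq_ae (fourier (cauchy_proj (\<lambda>x. f x + g x))) (fourier (\<lambda>x. cauchy_proj f x + cauchy_proj g x))"
    using fourier_cauchy_proj[OF L2_add[OF assms]] fourier_add[OF assms] fourier_add[OF C]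
      fourier_cauchy_proj[OF assms(1)] fourier_cauchy_proj[OF assms(2)]
    unfolding eq_ae_def by eventually_elim (simp add: distrib_left)
qed (intro L2_add cauchy_proj_spec assms)+

lemma cauchy_proj_cmult:
  assumes "f \<in> L2"
  shows "eq_ae (cauchy_proj (\<lambda>x. c * f x)) (\<lambda>x. c * cauchy_proj f x)"
proof (rule fourier_inj)
  show "eq_ae (fourier (cauchy_proj (\<lambda>x. c * f x))) (fourier (\<lambda>x. c * cauchy_proj f x))"
    using fourier_cauchy_proj[OF L2_cmult[OF assms, of c]] fourier_cmult[OF assms, of c]
      fourier_cmult[OF cauchy_proj_spec(1)[OF assms], of c] fourier_cauchy_proj[OF assms]
    unfolding eq_ae_def by eventually_elim simp
qed (intro L2_cmult cauchy_proj_spec assms)+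

lemma cauchy_proj_diff:
  assumes "f \<in> L2" "g \<in> L2"
  shows "eq_ae (cauchy_proj (\<lambda>x. f x - g x)) (\<lambda>x. cauchy_proj f x - cauchy_proj g x)"
  using cauchy_proj_add[OF assms(1) L2_cmult[OF assms(2), of "-1"]] cauchy_proj_cmult[OF assms(2), of "-1"]
  unfolding eq_ae_def by (simp, eventually_elim) simp

lemma l2_norm_cauchy_proj_le:
  assumes "f \<in> L2"
  shows "l2_norm (cauchy_proj f) \<le> l2_norm f"
proof -
  note C = cauchy_proj_spec[OF assms]
  have "l2_norm (fourier (cauchy_proj f)) \<le> l2_norm (fourier f)"
  proof (rule l2_norm_mono)
    show "AE \<xi> in lborel. cmod (fourier (cauchy_proj f) \<xi>) \<le> cmod (fourier f \<xi>)"
      using C(2) unfolding eq_ae_def by eventually_elim (simp add: indicator_def)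
  qed (use C assms in \<open>auto intro: L2_measurable\<close>)
  then show ?thesis by (simp add: l2_norm_fourier C assms)
qed

lemma cauchy_proj_symmetric:
  assumes f: "f \<in> L2" and g: "g \<in> L2"
  shows "l2_inner (cauchy_proj f) g = l2_inner f (cauchy_proj g)"
proof -
  note Cf = cauchy_proj_spec[OF f] and Cg = cauchy_proj_spec[OF g]
  have "l2_inner (fourier (cauchy_proj f)) (fourier g) = l2_inner (fourier f) (fourier (cauchy_proj g))"
    unfolding l2_inner_def
  proof (rule integral_cong_AE)
    show "AE \<xi> in lborel. fourier (cauchy_proj f) \<xi> * cnj (fourier g \<xi>)
        = fourier f \<xi> * cnj (fourier (cauchy_proj g) \<xi>)"
      using Cf(2) Cg(2) unfolding eq_ae_def by eventually_elim (simp add: indicator_def)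
  qed (use L2_integrable_inner[OF fourier_L2[OF Cf(1)] fourier_L2[OF g]]
      L2_integrable_inner[OF fourier_L2[OF f] fourier_L2[OF Cg(1)]] in auto)
  then show ?thesis
    by (simp add: fourier_parseval Cf Cg f g)
qed

lemma Linf_mult_L2:
  assumes "u \<in> Linf" "f \<in> L2"
  shows "(\<lambda>x. complex_of_real (u x) * f x) \<in> L2"
proof -
  from assms(1) obtain C where "u \<in> borel_measurable borel" "AE x in lborel. norm (u x) \<le> C"
    by (auto simp: Linf_def)
  then show ?thesis
    by (intro L2_bounded_mult[OF assms(2), where C=C]) auto
qed

context
  fixes u :: "real \<Rightarrow> real"
  assumes u: "u \<in> Linf"
begin

lemma cauchy_mult_L2: "f \<in> L2 \<Longrightarrow> cauchy_mult u f \<in> L2"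
  and cauchy_mult_Hardy: "f \<in> L2 \<Longrightarrow> cauchy_mult u f \<in> Hardy"
  unfolding cauchy_mult_def by (intro cauchy_proj_spec cauchy_proj_Hardy Linf_mult_L2 u; simp)+

text \<open>
  On the Hardy space the inner projection acts as the identity, and any representative of \<open>f\<close> may
  be inserted. This is used with the continuous representative.
\<close>

lemma cauchy_mult_eq:
  assumes "f \<in> Hardy" "g \<in> L2" "eq_ae f g"
  shows "cauchy_mult u f = cauchy_proj (\<lambda>x. complex_of_real (u x) * g x)"
  unfolding cauchy_mult_def
proof (rule cauchy_proj_cong)
  show "(\<lambda>x. complex_of_real (u x) * cauchy_proj f x) \<in> L2"
    by (intro Linf_mult_L2 u cauchy_proj_spec Hardy_L2 assms)
  show "(\<lambda>x. complex_of_real (u x) * g x) \<in> L2"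
    by (intro Linf_mult_L2 u assms)
  show "eq_ae (\<lambda>x. complex_of_real (u x) * cauchy_proj f x) (\<lambda>x. complex_of_real (u x) * g x)"
    using eq_ae_trans[OF cauchy_proj_id[OF assms(1)] assms(3)]
    unfolding eq_ae_def by eventually_elim simp
qed

lemma cauchy_mult_Hardy_eq:
  "f \<in> Hardy \<Longrightarrow> cauchy_mult u f = cauchy_proj (\<lambda>x. complex_of_real (u x) * f x)"
  by (rule cauchy_mult_eq) (auto intro: Hardy_L2)

lemma cauchy_mult_symmetric:
  assumes f: "f \<in> Hardy" and g: "g \<in> Hardy"
  shows "l2_inner (cauchy_mult u f) g = l2_inner f (cauchy_mult u g)"
proof -
  have L: "f \<in> L2" "g \<in> L2" using f g by (auto intro: Hardy_L2)
  note uL = Linf_mult_L2[OF u L(1)] Linf_mult_L2[OF u L(2)]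
  have "l2_inner (cauchy_mult u f) g = l2_inner (\<lambda>x. complex_of_real (u x) * f x) g"
    unfolding cauchy_mult_Hardy_eq[OF f] cauchy_proj_symmetric[OF uL(1) L(2)]
    by (intro l2_inner_cong_AE uL L cauchy_proj_spec cauchy_proj_id g eq_ae_refl)
  also have "\<dots> = l2_inner f (\<lambda>x. complex_of_real (u x) * g x)"
    by (simp add: l2_inner_def mult_ac)
  also have "\<dots> = l2_inner f (cauchy_mult u g)"
    unfolding cauchy_mult_Hardy_eq[OF g] cauchy_proj_symmetric[OF L(1) uL(2), symmetric]
    by (intro l2_inner_cong_AE uL L cauchy_proj_spec eq_ae_sym[OF cauchy_proj_id[OF f]] eq_ae_refl)
  finally show ?thesis .
qed

lemma linear_operator_cauchy_mult: "linear_operator_in Hardy Hardy (cauchy_mult u)"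
  unfolding linear_operator_in_def
proof (intro conjI ballI allI impI)
  fix f g assume f: "f \<in> Hardy" and g: "g \<in> Hardy"
  note uL = Linf_mult_L2[OF u Hardy_L2[OF f]] Linf_mult_L2[OF u Hardy_L2[OF g]]
  show "eq_ae (cauchy_mult u (\<lambda>x. f x + g x)) (\<lambda>x. cauchy_mult u f x + cauchy_mult u g x)"
    unfolding cauchy_mult_Hardy_eq[OF f] cauchy_mult_Hardy_eq[OF g] cauchy_mult_Hardy_eq[OF Hardy_add[OF f g]]
    using cauchy_proj_add[OF uL] by (simp add: distrib_left)
next
  fix c f assume f: "f \<in> Hardy"
  show "eq_ae (cauchy_mult u (\<lambda>x. c * f x)) (\<lambda>x. c * cauchy_mult u f x)"
    unfolding cauchy_mult_Hardy_eq[OF f] cauchy_mult_Hardy_eq[OF Hardy_cmult[OF f]]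
    using cauchy_proj_cmult[OF Linf_mult_L2[OF u Hardy_L2[OF f]], of c] by (simp add: mult.left_commute)
next
  fix f g assume f: "f \<in> Hardy" and g: "g \<in> L2" and eq: "eq_ae f g"
  show "eq_ae (cauchy_mult u f) (cauchy_mult u g)"
    using cauchy_mult_eq[OF f g eq] cauchy_mult_Hardy_eq[OF Hardy_cong[OF f g eq]] by simp
qed (auto intro: Hardy_add Hardy_cmult Hardy_zero Hardy_cong cauchy_mult_Hardy Hardy_L2)

end

section \<open>Weak derivatives on the Fourier side\<close>

lemma FT_translate: "FT (\<lambda>x. f (x - d)) \<xi> = fker d \<xi> * FT f \<xi>"
proof -
  have "FT (\<lambda>x. f (x - d)) \<xi> = \<bar>1\<bar> *\<^sub>R (LINT x|lborel. fker (d + 1 * x) \<xi> * f (d + 1 * x - d))"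
    unfolding FT_def by (rule lborel_integral_real_affine) simp
  also have "\<dots> = (LINT x|lborel. fker d \<xi> * (fker x \<xi> * f x))"
    by (simp add: fker_commute[of _ \<xi>] fker_add[symmetric] mult.assoc)
  finally show ?thesis by (simp add: FT_def)
qed

lemma pairing_fourier:
  assumes f: "f \<in> L2" and h: "integrable lborel h" "h \<in> L2"
  shows "2 * pi * (LINT x|lborel. f x * cnj (h x)) = (LINT \<xi>|lborel. fourier f \<xi> * cnj (FT h \<xi>))"
proof -
  have "l2_inner (fourier f) (FT h) = l2_inner (fourier f) (fourier h)"
    by (intro l2_inner_cong_AE fourier_L2 f h FT_plancherel eq_ae_refl eq_ae_sym[OF fourier_eq_FT])
  then show ?thesis
    by (simp add: fourier_parseval f h) (simp add: l2_inner_def)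
qed

text \<open>
  By Parseval's identity and integration by parts for \<open>\<phi>\<close>, the identity that defines the weak
  derivative says that \<open>F g - \<i> \<xi> F f\<close> is orthogonal to the transform of \<open>\<phi>\<close>.
\<close>

lemma weak_deriv_identity_iff:
  assumes f: "f \<in> L2" and g: "g \<in> L2" and \<phi>: "test_function \<phi>"
  defines "\<Phi> \<equiv> \<lambda>x. complex_of_real (\<phi> x)"
  shows "integrable lborel (\<lambda>\<xi>. (fourier g \<xi> - \<i> * of_real \<xi> * fourier f \<xi>) * cnj (FT \<Phi> \<xi>))"
    and "(LINT x|lborel. f x * of_real (deriv \<phi> x)) = - (LINT x|lborel. g x * of_real (\<phi> x)) \<longleftrightarrow>
      (LINT \<xi>|lborel. (fourier g \<xi> - \<i> * of_real \<xi> * fourier f \<xi>) * cnj (FT \<Phi> \<xi>)) = 0"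
proof -
  note L = test_function_L1_L2[OF \<phi>]
  define \<Psi> where "\<Psi> x = complex_of_real (deriv \<phi> x)" for x
  have F\<Psi>: "FT \<Psi> \<xi> = \<i> * of_real \<xi> * FT \<Phi> \<xi>" for \<xi>
    unfolding \<Psi>_def \<Phi>_def by (rule FT_deriv_test_function[OF \<phi>])
  have \<Phi>: "integrable lborel \<Phi>" "\<Phi> \<in> L2" and \<Psi>: "integrable lborel \<Psi>" "\<Psi> \<in> L2"
    using L by (auto simp: \<Phi>_def \<Psi>_def[abs_def])
  have split: "(fourier g \<xi> - \<i> * of_real \<xi> * fourier f \<xi>) * cnj (FT \<Phi> \<xi>)
      = fourier f \<xi> * cnj (FT \<Psi> \<xi>) + fourier g \<xi> * cnj (FT \<Phi> \<xi>)" for \<xi>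
    unfolding F\<Psi> by (simp add: algebra_simps)
  have int: "integrable lborel (\<lambda>\<xi>. fourier f \<xi> * cnj (FT \<Psi> \<xi>))"
    "integrable lborel (\<lambda>\<xi>. fourier g \<xi> * cnj (FT \<Phi> \<xi>))"
    by (intro L2_integrable_inner fourier_L2 f g FT_plancherel \<Phi> \<Psi>)+
  then show "integrable lborel (\<lambda>\<xi>. (fourier g \<xi> - \<i> * of_real \<xi> * fourier f \<xi>) * cnj (FT \<Phi> \<xi>))"
    unfolding split by (rule Bochner_Integration.integrable_add)
  have "(LINT \<xi>|lborel. (fourier g \<xi> - \<i> * of_real \<xi> * fourier f \<xi>) * cnj (FT \<Phi> \<xi>))
      = 2 * pi * (LINT x|lborel. f x * cnj (\<Psi> x)) + 2 * pi * (LINT x|lborel. g x * cnj (\<Phi> x))"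
    unfolding split Bochner_Integration.integral_add[OF int]
    using pairing_fourier[OF f \<Psi>] pairing_fourier[OF g \<Phi>] by simp
  also have "\<dots> = 2 * pi * ((LINT x|lborel. f x * of_real (deriv \<phi> x)) + (LINT x|lborel. g x * of_real (\<phi> x)))"
    by (simp add: \<Phi>_def \<Psi>_def distrib_left)
  finally show "(LINT x|lborel. f x * of_real (deriv \<phi> x)) = - (LINT x|lborel. g x * of_real (\<phi> x)) \<longleftrightarrow>
      (LINT \<xi>|lborel. (fourier g \<xi> - \<i> * of_real \<xi> * fourier f \<xi>) * cnj (FT \<Phi> \<xi>)) = 0"
    by (simp add: eq_neg_iff_add_eq_0)
qed

lemma flat_integral_pos: "(LINT x|lborel. flat 1 0 x) > 0"
proof -
  have int: "integrable lborel (flat 1 0)"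
    using test_function_L1_L2(1)[OF test_function_flat[of 1 1 0 0]]
    by (simp add: complex_of_real_integrable_eq)
  have nn: "flat 1 0 x \<ge> 0" for x by (simp add: flat_def)
  have "(LINT x|lborel. flat 1 0 x) \<noteq> 0"
  proof
    assume "(LINT x|lborel. flat 1 0 x) = 0"
    then have "AE x in lborel. flat 1 0 x = 0"
      using integral_nonneg_eq_0_iff_AE[OF int] nn by simp
    then have "AE x in lborel. x \<notin> {-1<..<1::real}"
      by eventually_elim (auto simp: flat_def abs_less_iff)
    then have "emeasure lborel {-1<..<1::real} = 0"
      by (subst (asm) AE_iff_measurable[of "{-1<..<1::real}"]) auto
    then show False by simp
  qed
  moreover have "(LINT x|lborel. flat 1 0 x) \<ge> 0"
    using nn by simp
  ultimately show ?thesis by linarith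
qed

text \<open>
  Dilating the bump function by \<open>1 / n\<close> stretches its transform by \<open>n\<close>, and the value at
  \<open>0\<close> is the positive integral of the bump, so that no frequency is annihilated by all of them.
\<close>

lemma FT_flat_dilated_nonzero:
  "\<exists>n. FT (\<lambda>x. complex_of_real (flat 1 0 (real (Suc n) * x))) \<xi> \<noteq> 0"
proof (rule ccontr)
  assume "\<not> ?thesis"
  then have zero: "FT (\<lambda>x. complex_of_real (flat 1 0 (real (Suc n) * x))) \<xi> = 0" for n by blast
  have int: "integrable lborel (\<lambda>x. complex_of_real (flat 1 0 x))"
    using test_function_L1_L2(1)[OF test_function_flat[of 1 1 0 0]] by simp
  have scaled: "(LINT t|lborel. fker (t * inverse (real (Suc n))) \<xi> * complex_of_real (flat 1 0 t)) = 0" for n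
  proof -
    define c where "c = inverse (real (Suc n))"
    have c: "c > 0" "real (Suc n) * c = 1" by (simp_all add: c_def)
    have eq: "real (Suc n) * (0 + c * t) = t" for t
      using c(2) by (metis add_0 mult.assoc mult_1)
    have "0 = \<bar>c\<bar> *\<^sub>R (LINT t|lborel. fker (0 + c * t) \<xi> * complex_of_real (flat 1 0 (real (Suc n) * (0 + c * t))))"
      unfolding zero[of n, symmetric] FT_def by (rule lborel_integral_real_affine) (use c in simp)
    then have "(LINT t|lborel. fker (0 + c * t) \<xi> * complex_of_real (flat 1 0 t)) = 0"
      unfolding eq using c by simp
    then show ?thesis
      unfolding c_def by (simp only: add_0_left mult.commute)
  qed
  have "(\<lambda>n. LINT t|lborel. fker (t * inverse (real (Suc n))) \<xi> * complex_of_real (flat 1 0 t))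
      \<longlonglongrightarrow> (LINT t|lborel. complex_of_real (flat 1 0 t))"
  proof (rule integral_dominated_convergence[where w="\<lambda>t. norm (complex_of_real (flat 1 0 t))"])
    have [measurable]: "(\<lambda>x. complex_of_real (flat 1 0 x)) \<in> borel_measurable borel"
      using int by (auto dest: borel_measurable_integrable)
    show "(\<lambda>x. complex_of_real (flat 1 0 x)) \<in> borel_measurable lborel"
      "\<And>n. (\<lambda>t. fker (t * inverse (real (Suc n))) \<xi> * complex_of_real (flat 1 0 t)) \<in> borel_measurable lborel"
      by measurable
    show "integrable lborel (\<lambda>t. norm (complex_of_real (flat 1 0 t)))"
      using int by (rule integrable_norm)
    show "AE t in lborel. (\<lambda>n. fker (t * inverse (real (Suc n))) \<xi> * complex_of_real (flat 1 0 t))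
        \<longlonglongrightarrow> complex_of_real (flat 1 0 t)"
    proof (rule AE_I2)
      fix t
      have "(\<lambda>n. t * inverse (real (Suc n))) \<longlonglongrightarrow> t * 0"
        by (rule tendsto_mult[OF tendsto_const LIMSEQ_inverse_real_of_nat])
      then have "(\<lambda>n. fker (t * inverse (real (Suc n))) \<xi>) \<longlonglongrightarrow> fker 0 \<xi>"
        using continuous_on_tendsto_compose[OF continuous_fker[of UNIV \<xi>]] by simp
      from tendsto_mult_right[OF this, of "complex_of_real (flat 1 0 t)"]
      show "(\<lambda>n. fker (t * inverse (real (Suc n))) \<xi> * complex_of_real (flat 1 0 t))
        \<longlonglongrightarrow> complex_of_real (flat 1 0 t)"
        by (simp add: fker_commute[of 0])
    qed
  qed (simp add: norm_mult)
  then have "(LINT t|lborel. complex_of_real (flat 1 0 t)) = 0"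
    unfolding scaled using LIMSEQ_unique tendsto_const by blast
  then show False
    using flat_integral_pos by simp
qed

text \<open>
  The function \<open>W(\<xi>) = F g(\<xi>) - \<i> \<xi> F f(\<xi>)\<close> vanishes: testing with all translates of one test
  function \<open>\<phi>\<close> says that the Fourier integral of \<open>W * cnj (FT \<phi>)\<close> is zero, and that product is in
  \<open>L\<^sup>1 \<inter> L\<^sup>2\<close>, so it vanishes almost everywhere; dilations of \<open>\<phi>\<close> then reach every frequency.
\<close>

lemma fourier_has_weak_deriv:
  assumes f: "f \<in> L2" and g: "g \<in> L2" and fg: "has_weak_deriv f g"
  shows "eq_ae (fourier g) (\<lambda>\<xi>. \<i> * of_real \<xi> * fourier f \<xi>)"
proof -
  define W where "W \<xi> = fourier g \<xi> - \<i> * of_real \<xi> * fourier f \<xi>" for \<xi>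
  have [measurable]: "fourier f \<in> borel_measurable borel" "fourier g \<in> borel_measurable borel"
    using f g by (auto intro!: L2_measurable fourier_L2)
  have AE0: "AE \<xi> in lborel. W \<xi> * cnj (FT (\<lambda>x. complex_of_real (flat 1 0 (real (Suc n) * x))) \<xi>) = 0" for n
  proof -
    define \<phi> where "\<phi> d x = flat 1 0 (real (Suc n) * (x - d))" for d x
    have \<phi>: "test_function (\<phi> d)" for d
      unfolding \<phi>_def by (rule test_function_flat) simp
    define K where "K \<xi> = W \<xi> * cnj (FT (\<lambda>x. complex_of_real (\<phi> 0 x)) \<xi>)" for \<xi>
    note L = test_function_L1_L2[OF \<phi>[of 0]]
    have K_int: "integrable lborel K"
      using weak_deriv_identity_iff(1)[OF f g \<phi>[of 0]] unfolding K_def W_def .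
    have K_L2: "K \<in> L2"
    proof -
      have K_eq: "K \<xi> = cnj (FT (\<lambda>x. complex_of_real (\<phi> 0 x)) \<xi>) * fourier g \<xi>
          + cnj (FT (\<lambda>x. complex_of_real (deriv (\<phi> 0) x)) \<xi>) * fourier f \<xi>" for \<xi>
        unfolding FT_deriv_test_function[OF \<phi>] by (simp add: K_def W_def algebra_simps)
      have [measurable]: "(\<lambda>x. complex_of_real (\<phi> 0 x)) \<in> borel_measurable borel"
        "(\<lambda>x. complex_of_real (deriv (\<phi> 0) x)) \<in> borel_measurable borel"
        using L by (auto intro: L2_measurable)
      have prod: "(\<lambda>\<xi>. cnj (FT h \<xi>) * k \<xi>) \<in> L2" if "h \<in> borel_measurable borel" "k \<in> L2" for h k
        by (rule L2_bounded_mult[OF that(2)]) (use that(1) norm_FT_le[of h] in auto)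
      then show ?thesis
        unfolding K_eq[abs_def]
        by (intro L2_add prod fourier_L2 f g L2_measurable[OF L(2)] L2_measurable[OF L(4)])
    qed
    have "FT K y = 0" for y
    proof -
      have "(LINT \<xi>|lborel. W \<xi> * cnj (FT (\<lambda>x. complex_of_real (\<phi> (- y) x)) \<xi>)) = 0"
        using weak_deriv_identity_iff(2)[OF f g \<phi>[of "- y"]] fg \<phi>[of "- y"]
        unfolding has_weak_deriv_def W_def by blast
      moreover have "FT (\<lambda>x. complex_of_real (\<phi> (- y) x)) \<xi> = fker (- y) \<xi> * FT (\<lambda>x. complex_of_real (\<phi> 0 x)) \<xi>" for \<xi>
        using FT_translate[of "\<lambda>x. complex_of_real (\<phi> 0 x)" "- y" \<xi>] by (simp add: \<phi>_def)
      ultimately have "(LINT \<xi>|lborel. fker \<xi> y * K \<xi>) = 0"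
        by (simp add: K_def fker_commute[of "- y"] cnj_fker mult_ac)
      then show ?thesis by (simp add: FT_def)
    qed
    then have "l2_norm (FT K) = 0" by (simp add: l2_norm_def)
    then have "l2_norm K = 0" by (simp add: FT_plancherel(2)[OF K_int K_L2])
    then show ?thesis
      by (simp add: l2_norm_eq_0_iff K_L2) (simp add: K_def \<phi>_def)
  qed
  have "AE \<xi> in lborel. \<forall>n. W \<xi> * cnj (FT (\<lambda>x. complex_of_real (flat 1 0 (real (Suc n) * x))) \<xi>) = 0"
    unfolding AE_all_countable by (intro allI AE0)
  then show ?thesis
    unfolding eq_ae_def
  proof eventually_elim
    case (elim \<xi>)
    obtain n where "FT (\<lambda>x. complex_of_real (flat 1 0 (real (Suc n) * x))) \<xi> \<noteq> 0"
      using FT_flat_dilated_nonzero by blast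
    with elim have "W \<xi> = 0"
      by (metis complex_cnj_zero_iff mult_eq_0_iff)
    then show ?case by (simp add: W_def)
  qed
qed

lemma has_weak_deriv_fourier:
  assumes f: "f \<in> L2" and g: "g \<in> L2" and eq: "eq_ae (fourier g) (\<lambda>\<xi>. \<i> * of_real \<xi> * fourier f \<xi>)"
  shows "has_weak_deriv f g"
  unfolding has_weak_deriv_def
proof (intro allI impI)
  fix \<phi> assume \<phi>: "test_function \<phi>"
  have "(LINT \<xi>|lborel. (fourier g \<xi> - \<i> * of_real \<xi> * fourier f \<xi>) * cnj (FT (\<lambda>x. complex_of_real (\<phi> x)) \<xi>)) = 0"
    by (rule integral_eq_zero_AE) (use eq in \<open>auto simp: eq_ae_def elim!: eventually_mono\<close>)
  then show "(LINT x|lborel. f x * of_real (deriv \<phi> x)) = - (LINT x|lborel. g x * of_real (\<phi> x))"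
    using weak_deriv_identity_iff(2)[OF f g \<phi>] by blast
qed

text \<open>
  If multiplication by \<open>\<xi>\<close> keeps \<open>F f\<close> square-integrable, the inverse transform of \<open>\<i> \<xi> F f\<close> is
  a weak derivative; conversely a weak derivative has this transform.
\<close>

lemma Sobolev1_iff:
  assumes f: "f \<in> L2"
  shows "f \<in> Sobolev1 \<longleftrightarrow> (\<lambda>\<xi>. complex_of_real \<xi> * fourier f \<xi>) \<in> L2"
proof
  have m: "fourier f \<in> borel_measurable borel" using f by (auto intro!: L2_measurable fourier_L2)
  assume "f \<in> Sobolev1"
  then obtain g where g: "g \<in> L2" "has_weak_deriv f g" by (auto simp: Sobolev1_def)
  have le: "AE \<xi> in lborel. norm (complex_of_real \<xi> * fourier f \<xi>) \<le> norm (fourier g \<xi>)"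
    using fourier_has_weak_deriv[OF f g] unfolding eq_ae_def
    by eventually_elim (simp add: norm_mult)
  show "(\<lambda>\<xi>. complex_of_real \<xi> * fourier f \<xi>) \<in> L2"
    by (rule L2_dominated[OF _ fourier_L2[OF g(1)] le]) (use m in measurable)
next
  assume "(\<lambda>\<xi>. complex_of_real \<xi> * fourier f \<xi>) \<in> L2"
  then have h: "(\<lambda>\<xi>. \<i> * (complex_of_real \<xi> * fourier f \<xi>)) \<in> L2" by (rule L2_cmult)
  have "has_weak_deriv f (inv_fourier (\<lambda>\<xi>. \<i> * (complex_of_real \<xi> * fourier f \<xi>)))"
    by (rule has_weak_deriv_fourier[OF f inv_fourier_L2[OF h]])
       (use fourier_inv_fourier[OF h] in \<open>simp add: mult.assoc\<close>)
  then show "f \<in> Sobolev1"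
    using f inv_fourier_L2[OF h] by (auto simp: Sobolev1_def)
qed

lemma fourier_momentum:
  assumes "f \<in> Sobolev1"
  shows "momentum f \<in> L2" "eq_ae (fourier (momentum f)) (\<lambda>\<xi>. complex_of_real \<xi> * fourier f \<xi>)"
proof -
  have f: "f \<in> L2" and ex: "\<exists>g. g \<in> L2 \<and> has_weak_deriv f g"
    using assms by (auto simp: Sobolev1_def)
  from someI_ex[OF ex] have w: "weak_deriv f \<in> L2" "has_weak_deriv f (weak_deriv f)"
    unfolding weak_deriv_def by auto
  show "momentum f \<in> L2"
    unfolding momentum_def by (rule L2_cmult[OF w(1)])
  show "eq_ae (fourier (momentum f)) (\<lambda>\<xi>. complex_of_real \<xi> * fourier f \<xi>)"
    using fourier_cmult[OF w(1), of "1 / \<i>"] fourier_has_weak_deriv[OF f w]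
    unfolding eq_ae_def momentum_def by eventually_elim (simp flip: mult.assoc)
qed

section \<open>The momentum operator on the Hardy space\<close>

lemma Sobolev1_L2: "f \<in> Sobolev1 \<Longrightarrow> f \<in> L2"
  by (simp add: Sobolev1_def)

lemma eq_ae_by_fourier:
  assumes "f \<in> L2" "g \<in> L2" "eq_ae (fourier f) h" "eq_ae (fourier g) h"
  shows "eq_ae f g"
  by (rule fourier_inj[OF assms(1,2) eq_ae_trans[OF assms(3) eq_ae_sym[OF assms(4)]]])

lemma Sobolev1_cong: "f \<in> Sobolev1 \<Longrightarrow> g \<in> L2 \<Longrightarrow> eq_ae f g \<Longrightarrow> g \<in> Sobolev1"
  using fourier_cong_L2[of f g] Sobolev1_iff[of f] Sobolev1_iff[of g] Sobolev1_L2[of f] by simp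

lemma measurable_mult_fourier:
  assumes "f \<in> L2"
  shows "(\<lambda>\<xi>. complex_of_real \<xi> * fourier f \<xi>) \<in> borel_measurable borel"
proof -
  have [measurable]: "fourier f \<in> borel_measurable borel"
    by (rule L2_measurable[OF fourier_L2[OF assms]])
  show ?thesis by measurable
qed

lemma Sobolev1_add:
  assumes f: "f \<in> Sobolev1" and g: "g \<in> Sobolev1"
  shows "(\<lambda>x. f x + g x) \<in> Sobolev1"
proof -
  note L = Sobolev1_L2[OF f] Sobolev1_L2[OF g]
  have "(\<lambda>\<xi>. complex_of_real \<xi> * fourier f \<xi> + complex_of_real \<xi> * fourier g \<xi>) \<in> L2"
    using f g L by (intro L2_add) (simp_all add: Sobolev1_iff)
  moreover have "AE \<xi> in lborel. complex_of_real \<xi> * fourier f \<xi> + complex_of_real \<xi> * fourier g \<xi>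
      = complex_of_real \<xi> * fourier (\<lambda>x. f x + g x) \<xi>"
    using fourier_add[OF L] unfolding eq_ae_def by eventually_elim (simp add: distrib_left)
  ultimately have "(\<lambda>\<xi>. complex_of_real \<xi> * fourier (\<lambda>x. f x + g x) \<xi>) \<in> L2"
    using L2_cong_AE[OF _ measurable_mult_fourier[OF L2_add[OF L]]] by blast
  then show ?thesis by (simp add: Sobolev1_iff L2_add L)
qed

lemma Sobolev1_cmult:
  assumes f: "f \<in> Sobolev1"
  shows "(\<lambda>x. c * f x) \<in> Sobolev1"
proof -
  note L = Sobolev1_L2[OF f]
  have "(\<lambda>\<xi>. c * (complex_of_real \<xi> * fourier f \<xi>)) \<in> L2"
    using f L by (intro L2_cmult) (simp add: Sobolev1_iff)
  moreover have "AE \<xi> in lborel. c * (complex_of_real \<xi> * fourier f \<xi>)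
      = complex_of_real \<xi> * fourier (\<lambda>x. c * f x) \<xi>"
    using fourier_cmult[OF L, of c] unfolding eq_ae_def by eventually_elim simp
  ultimately have "(\<lambda>\<xi>. complex_of_real \<xi> * fourier (\<lambda>x. c * f x) \<xi>) \<in> L2"
    using L2_cong_AE[OF _ measurable_mult_fourier[OF L2_cmult[OF L]]] by blast
  then show ?thesis by (simp add: Sobolev1_iff L2_cmult L)
qed

lemma momentum_Hardy:
  assumes "f \<in> Hardy" "f \<in> Sobolev1"
  shows "momentum f \<in> Hardy"
proof -
  have "AE \<xi> in lborel. \<xi> < 0 \<longrightarrow> fourier f \<xi> = 0"
    using assms(1) by (simp add: Hardy_def)
  then have "AE \<xi> in lborel. \<xi> < 0 \<longrightarrow> fourier (momentum f) \<xi> = 0"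
    using fourier_momentum(2)[OF assms(2)] unfolding eq_ae_def by eventually_elim simp
  then show ?thesis
    using fourier_momentum(1)[OF assms(2)] by (simp add: Hardy_def)
qed

lemma linear_operator_momentum: "linear_operator_in Hardy (Hardy \<inter> Sobolev1) momentum"
  unfolding linear_operator_in_def
proof (intro conjI ballI allI impI)
  have "has_weak_deriv (\<lambda>x. 0) (\<lambda>x. 0)" by (simp add: has_weak_deriv_def)
  then have "(\<lambda>x. 0) \<in> Sobolev1" using L2_zero unfolding Sobolev1_def by blast
  with Hardy_zero show "(\<lambda>x. 0) \<in> Hardy \<inter> Sobolev1" by blast
next
  fix f g assume "f \<in> Hardy \<inter> Sobolev1" "g \<in> Hardy \<inter> Sobolev1"
  then have f: "f \<in> Sobolev1" and g: "g \<in> Sobolev1" by auto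
  note L = Sobolev1_L2[OF f] Sobolev1_L2[OF g] and pf = fourier_momentum[OF f]
    and pg = fourier_momentum[OF g] and pfg = fourier_momentum[OF Sobolev1_add[OF f g]]
  show "eq_ae (momentum (\<lambda>x. f x + g x)) (\<lambda>x. momentum f x + momentum g x)"
  proof (rule fourier_inj[OF pfg(1) L2_add[OF pf(1) pg(1)]])
    show "eq_ae (fourier (momentum (\<lambda>x. f x + g x))) (fourier (\<lambda>x. momentum f x + momentum g x))"
      using pfg(2) pf(2) pg(2) fourier_add[OF L] fourier_add[OF pf(1) pg(1)]
      unfolding eq_ae_def by eventually_elim (simp add: distrib_left)
  qed
next
  fix c f assume "f \<in> Hardy \<inter> Sobolev1"
  then have f: "f \<in> Sobolev1" by auto
  note L = Sobolev1_L2[OF f] and pf = fourier_momentum[OF f]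
    and pcf = fourier_momentum[OF Sobolev1_cmult[OF f, of c]]
  show "eq_ae (momentum (\<lambda>x. c * f x)) (\<lambda>x. c * momentum f x)"
  proof (rule fourier_inj[OF pcf(1) L2_cmult[OF pf(1)]])
    show "eq_ae (fourier (momentum (\<lambda>x. c * f x))) (fourier (\<lambda>x. c * momentum f x))"
      using pcf(2) pf(2) fourier_cmult[OF L, of c] fourier_cmult[OF pf(1), of c]
      unfolding eq_ae_def by eventually_elim simp
  qed
next
  fix f g assume "f \<in> Hardy \<inter> Sobolev1" and g: "g \<in> L2" and eq: "eq_ae f g"
  then have f: "f \<in> Sobolev1" by auto
  have g': "g \<in> Sobolev1" by (rule Sobolev1_cong[OF f g eq])
  show "eq_ae (momentum f) (momentum g)"
    using fourier_momentum(2)[OF g'] fourier_cong_L2[OF Sobolev1_L2[OF f] g eq]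
    by (intro eq_ae_by_fourier[OF fourier_momentum(1)[OF f] fourier_momentum(1)[OF g']
          fourier_momentum(2)[OF f]]) simp
qed (auto intro: Hardy_add Hardy_cmult Hardy_cong momentum_Hardy Sobolev1_add Sobolev1_cmult Sobolev1_cong)

lemma momentum_symmetric:
  assumes f: "f \<in> Sobolev1" and g: "g \<in> Sobolev1"
  shows "l2_inner (momentum f) g = l2_inner f (momentum g)"
proof -
  note L = Sobolev1_L2[OF f] Sobolev1_L2[OF g] and pf = fourier_momentum[OF f] and pg = fourier_momentum[OF g]
  have "l2_inner (fourier (momentum f)) (fourier g) = l2_inner (fourier f) (fourier (momentum g))"
    unfolding l2_inner_def
  proof (rule integral_cong_AE)
    show "AE \<xi> in lborel. fourier (momentum f) \<xi> * cnj (fourier g \<xi>)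
        = fourier f \<xi> * cnj (fourier (momentum g) \<xi>)"
      using pf(2) pg(2) unfolding eq_ae_def by eventually_elim simp
  qed (use L2_integrable_inner[OF fourier_L2[OF pf(1)] fourier_L2[OF L(2)]]
      L2_integrable_inner[OF fourier_L2[OF L(1)] fourier_L2[OF pg(1)]] in auto)
  then show ?thesis
    by (simp add: fourier_parseval pf pg L)
qed

text \<open>
  Functions with transform in a bounded interval \<open>[0, n]\<close> lie in the domain. They provide both
  its density and enough test elements to identify the adjoint.
\<close>

lemma inv_fourier_band_limited:
  fixes h :: "real \<Rightarrow> complex" and n :: nat
  assumes h: "(\<lambda>\<xi>. indicator {0..real n} \<xi> * h \<xi>) \<in> L2"
  defines "k \<equiv> inv_fourier (\<lambda>\<xi>. indicator {0..real n} \<xi> * h \<xi>)"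
  shows "k \<in> Hardy \<inter> Sobolev1" "eq_ae (fourier k) (\<lambda>\<xi>. indicator {0..real n} \<xi> * h \<xi>)"
proof -
  have k: "k \<in> L2" unfolding k_def by (rule inv_fourier_L2[OF h])
  show eq: "eq_ae (fourier k) (\<lambda>\<xi>. indicator {0..real n} \<xi> * h \<xi>)"
    unfolding k_def by (rule fourier_inv_fourier[OF h])
  then have "AE \<xi> in lborel. \<xi> < 0 \<longrightarrow> fourier k \<xi> = 0"
    unfolding eq_ae_def by eventually_elim auto
  then have "k \<in> Hardy" using k by (simp add: Hardy_def)
  moreover have "k \<in> Sobolev1"
  proof -
    have "AE \<xi> in lborel. norm (complex_of_real \<xi> * fourier k \<xi>) \<le> norm (of_real (real n) * fourier k \<xi>)"
      using eq unfolding eq_ae_def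
      by eventually_elim (auto simp: norm_mult indicator_def intro!: mult_right_mono)
    then show ?thesis
      unfolding Sobolev1_iff[OF k]
      by (rule L2_dominated[OF measurable_mult_fourier[OF k] L2_cmult[OF fourier_L2[OF k]]])
  qed
  ultimately show "k \<in> Hardy \<inter> Sobolev1" by blast
qed

lemma l2_tendsto_by_fourier:
  assumes F: "\<And>n. F n \<in> L2" "f \<in> L2" and H: "l2_tendsto H h"
    and eq: "\<And>n. eq_ae (fourier (F n)) (H n)" "eq_ae (fourier f) h"
  shows "l2_tendsto F f"
proof -
  note HL = l2_tendstoD[OF H]
  have "l2_norm (\<lambda>x. F n x - f x) = (1 / sqrt (2 * pi)) * l2_norm (\<lambda>\<xi>. H n \<xi> - h \<xi>)" for n
  proof -
    have "l2_norm (fourier (\<lambda>x. F n x - f x)) = l2_norm (\<lambda>\<xi>. H n \<xi> - h \<xi>)"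
    proof (rule l2_norm_cong_AE)
      show "AE \<xi> in lborel. cmod (fourier (\<lambda>x. F n x - f x) \<xi>) = cmod (H n \<xi> - h \<xi>)"
        using fourier_diff[OF F(1)[of n] F(2)] eq(1)[of n] eq(2)
        unfolding eq_ae_def by eventually_elim simp
    qed (intro L2_measurable fourier_L2 L2_diff F HL)+
    then have "sqrt (2 * pi) * l2_norm (\<lambda>x. F n x - f x) = l2_norm (\<lambda>\<xi>. H n \<xi> - h \<xi>)"
      by (simp add: l2_norm_fourier L2_diff F)
    moreover have "sqrt (2 * pi) \<noteq> 0" by simp
    ultimately show ?thesis by (metis nonzero_mult_div_cancel_left times_divide_eq_left mult_1)
  qed
  then show ?thesis
    using F tendsto_mult_left[OF HL(3), of "1 / sqrt (2 * pi)"] by (simp add: l2_tendsto_def)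
qed

lemma densely_defined_Hardy_Sobolev1: "densely_defined_in Hardy (Hardy \<inter> Sobolev1)"
  unfolding densely_defined_in_def
proof
  fix f assume f: "f \<in> Hardy"
  have fL: "f \<in> L2" by (rule Hardy_L2[OF f])
  have [measurable]: "fourier f \<in> borel_measurable borel"
    by (rule L2_measurable[OF fourier_L2[OF fL]])
  define H where "H n \<xi> = indicator {0..real n} \<xi> * fourier f \<xi>" for n \<xi>
  have HL: "H n \<in> L2" for n
    unfolding H_def by (intro L2_indicator_mult fourier_L2 fL) auto
  note k = inv_fourier_band_limited[OF HL[unfolded H_def[abs_def]], folded H_def]
  have "l2_tendsto H (fourier f)"
  proof (rule l2_tendsto_dominated[where w="\<lambda>\<xi>. norm (fourier f \<xi>)"])
    show "(\<lambda>\<xi>. norm (fourier f \<xi>)) \<in> L2"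
      using fourier_L2[OF fL] by (auto simp: L2_iff)
    have "AE \<xi> in lborel. \<xi> < 0 \<longrightarrow> fourier f \<xi> = 0" using f by (simp add: Hardy_def)
    then show "AE \<xi> in lborel. (\<lambda>n. H n \<xi>) \<longlonglongrightarrow> fourier f \<xi>"
    proof eventually_elim
      case (elim \<xi>)
      obtain N :: nat where N: "\<xi> \<le> real N" using real_arch_simple by blast
      have "\<forall>\<^sub>F n in sequentially. H n \<xi> = fourier f \<xi>"
        using eventually_ge_at_top[of N] by eventually_elim (use N elim in \<open>auto simp: H_def indicator_def\<close>)
      then show ?case by (rule tendsto_eventually)
    qed
    show "H n \<in> borel_measurable borel" for n by (rule L2_measurable[OF HL])
  qed (auto simp: H_def indicator_def)
  then have "l2_tendsto (\<lambda>n. inv_fourier (H n)) f"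
    by (rule l2_tendsto_by_fourier[OF inv_fourier_L2[OF HL] fL _ k(2) eq_ae_refl])
  with k(1) show "\<exists>F. (\<forall>n. F n \<in> Hardy \<inter> Sobolev1) \<and> l2_tendsto F f"
    by (intro exI[of _ "\<lambda>n. inv_fourier (H n)"]) auto
qed

section \<open>Self-adjointness of bounded symmetric perturbations\<close>

lemma linear_operator_inD:
  assumes "linear_operator_in H D A"
  shows "D \<subseteq> H" "\<And>f. f \<in> D \<Longrightarrow> A f \<in> H" "(\<lambda>x. 0) \<in> D"
    "\<And>f g. f \<in> D \<Longrightarrow> g \<in> D \<Longrightarrow>
      (\<lambda>x. f x + g x) \<in> D \<and> eq_ae (A (\<lambda>x. f x + g x)) (\<lambda>x. A f x + A g x)"
    "\<And>c f. f \<in> D \<Longrightarrow> (\<lambda>x. c * f x) \<in> D \<and> eq_ae (A (\<lambda>x. c * f x)) (\<lambda>x. c * A f x)"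
    "\<And>f g. f \<in> D \<Longrightarrow> g \<in> L2 \<Longrightarrow> eq_ae f g \<Longrightarrow> g \<in> D \<and> eq_ae (A f) (A g)"
proof -
  note c1 = assms[unfolded linear_operator_in_def]
  note c2 = conjunct2[OF c1] note c3 = conjunct2[OF c2] note c4 = conjunct2[OF c3]
  note c5 = conjunct2[OF c4] note c6 = conjunct2[OF c5]
  show "D \<subseteq> H" by (rule conjunct1[OF c1])
  show "A f \<in> H" if "f \<in> D" for f by (rule bspec[OF conjunct1[OF c2] that])
  show "(\<lambda>x. 0) \<in> D" by (rule conjunct1[OF c3])
  show "(\<lambda>x. f x + g x) \<in> D \<and> eq_ae (A (\<lambda>x. f x + g x)) (\<lambda>x. A f x + A g x)"
    if "f \<in> D" "g \<in> D" for f g by (rule bspec[OF bspec[OF conjunct1[OF c4] that(1)] that(2)])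
  show "(\<lambda>x. c * f x) \<in> D \<and> eq_ae (A (\<lambda>x. c * f x)) (\<lambda>x. c * A f x)" if "f \<in> D" for c f
    by (rule bspec[OF spec[OF conjunct1[OF c5]] that])
  show "g \<in> D \<and> eq_ae (A f) (A g)" if "f \<in> D" "g \<in> L2" "eq_ae f g" for f g
    by (rule mp[OF bspec[OF bspec[OF c6 that(1)] that(2)] that(3)])
qed

lemma linear_operator_diff:
  assumes A: "linear_operator_in Hardy D A" and K: "linear_operator_in Hardy E K" and DE: "D \<subseteq> E"
  shows "linear_operator_in Hardy D (\<lambda>f x. A f x - K f x)"
  unfolding linear_operator_in_def
proof (intro conjI ballI allI impI)
  note A' = linear_operator_inD[OF A] and K' = linear_operator_inD[OF K]
  show "D \<subseteq> Hardy" "(\<lambda>x. 0) \<in> D" by (fact A')+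
  fix f assume f: "f \<in> D"
  then have fE: "f \<in> E" using DE by blast
  show "(\<lambda>x. A f x - K f x) \<in> Hardy" by (rule Hardy_diff[OF A'(2)[OF f] K'(2)[OF fE]])
  { fix g assume g: "g \<in> D"
    then have gE: "g \<in> E" using DE by blast
    show "(\<lambda>x. f x + g x) \<in> D" using A'(4)[OF f g] by (rule conjunct1)
    show "eq_ae (\<lambda>x. A (\<lambda>x. f x + g x) x - K (\<lambda>x. f x + g x) x)
        (\<lambda>x. A f x - K f x + (A g x - K g x))"
      using conjunct2[OF A'(4)[OF f g]] conjunct2[OF K'(4)[OF fE gE]]
      unfolding eq_ae_def by eventually_elim simp }
  { fix c
    show "(\<lambda>x. c * f x) \<in> D" using A'(5)[OF f] by (rule conjunct1)
    show "eq_ae (\<lambda>x. A (\<lambda>x. c * f x) x - K (\<lambda>x. c * f x) x) (\<lambda>x. c * (A f x - K f x))"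
      using conjunct2[OF A'(5)[OF f, of c]] conjunct2[OF K'(5)[OF fE, of c]]
      unfolding eq_ae_def by eventually_elim (simp add: right_diff_distrib) }
  { fix g assume g: "g \<in> L2" "eq_ae f g"
    show "g \<in> D" using A'(6)[OF f g] by (rule conjunct1)
    show "eq_ae (\<lambda>x. A f x - K f x) (\<lambda>x. A g x - K g x)"
      using conjunct2[OF A'(6)[OF f g]] conjunct2[OF K'(6)[OF fE g]]
      unfolding eq_ae_def by eventually_elim simp }
qed

text \<open>
  Testing with the function whose transform is \<open>\<xi> F g(\<xi>) - F k(\<xi>)\<close> cut off to \<open>[0, n]\<close> shows
  that this difference vanishes on \<open>[0, n]\<close>; the cutoff is needed because nothing is known about
  the growth of \<open>\<xi> F g(\<xi>)\<close> beforehand. Hence \<open>\<xi> F g = F k\<close> is square-integrable, and the adjoint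
  of the momentum operator has no larger domain than the operator itself.
\<close>

lemma momentum_adjoint:
  assumes g: "g \<in> Hardy" and k: "k \<in> Hardy"
    and adj: "\<And>f. f \<in> Hardy \<inter> Sobolev1 \<Longrightarrow> l2_inner (momentum f) g = l2_inner f k"
  shows "g \<in> Sobolev1" "eq_ae k (momentum g)"
proof -
  have gL: "g \<in> L2" and kL: "k \<in> L2" using g k by (auto intro: Hardy_L2)
  have [measurable]: "fourier g \<in> borel_measurable borel" "fourier k \<in> borel_measurable borel"
    using gL kL by (auto intro!: L2_measurable fourier_L2)
  define v where "v \<xi> = complex_of_real \<xi> * fourier g \<xi> - fourier k \<xi>" for \<xi>
  have v0: "AE \<xi> in lborel. indicator {0..real n} \<xi> * v \<xi> = 0" for n
  proof -
    define w where "w \<xi> = indicator {0..real n} \<xi> * v \<xi>" for \<xi>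
    have w: "w \<in> L2"
    proof -
      have "(\<lambda>\<xi>. (indicator {0..real n} \<xi> * complex_of_real \<xi>) * fourier g \<xi>) \<in> L2"
        by (rule L2_bounded_mult[OF fourier_L2[OF gL], where C="real n"])
           (auto simp: indicator_def norm_mult)
      moreover have "(\<lambda>\<xi>. indicator {0..real n} \<xi> * fourier k \<xi>) \<in> L2"
        by (intro L2_indicator_mult fourier_L2 kL) auto
      ultimately have "(\<lambda>\<xi>. (indicator {0..real n} \<xi> * complex_of_real \<xi>) * fourier g \<xi>
          - indicator {0..real n} \<xi> * fourier k \<xi>) \<in> L2"
        by (rule L2_diff)
      then show ?thesis by (simp add: w_def[abs_def] v_def right_diff_distrib mult.assoc)
    qed
    define f where "f = inv_fourier w"
    have f: "f \<in> Hardy \<inter> Sobolev1" and Ff: "eq_ae (fourier f) w"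
      unfolding f_def w_def[abs_def]
      by (rule inv_fourier_band_limited[OF w[unfolded w_def[abs_def]]])+
    have fS: "f \<in> Sobolev1" and fL: "f \<in> L2" using f by (auto intro: Hardy_L2)
    note pf = fourier_momentum[OF fS]
    have "l2_inner (fourier (momentum f)) (fourier g) = l2_inner (fourier f) (fourier k)"
      using adj[OF f] by (simp add: fourier_parseval pf gL fL kL)
    moreover have "l2_inner (fourier (momentum f)) (fourier g) - l2_inner (fourier f) (fourier k) = l2_inner w w"
      unfolding l2_inner_def
    proof (subst Bochner_Integration.integral_diff[symmetric])
      show "(LINT \<xi>|lborel. fourier (momentum f) \<xi> * cnj (fourier g \<xi>) - fourier f \<xi> * cnj (fourier k \<xi>))
          = (LINT \<xi>|lborel. w \<xi> * cnj (w \<xi>))"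
      proof (rule integral_cong_AE)
        show "AE \<xi> in lborel. fourier (momentum f) \<xi> * cnj (fourier g \<xi>) - fourier f \<xi> * cnj (fourier k \<xi>)
            = w \<xi> * cnj (w \<xi>)"
          using pf(2) Ff unfolding eq_ae_def
        proof eventually_elim
          case (elim \<xi>)
          have *: "w \<xi> * cnj (w \<xi>) = w \<xi> * cnj (v \<xi>)"
            by (simp add: w_def indicator_def)
          show ?case unfolding * elim by (simp add: v_def algebra_simps)
        qed
      qed (use L2_measurable[OF w] L2_measurable[OF fourier_L2[OF pf(1)]] L2_measurable[OF fourier_L2[OF fL]] in measurable)
    qed (intro L2_integrable_inner fourier_L2 pf gL fL kL)+
    ultimately have "l2_norm w = 0" by (simp add: l2_inner_self)
    then show ?thesis by (simp add: l2_norm_eq_0_iff[OF w]) (simp add: w_def)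
  qed
  have all: "AE \<xi> in lborel. \<forall>n. indicator {0..real n} \<xi> * v \<xi> = 0"
    unfolding AE_all_countable by (intro allI v0)
  have "AE \<xi> in lborel. \<xi> < 0 \<longrightarrow> fourier g \<xi> = 0" "AE \<xi> in lborel. \<xi> < 0 \<longrightarrow> fourier k \<xi> = 0"
    using g k by (auto simp: Hardy_def)
  with all have eq: "AE \<xi> in lborel. fourier k \<xi> = complex_of_real \<xi> * fourier g \<xi>"
  proof eventually_elim
    case (elim \<xi>)
    show ?case
    proof (cases "\<xi> < 0")
      case False
      obtain n :: nat where "\<xi> \<le> real n" using real_arch_simple by blast
      with False elim(1) show ?thesis by (auto simp: v_def indicator_def dest!: spec[of _ n])
    qed (use elim in simp)
  qed
  then have "(\<lambda>\<xi>. complex_of_real \<xi> * fourier g \<xi>) \<in> L2"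
    by (rule L2_cong_AE[OF fourier_L2[OF kL] measurable_mult_fourier[OF gL]])
  then show gS: "g \<in> Sobolev1" by (simp add: Sobolev1_iff[OF gL])
  show "eq_ae k (momentum g)"
    by (rule eq_ae_by_fourier[OF kL fourier_momentum(1)[OF gS] _ fourier_momentum(2)[OF gS]])
       (simp add: eq_ae_def eq)
qed

text \<open>
  The symmetric bounded operator \<open>cauchy_mult u\<close> can be moved to the right-hand side of the adjoint
  relation, where it turns \<open>h\<close> into \<open>h + cauchy_mult u g\<close>.
\<close>

lemma self_adjoint_Lax:
  assumes u: "u \<in> Linf"
  shows "self_adjoint_in Hardy (Hardy \<inter> Sobolev1) (Lax u)"
proof -
  have lin: "linear_operator_in Hardy (Hardy \<inter> Sobolev1) (Lax u)"
    using linear_operator_diff[OF linear_operator_momentum linear_operator_cauchy_mult[OF u]]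
    unfolding Lax_def[abs_def] by simp
  have inner_Lax: "l2_inner (Lax u f) g = l2_inner (momentum f) g - l2_inner (cauchy_mult u f) g"
    if "f \<in> Hardy \<inter> Sobolev1" "g \<in> L2" for f g
    unfolding Lax_def using that
    by (intro l2_inner_diff_left fourier_momentum(1) cauchy_mult_L2 u) (auto intro: Hardy_L2)
  have "adjoint_graph Hardy (Hardy \<inter> Sobolev1) (Lax u) = operator_graph Hardy (Hardy \<inter> Sobolev1) (Lax u)"
  proof (intro set_eqI iffI)
    fix p assume p: "p \<in> adjoint_graph Hardy (Hardy \<inter> Sobolev1) (Lax u)"
    obtain g h where gh: "p = (g, h)" by (cases p)
    have g: "g \<in> Hardy" and h: "h \<in> Hardy"
      and adj: "\<And>f. f \<in> Hardy \<inter> Sobolev1 \<Longrightarrow> l2_inner (Lax u f) g = l2_inner f h"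
      using p by (auto simp: gh adjoint_graph_def)
    note L = Hardy_L2[OF g] Hardy_L2[OF h]
    have Tg: "cauchy_mult u g \<in> Hardy" by (rule cauchy_mult_Hardy[OF u L(1)])
    define k where "k x = h x + cauchy_mult u g x" for x
    have k: "k \<in> Hardy" unfolding k_def[abs_def] by (rule Hardy_add[OF h Tg])
    have "l2_inner (momentum f) g = l2_inner f k" if f: "f \<in> Hardy \<inter> Sobolev1" for f
    proof -
      have "l2_inner (momentum f) g = l2_inner f h + l2_inner f (cauchy_mult u g)"
        using inner_Lax[OF f L(1)] adj[OF f] cauchy_mult_symmetric[OF u _ g, of f] f by simp
      also have "\<dots> = l2_inner f k"
        unfolding k_def[abs_def] using f
        by (intro l2_inner_add_right[symmetric] L Hardy_L2[OF Tg]) (auto intro: Hardy_L2)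
      finally show ?thesis .
    qed
    from momentum_adjoint[OF g k this] have gS: "g \<in> Sobolev1" and eq: "eq_ae k (momentum g)"
      by auto
    have "eq_ae h (Lax u g)"
      using eq unfolding eq_ae_def by eventually_elim (simp add: k_def Lax_def eq_diff_eq)
    then show "p \<in> operator_graph Hardy (Hardy \<inter> Sobolev1) (Lax u)"
      using g gS h by (simp add: gh operator_graph_def)
  next
    fix p assume p: "p \<in> operator_graph Hardy (Hardy \<inter> Sobolev1) (Lax u)"
    obtain g h where gh: "p = (g, h)" by (cases p)
    have g: "g \<in> Hardy" "g \<in> Sobolev1" and h: "h \<in> Hardy" and eq: "eq_ae h (Lax u g)"
      using p by (auto simp: gh operator_graph_def)
    note gL = Hardy_L2[OF g(1)]
    have "l2_inner (Lax u f) g = l2_inner f h" if f: "f \<in> Hardy \<inter> Sobolev1" for f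
    proof -
      have fH: "f \<in> Hardy" "f \<in> Sobolev1" and fL: "f \<in> L2" using f by (auto intro: Hardy_L2)
      have "l2_inner (Lax u f) g = l2_inner f (momentum g) - l2_inner f (cauchy_mult u g)"
        unfolding inner_Lax[OF f gL] momentum_symmetric[OF fH(2) g(2)] cauchy_mult_symmetric[OF u fH(1) g(1)] ..
      also have "\<dots> = l2_inner f (Lax u g)"
        unfolding Lax_def
        by (rule l2_inner_diff_right[OF fourier_momentum(1)[OF g(2)] cauchy_mult_L2[OF u gL] fL, symmetric])
      also have "\<dots> = l2_inner f h"
        using linear_operator_inD(2)[OF lin, of g] g
        by (intro l2_inner_cong_AE fL Hardy_L2[OF h] eq_ae_refl eq_ae_sym[OF eq]) (auto intro: Hardy_L2)
      finally show ?thesis .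
    qed
    then show "p \<in> adjoint_graph Hardy (Hardy \<inter> Sobolev1) (Lax u)"
      using g h by (simp add: gh adjoint_graph_def)
  qed
  with lin densely_defined_Hardy_Sobolev1 show ?thesis
    by (simp add: self_adjoint_in_def)
qed

section \<open>Relative compactness\<close>

text \<open>
  \<open>freq_weight\<close> makes \<open>\<parallel>freq_weight * F f\<parallel>\<close> a graph norm of the momentum operator, and
  point evaluation at \<open>x\<close> becomes the inner product with \<open>eval_at x\<close>.
\<close>

definition freq_weight :: "real \<Rightarrow> real" where
  "freq_weight \<xi> = sqrt (1 + \<xi>\<^sup>2)"

definition eval_at :: "real \<Rightarrow> real \<Rightarrow> complex" where
  "eval_at x \<xi> = fker \<xi> x * of_real (1 / freq_weight \<xi>)"

lemma freq_weight_pos: "freq_weight \<xi> > 0"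
proof -
  have "1 + \<xi>\<^sup>2 > 0" using zero_le_power2[of \<xi>] by linarith
  then show ?thesis by (simp add: freq_weight_def)
qed

lemma freq_weight_square: "(freq_weight \<xi>)\<^sup>2 = 1 + \<xi>\<^sup>2"
  by (simp add: freq_weight_def)

lemma freq_weight_measurable [measurable]: "freq_weight \<in> borel_measurable borel"
  unfolding freq_weight_def by measurable

lemma eval_at_measurable [measurable]: "eval_at x \<in> borel_measurable borel"
  unfolding eval_at_def by measurable

lemma inverse_freq_weight_L2: "(\<lambda>\<xi>. 1 / freq_weight \<xi>) \<in> L2"
proof -
  have "integrable lborel (\<lambda>\<xi>::real. inverse (1 + \<xi>\<^sup>2))"
    using integrable_inverse_1_plus_square by (simp add: set_integrable_def)
  then have "integrable lborel (\<lambda>\<xi>. (norm (1 / freq_weight \<xi>))\<^sup>2)"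
    by (simp add: power_divide freq_weight_square inverse_eq_divide)
  then show ?thesis by (simp add: L2_iff)
qed

lemma norm_eval_at: "norm (eval_at x \<xi>) = 1 / freq_weight \<xi>"
  using freq_weight_pos[of \<xi>] by (simp add: eval_at_def norm_divide)

lemma eval_at_L2: "eval_at x \<in> L2"
  by (rule L2_dominated[OF eval_at_measurable inverse_freq_weight_L2])
     (simp add: norm_eval_at abs_of_pos[OF freq_weight_pos])

lemma l2_norm_eval_at: "l2_norm (eval_at x) = l2_norm (eval_at 0)"
  by (rule l2_norm_cong_AE) (simp_all add: norm_eval_at)

lemma l2_tendsto_eval_at:
  assumes "y \<longlonglongrightarrow> x"
  shows "l2_tendsto (\<lambda>n. eval_at (y n)) (eval_at x)"
proof (rule l2_tendsto_dominated[OF eval_at_measurable eval_at_measurable inverse_freq_weight_L2])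
  show "AE \<xi> in lborel. norm (eval_at (y n) \<xi>) \<le> 1 / freq_weight \<xi>" for n
    by (simp add: norm_eval_at)
  have "(\<lambda>n. fker (y n) \<xi>) \<longlonglongrightarrow> fker x \<xi>" for \<xi>
    using continuous_on_tendsto_compose[OF continuous_fker assms, of UNIV] by simp
  then show "AE \<xi> in lborel. (\<lambda>n. eval_at (y n) \<xi>) \<longlonglongrightarrow> eval_at x \<xi>"
    unfolding eval_at_def fker_commute[of _ "y _"] fker_commute[of _ x]
    by (intro AE_I2 tendsto_intros)
qed

lemma Sobolev1_weighted_fourier:
  assumes f: "f \<in> Sobolev1"
  shows "(\<lambda>\<xi>. of_real (freq_weight \<xi>) * fourier f \<xi>) \<in> L2"
    and "(l2_norm (\<lambda>\<xi>. of_real (freq_weight \<xi>) * fourier f \<xi>))\<^sup>2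
      = 2 * pi * ((l2_norm f)\<^sup>2 + (l2_norm (momentum f))\<^sup>2)"
proof -
  note L = Sobolev1_L2[OF f] and p = fourier_momentum[OF f]
  have [measurable]: "fourier f \<in> borel_measurable borel"
    by (rule L2_measurable[OF fourier_L2[OF L]])
  have xi: "(\<lambda>\<xi>. complex_of_real \<xi> * fourier f \<xi>) \<in> L2"
    using f L by (simp add: Sobolev1_iff)
  note int = L2_integrable_square[OF fourier_L2[OF L]] L2_integrable_square[OF xi]
  have eq: "(norm (of_real (freq_weight \<xi>) * fourier f \<xi>))\<^sup>2
      = (norm (fourier f \<xi>))\<^sup>2 + (norm (complex_of_real \<xi> * fourier f \<xi>))\<^sup>2" for \<xi>
    by (simp add: norm_mult power_mult_distrib freq_weight_square distrib_right)
  show "(\<lambda>\<xi>. of_real (freq_weight \<xi>) * fourier f \<xi>) \<in> L2"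
    unfolding L2_iff eq using int by (intro conjI Bochner_Integration.integrable_add) measurable
  have "l2_norm (\<lambda>\<xi>. complex_of_real \<xi> * fourier f \<xi>) = l2_norm (fourier (momentum f))"
  proof (rule l2_norm_cong_AE)
    show "AE \<xi> in lborel. cmod (complex_of_real \<xi> * fourier f \<xi>) = cmod (fourier (momentum f) \<xi>)"
      using p(2) unfolding eq_ae_def by eventually_elim simp
  qed (intro L2_measurable xi fourier_L2 p)+
  then show "(l2_norm (\<lambda>\<xi>. of_real (freq_weight \<xi>) * fourier f \<xi>))\<^sup>2
      = 2 * pi * ((l2_norm f)\<^sup>2 + (l2_norm (momentum f))\<^sup>2)"
    unfolding l2_norm_square eq Bochner_Integration.integral_add[OF int]
    unfolding l2_norm_square[symmetric]
    by (simp add: l2_norm_fourier L p power_mult_distrib distrib_left)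
qed

text \<open>
  Up to null sets this is \<open>f\<close> by Fourier inversion, the weight being cancelled by \<open>eval_at x\<close>.
\<close>

definition cont_rep :: "(real \<Rightarrow> complex) \<Rightarrow> real \<Rightarrow> complex" where
  "cont_rep f x = of_real (1 / (2 * pi)) *
     l2_inner (\<lambda>\<xi>. of_real (freq_weight \<xi>) * fourier f \<xi>) (eval_at x)"

text \<open>
  Inversion by an integral is possible because \<open>F f\<close>, the product of the square-integrable functions
  \<open>freq_weight * F f\<close> and \<open>1 / freq_weight\<close>, is integrable.
\<close>

lemma cont_rep:
  assumes f: "f \<in> Sobolev1"
  shows "cont_rep f \<in> borel_measurable borel" "eq_ae f (cont_rep f)"
proof -
  note L = Sobolev1_L2[OF f] and W = Sobolev1_weighted_fourier(1)[OF f]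
  have [measurable]: "fourier f \<in> borel_measurable borel"
    by (rule L2_measurable[OF fourier_L2[OF L]])
  have w0: "complex_of_real (freq_weight \<xi>) \<noteq> 0" for \<xi>
    using freq_weight_pos[of \<xi>] by simp
  define h where "h \<xi> = cnj (fourier f \<xi>)" for \<xi>
  have hL: "h \<in> L2" unfolding h_def by (intro L2_cnj fourier_L2 L)
  have h_int: "integrable lborel h"
  proof -
    have "integrable lborel (\<lambda>\<xi>. of_real (freq_weight \<xi>) * fourier f \<xi> * eval_at 0 \<xi>)"
      by (rule L2_integrable_mult[OF W eval_at_L2])
    then have "integrable lborel (fourier f)"
      using w0 by (simp add: eval_at_def)
    then show ?thesis unfolding h_def by simp
  qed
  have rep: "cont_rep f x = of_real (1 / (2 * pi)) * cnj (FT h x)" for x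
  proof -
    have "l2_inner (\<lambda>\<xi>. of_real (freq_weight \<xi>) * fourier f \<xi>) (eval_at x) = cnj (FT h x)"
      unfolding l2_inner_def FT_def Bochner_Integration.integral_cnj[symmetric]
      by (rule Bochner_Integration.integral_cong) (use w0 in \<open>simp_all add: eval_at_def h_def\<close>)
    then show ?thesis by (simp only: cont_rep_def)
  qed
  have [measurable]: "h \<in> borel_measurable borel" by (rule L2_measurable[OF hL])
  show "cont_rep f \<in> borel_measurable borel"
    unfolding rep[abs_def] by measurable
  have "eq_ae f (inv_fourier (fourier f))"
    by (rule eq_ae_inv_fourier[OF L fourier_L2[OF L] eq_ae_refl])
  moreover have "eq_ae (inv_fourier (fourier f)) (cont_rep f)"
    using fourier_eq_FT[OF h_int hL] unfolding eq_ae_def inv_fourier_def h_def[symmetric] rep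
    by eventually_elim simp
  ultimately show "eq_ae f (cont_rep f)" by (rule eq_ae_trans)
qed

text \<open>
  A sequence bounded in \<open>H\<^sup>1\<close> has a subsequence whose continuous representatives converge at
  every point: at the rationals by diagonal extraction, and elsewhere because \<open>x \<mapsto> eval_at x\<close> is
  continuous into \<open>L\<^sup>2\<close>, which makes the representatives equicontinuous.
\<close>

lemma Sobolev1_pointwise_convergent_subsequence:
  fixes F :: "nat \<Rightarrow> real \<Rightarrow> complex"
  assumes F: "\<And>n. F n \<in> Sobolev1" and A: "\<And>n. l2_norm (F n) \<le> A" and B: "\<And>n. l2_norm (momentum (F n)) \<le> B"
  shows "\<exists>C (r :: nat \<Rightarrow> nat) c. strict_mono r \<and> (\<forall>n x. norm (cont_rep (F n) x) \<le> C) \<and>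
    (\<forall>x. (\<lambda>n. cont_rep (F (r n)) x) \<longlonglongrightarrow> c x)"
proof -
  define V where "V n \<xi> = of_real (freq_weight \<xi>) * fourier (F n) \<xi>" for n \<xi>
  have V: "V n \<in> L2" for n
    unfolding V_def by (rule Sobolev1_weighted_fourier(1)[OF F])
  define M where "M = sqrt (2 * pi * (A\<^sup>2 + B\<^sup>2))"
  have VM: "l2_norm (V n) \<le> M" for n
  proof (rule power2_le_imp_le)
    have "(l2_norm (F n))\<^sup>2 \<le> A\<^sup>2" "(l2_norm (momentum (F n)))\<^sup>2 \<le> B\<^sup>2"
      using A B by (auto intro!: power_mono)
    then have "(l2_norm (V n))\<^sup>2 \<le> 2 * pi * (A\<^sup>2 + B\<^sup>2)"
      unfolding V_def Sobolev1_weighted_fourier(2)[OF F] by (intro mult_left_mono) auto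
    then show "(l2_norm (V n))\<^sup>2 \<le> M\<^sup>2" by (simp add: M_def)
  qed (simp add: M_def)
  have M0: "0 \<le> M" by (simp add: M_def)
  have rep: "cont_rep (F n) x = of_real (1 / (2 * pi)) * l2_inner (V n) (eval_at x)" for n x
    by (simp add: cont_rep_def V_def[abs_def])
  have inner_le: "norm (of_real (1 / (2 * pi)) * l2_inner (V n) e) \<le> M * l2_norm e" if "e \<in> L2" for n e
  proof -
    have "norm (complex_of_real (1 / (2 * pi))) \<le> 1"
      using pi_gt3 by (simp add: norm_divide)
    moreover have "norm (l2_inner (V n) e) \<le> M * l2_norm e"
      using norm_l2_inner_le[OF V that, of n] mult_right_mono[OF VM, of "l2_norm e" n] by simp
    ultimately show ?thesis
      unfolding norm_mult using mult_mono[of _ 1 _ "M * l2_norm e"] by fastforce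
  qed
  define C where "C = M * l2_norm (eval_at 0)"
  have C: "norm (cont_rep (F n) x) \<le> C" for n x
    using inner_le[OF eval_at_L2, of n x] unfolding rep C_def l2_norm_eval_at[of x] .
  have equi: "dist (cont_rep (F n) x) (cont_rep (F n) y) \<le> M * l2_norm (\<lambda>\<xi>. eval_at x \<xi> - eval_at y \<xi>)" for n x y
    using inner_le[OF L2_diff[OF eval_at_L2 eval_at_L2], of n x y]
    unfolding rep dist_norm right_diff_distrib[symmetric]
      l2_inner_diff_right[OF eval_at_L2 eval_at_L2 V] .
  obtain r :: "nat \<Rightarrow> nat" where r: "strict_mono r"
    and conv: "\<And>q. q \<in> \<rat> \<Longrightarrow> \<exists>l. (\<lambda>n. cont_rep (F (r n)) q) \<longlonglongrightarrow> l"
    using function_convergent_subsequence[of "\<rat> :: real set" "\<lambda>n. cont_rep (F n)" C] countable_rat C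
    by auto
  have "convergent (\<lambda>n. cont_rep (F (r n)) x)" for x
  proof -
    have "\<exists>q. q \<in> \<rat> \<and> x < q \<and> q < x + inverse (real (Suc k))" for k
      using Rats_dense_in_real[of x "x + inverse (real (Suc k))"] by auto
    then obtain q where q: "\<And>k. q k \<in> \<rat>" "\<And>k. x < q k" "\<And>k. q k < x + inverse (real (Suc k))"
      by metis
    have "q \<longlonglongrightarrow> x"
    proof (rule tendsto_sandwich[where f="\<lambda>_. x" and h="\<lambda>k. x + inverse (real (Suc k))"])
      show "(\<lambda>k. x + inverse (real (Suc k))) \<longlonglongrightarrow> x"
        using tendsto_add[OF tendsto_const LIMSEQ_inverse_real_of_nat] by simp
    qed (use q in \<open>auto intro!: always_eventually less_imp_le\<close>)
    then have lim: "(\<lambda>k. M * l2_norm (\<lambda>\<xi>. eval_at (q k) \<xi> - eval_at x \<xi>)) \<longlonglongrightarrow> 0"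
      using tendsto_mult_left[OF l2_tendstoD(3)[OF l2_tendsto_eval_at]] by fastforce
    have "Cauchy (\<lambda>n. cont_rep (F (r n)) x)"
    proof (rule metric_CauchyI)
      fix e :: real assume e: "e > 0"
      then have "\<forall>\<^sub>F k in sequentially. M * l2_norm (\<lambda>\<xi>. eval_at (q k) \<xi> - eval_at x \<xi>) < e / 3"
        using order_tendstoD(2)[OF lim, of "e / 3"] by simp
      then obtain k where k: "M * l2_norm (\<lambda>\<xi>. eval_at (q k) \<xi> - eval_at x \<xi>) < e / 3"
        by (auto simp: eventually_sequentially)
      from conv[OF q(1)[of k]] have "Cauchy (\<lambda>n. cont_rep (F (r n)) (q k))"
        by (auto intro: LIMSEQ_imp_Cauchy)
      then obtain N where N: "\<And>m n. m \<ge> N \<Longrightarrow> n \<ge> N \<Longrightarrow>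
          dist (cont_rep (F (r m)) (q k)) (cont_rep (F (r n)) (q k)) < e / 3"
        using e metric_CauchyD[of _ "e / 3"] by (metis divide_pos_pos zero_less_numeral)
      have near: "dist (cont_rep (F (r n)) (q k)) (cont_rep (F (r n)) x) < e / 3" for n
        using equi[of "r n" "q k" x] k by simp
      have "dist (cont_rep (F (r m)) x) (cont_rep (F (r n)) x) < e" if "m \<ge> N" "n \<ge> N" for m n
        using near[of m] near[of n] N[OF that]
          dist_triangle[of "cont_rep (F (r m)) x" "cont_rep (F (r n)) x" "cont_rep (F (r m)) (q k)"]
          dist_triangle[of "cont_rep (F (r m)) (q k)" "cont_rep (F (r n)) x" "cont_rep (F (r n)) (q k)"]
        by (simp add: dist_commute)
      then show "\<exists>N. \<forall>m\<ge>N. \<forall>n\<ge>N. dist (cont_rep (F (r m)) x) (cont_rep (F (r n)) x) < e"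
        by blast
    qed
    then show ?thesis by (rule Cauchy_convergent)
  qed
  then have "(\<lambda>n. cont_rep (F (r n)) x) \<longlonglongrightarrow> lim (\<lambda>n. cont_rep (F (r n)) x)" for x
    by (simp add: convergent_LIMSEQ_iff)
  with r C show ?thesis
    by (intro exI[of _ C] exI[of _ r] exI[of _ "\<lambda>x. lim (\<lambda>n. cont_rep (F (r n)) x)"]) auto
qed

text \<open>
  The pointwise convergent representatives are bounded by a common constant \<open>C\<close>, so that their
  products with \<open>u\<close> are dominated by the square-integrable function \<open>C * \<bar>u\<bar>\<close> and converge in the
  mean.
\<close>

lemma relatively_compact_cauchy_mult:
  assumes uL2: "u \<in> L2" and u: "u \<in> Linf"
  shows "relatively_compact_in Hardy (Hardy \<inter> Sobolev1) momentum Hardy (cauchy_mult u)"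
  unfolding relatively_compact_in_def
proof (intro conjI linear_operator_momentum linear_operator_cauchy_mult u allI impI)
  show "Hardy \<inter> Sobolev1 \<subseteq> Hardy" by blast
  fix F :: "nat \<Rightarrow> real \<Rightarrow> complex"
  assume F: "\<forall>n. F n \<in> Hardy \<inter> Sobolev1"
    and bF: "bounded (range (\<lambda>n. l2_norm (F n)))" and bpF: "bounded (range (\<lambda>n. l2_norm (momentum (F n))))"
  have FH: "F n \<in> Hardy" and FS: "F n \<in> Sobolev1" for n using F by auto
  have [measurable]: "u \<in> borel_measurable borel" by (rule L2_measurable[OF uL2])
  from bF obtain A where A: "\<And>n. l2_norm (F n) \<le> A" by (auto simp: bounded_iff)
  from bpF obtain B where B: "\<And>n. l2_norm (momentum (F n)) \<le> B" by (auto simp: bounded_iff)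
  obtain C r c where r: "strict_mono (r :: nat \<Rightarrow> nat)" and C: "\<And>n x. norm (cont_rep (F n) x) \<le> C"
    and c: "\<And>x. (\<lambda>n. cont_rep (F (r n)) x) \<longlonglongrightarrow> c x"
    using Sobolev1_pointwise_convergent_subsequence[of F A B, OF FS A B] by blast
  have [measurable]: "cont_rep (F n) \<in> borel_measurable borel" for n
    by (rule cont_rep(1)[OF FS])
  have [measurable]: "c \<in> borel_measurable borel"
    by (rule borel_measurable_LIMSEQ_metric[OF _ c]) measurable
  have repL: "cont_rep (F n) \<in> L2" for n
    by (rule L2_cong_AE[OF Sobolev1_L2[OF FS] cont_rep(1)[OF FS]])
       (use cont_rep(2)[OF FS] in \<open>simp add: eq_ae_def\<close>)
  define G where "G n x = complex_of_real (u x) * cont_rep (F (r n)) x" for n x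
  define g where "g x = complex_of_real (u x) * c x" for x
  have Gg: "l2_tendsto G g"
  proof (rule l2_tendsto_dominated[where w="\<lambda>x. C * \<bar>u x\<bar>"])
    show "(\<lambda>x. C * \<bar>u x\<bar>) \<in> L2"
      using L2_integrable_square[OF uL2] by (simp add: L2_iff power_mult_distrib)
    show "AE x in lborel. norm (G n x) \<le> C * \<bar>u x\<bar>" for n
      using mult_right_mono[OF C[of "r n"] abs_ge_zero[of "u _"]]
      by (intro AE_I2) (simp add: G_def norm_mult mult.commute)
    show "AE x in lborel. (\<lambda>n. G n x) \<longlonglongrightarrow> g x"
      unfolding G_def g_def by (intro AE_I2 tendsto_intros c)
  qed (unfold G_def g_def, measurable)
  note GL = l2_tendstoD[OF Gg]
  have "l2_tendsto (\<lambda>n. cauchy_proj (G n)) (cauchy_proj g)"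
  proof (rule l2_tendsto_bounded_linear[OF Gg, where C=1])
    fix n
    have "l2_norm (\<lambda>x. cauchy_proj (G n) x - cauchy_proj g x) = l2_norm (cauchy_proj (\<lambda>x. G n x - g x))"
    proof (rule l2_norm_cong_AE)
      show "AE x in lborel. cmod (cauchy_proj (G n) x - cauchy_proj g x) = cmod (cauchy_proj (\<lambda>x. G n x - g x) x)"
        using cauchy_proj_diff[OF GL(1,2), of n] unfolding eq_ae_def by eventually_elim simp
    qed (intro L2_measurable L2_diff cauchy_proj_spec GL)+
    also have "\<dots> \<le> l2_norm (\<lambda>x. G n x - g x)"
      by (rule l2_norm_cauchy_proj_le[OF L2_diff[OF GL(1,2)]])
    finally show "l2_norm (\<lambda>x. cauchy_proj (G n) x - cauchy_proj g x) \<le> 1 * l2_norm (\<lambda>x. G n x - g x)"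
      by simp
  qed (intro cauchy_proj_spec GL)+
  moreover have "cauchy_mult u (F (r n)) = cauchy_proj (G n)" for n
    unfolding G_def by (rule cauchy_mult_eq[OF u FH repL cont_rep(2)[OF FS]])
  ultimately show "\<exists>r g. strict_mono r \<and> g \<in> Hardy \<and> l2_tendsto (\<lambda>n. cauchy_mult u (F (r n))) g"
    using r cauchy_proj_Hardy[OF GL(2)] by (intro exI[of _ r] exI[of _ "cauchy_proj g"]) simp
qed

theorem theorem1p1:
  fixes u :: "real \<Rightarrow> real"
  assumes "u \<in> L2" and "u \<in> Linf"
  shows "relatively_compact_in Hardy (Hardy \<inter> Sobolev1) momentum Hardy (cauchy_mult u) \<and>
         self_adjoint_in Hardy (Hardy \<inter> Sobolev1) (Lax u)"
  using relatively_compact_cauchy_mult[OF assms] self_adjoint_Lax[OF assms(2)] by blast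

end
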